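(* For all nonnegative $(n,p,e)$ on $\mathcal T^d$ satisfying the normalizations $\int_{\mathcal T^d}(n-p)\,dx=\mathbf C_0$ and $\int_{\mathcal T^d}e\,dx=E_0=e^*$, for which $\mathcal H(n,p,e)<\infty$, $\mathcal P(n,p,e)<\infty$ and $0<\underline e\le e(x)\le\bar e$ for all $x\in\mathcal T^d$, there exists a constant $$K=K\big(\kappa,\|n\|_{L^1},\|p\|_{L^1},n^*,p^*,\underline e,\bar e,e^*\big)>0,$$ depending on $(n,p,e)$ only through the listed arguments, such that $$\mathcal H(n,p,e)\le K\,\mathcal P(n,p,e).$$
   Context: $\mathcal T^d$ is the $d$-dimensional torus, rescaled so that $|\mathcal T^d|=1$. Fixed parameters: $\kappa>0$, $c>0$, constants $0<\underline e<\bar e$, $E_0>0$, $\mathbf C_0\in\mathbb R$, and a reaction coefficient $k$ with $0<\underline k\le k\le\bar k$ for constants $\underline k,\bar k$ (the constant $K$ may also depend on the fixed quantities $d$, $c$ and the bounds on $k$). Notation: $\lambda_B(\nu)=\nu\ln\nu-\nu+1$. $e^*=E_0$. $C_n,C_p>0$ are uniquely determined by $C_nC_p=1$ and $C_n-C_p=\mathbf C_0/\sqrt{e^*}$. $n^*=C_n\sqrt{e^*}$, $p^*=C_p\sqrt{e^*}$ (so $n^*p^*=e^*$). $w_n(e)=C_n\sqrt e$, $w_p(e)=C_p\sqrt e$. The relative entropy is $$\mathcal H(n,p,e)=\int_{\mathcal T^d}\Big\{w_n(e)\,\lambda_B\Big(\frac{n}{w_n(e)}\Big)+w_p(e)\,\lambda_B\Big(\frac{p}{w_p(e)}\Big)+\frac{c+C_n+C_p}{2\sqrt{e^*}}\big(\sqrt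 e-\sqrt{e^*}\big)^2\Big\}\,dx ,$$ and the entropy production is $$\mathcal P(n,p,e)=\int_{\mathcal T^d}\Big\{\kappa\Big(n\Big|\nabla\ln\frac{n}{\sqrt e}\Big|^2+p\Big|\nabla\ln\frac{p}{\sqrt e}\Big|^2+\frac N4\Big|\frac{\nabla e}{e}\Big|^2\Big)+k(np-e)\ln\frac{np}{e}\Big\}\,dx,\qquad N=n+p+c\sqrt e .$$ *)

theory Defs
  imports "HOL-Analysis.Analysis"
begin

text \<open>Functions on the torus are represented by functions on \<^typ>\<open>real ^ 'd\<close> that are periodic
  with respect to the integer lattice; integrals are taken over the unit cell, which has volume 1
  (the faces of the cube identified on the torus form a null set).\<close>

definition periodic :: "(real ^ 'd \<Rightarrow> 'b) \<Rightarrow> bool" where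
  "periodic f \<longleftrightarrow> (\<forall>x i. f (x + axis i 1) = f x)"

definition torus :: "(real ^ 'd) measure" where
  "torus = lebesgue_on (cbox 0 1)"

definition L1_norm :: "(real ^ 'd \<Rightarrow> real) \<Rightarrow> real" where
  "L1_norm f = (\<integral>x. \<bar>f x\<bar> \<partial>torus)"

text \<open>Membership in the Sobolev space \<open>W\<^sup>1\<^sup>,\<^sup>1\<close> of the torus with gradient \<open>g\<close>. As usual for
  first derivatives, \<open>C\<^sup>1\<close> test functions are used; on the torus no boundary condition beyond
  periodicity is imposed on them.\<close>

definition has_weak_gradient ::
    "(real ^ 'd \<Rightarrow> real) \<Rightarrow> (real ^ 'd \<Rightarrow> real ^ 'd) \<Rightarrow> bool" where
  "has_weak_gradient f g \<longleftrightarrow> integrable torus f \<and> integrable torus g \<and>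
     (\<forall>\<phi> \<psi>. periodic \<phi> \<and> continuous_on UNIV \<psi> \<and> (\<forall>x. GDERIV \<phi> x :> \<psi> x) \<longrightarrow>
        (\<integral>x. f x *\<^sub>R \<psi> x \<partial>torus) = - (\<integral>x. \<phi> x *\<^sub>R g x \<partial>torus))"

text \<open>The logarithm of a nonnegative density need not be locally integrable (the density may
  approach zero), so gradients are understood through truncations: \<open>g\<close> is the gradient of \<open>v\<close> if
  every truncation of \<open>v\<close> at levels \<open>\<plusminus>m\<close> is in \<open>W\<^sup>1\<^sup>,\<^sup>1\<close> with gradient \<open>g\<close> where \<open>\<bar>v\<bar> < m\<close>
  and zero elsewhere. Such a \<open>g\<close> is unique almost everywhere, and it is the weak gradient of \<open>v\<close>
  whenever \<open>v\<close> itself is in \<open>W\<^sup>1\<^sup>,\<^sup>1\<close>. For a density \<open>u\<close> that is positive almost everywhere,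
  \<open>ln u\<close> has a gradient \<open>g\<close> with \<open>u \<bar>g\<bar>\<^sup>2\<close> integrable iff \<open>sqrt u\<close> has a square integrable
  weak gradient, up to integrability of \<open>u\<close>.\<close>

definition truncate :: "real \<Rightarrow> real \<Rightarrow> real" where
  "truncate m s = max (- m) (min m s)"

definition has_gradient ::
    "(real ^ 'd \<Rightarrow> real) \<Rightarrow> (real ^ 'd \<Rightarrow> real ^ 'd) \<Rightarrow> bool" where
  "has_gradient v g \<longleftrightarrow>
     (\<forall>m>0. has_weak_gradient (\<lambda>x. truncate m (v x)) (\<lambda>x. if \<bar>v x\<bar> < m then g x else 0))"

definition gradient :: "(real ^ 'd \<Rightarrow> real) \<Rightarrow> real ^ 'd \<Rightarrow> real ^ 'd" where
  "gradient v = (SOME g. has_gradient v g)"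

text \<open>Since \<^term>\<open>0 * ln 0 = (0::real)\<close> the value at \<open>0\<close> is the limit \<open>1\<close>.\<close>

definition lambda_B :: "real \<Rightarrow> real" where
  "lambda_B \<nu> = \<nu> * ln \<nu> - \<nu> + 1"

text \<open>Entropy and production have nonnegative integrands and are allowed to be infinite;
  \<open>es\<close> stands for \<open>e\<^sup>*\<close>, and \<open>w\<^sub>n(e) = C\<^sub>n sqrt e\<close>, \<open>w\<^sub>p(e) = C\<^sub>p sqrt e\<close>.\<close>

definition rel_entropy ::
    "real \<Rightarrow> real \<Rightarrow> real \<Rightarrow> real \<Rightarrow> (real ^ 'd \<Rightarrow> real) \<Rightarrow> (real ^ 'd \<Rightarrow> real) \<Rightarrow> (real ^ 'd \<Rightarrow> real) \<Rightarrow> ennreal"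
  where
  "rel_entropy c Cn Cp es n p e =
     (\<integral>\<^sup>+x. ennreal
         (let wn = Cn * sqrt (e x); wp = Cp * sqrt (e x) in
          wn * lambda_B (n x / wn) + wp * lambda_B (p x / wp)
          + (c + Cn + Cp) / (2 * sqrt es) * (sqrt (e x) - sqrt es)\<^sup>2) \<partial>torus)"

text \<open>\<open>(np - e) ln (np / e)\<close> for \<open>n, p \<ge> 0\<close> and \<open>e > 0\<close>, with its limit \<open>\<infinity>\<close> at \<open>np = 0\<close>
  (where the library's convention \<open>ln 0 = 0\<close> would give the wrong value).\<close>

definition reaction_density :: "real \<Rightarrow> real \<Rightarrow> real \<Rightarrow> ennreal" where
  "reaction_density n p e =
     (if n * p = 0 then \<infinity> else ennreal ((n * p - e) * ln (n * p / e)))"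

text \<open>The production is infinite if one of the gradients does not exist. The junk value
  \<open>ln 0 = 0\<close> inside the gradients is harmless: if \<open>n\<close> or \<open>p\<close> vanishes on a set of positive
  measure, the reaction term is infinite. The reaction coefficient \<open>k\<close> may depend on \<open>x\<close>, in
  particular through \<open>n\<close>, \<open>p\<close>, \<open>e\<close>.\<close>

definition entropy_production ::
    "real \<Rightarrow> real \<Rightarrow> (real ^ 'd \<Rightarrow> real) \<Rightarrow> (real ^ 'd \<Rightarrow> real) \<Rightarrow> (real ^ 'd \<Rightarrow> real) \<Rightarrow> (real ^ 'd \<Rightarrow> real) \<Rightarrow> ennreal"
  where
  "entropy_production \<kappa> c k n p e =
     (let vn = (\<lambda>x. ln (n x / sqrt (e x))); vp = (\<lambda>x. ln (p x / sqrt (e x))) in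
      if (\<exists>g. has_gradient vn g) \<and> (\<exists>g. has_gradient vp g) \<and> (\<exists>g. has_gradient e g)
      then \<integral>\<^sup>+x. ennreal
              (\<kappa> * (n x * (norm (gradient vn x))\<^sup>2 + p x * (norm (gradient vp x))\<^sup>2
                    + (n x + p x + c * sqrt (e x)) / 4 * (norm (gradient e x /\<^sub>R e x))\<^sup>2))
            + ennreal (k x) * reaction_density (n x) (p x) (e x) \<partial>torus
      else \<infinity>)"

end

theory Submission
  imports Defs
begin

text \<open>Put \<open>a = sqrt (n / sqrt e)\<close> and \<open>b = sqrt (p / sqrt e)\<close>. As \<open>e\<close> lies between positive
constants, the production \<open>P\<close> bounds \<open>\<integral>\<bar>\<nabla>a\<bar>\<^sup>2\<close>, \<open>\<integral>\<bar>\<nabla>b\<bar>\<^sup>2\<close> and \<open>\<integral>\<bar>\<nabla>e\<bar>\<^sup>2\<close>, and by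
\<open>(r - 1)\<^sup>2 \<le> (r\<^sup>2 - 1) ln (r\<^sup>2)\<close> also \<open>\<integral>(a b - 1)\<^sup>2\<close>. The entropy density of \<open>n\<close> is of the order
of \<open>(a - sqrt C\<^sub>n)\<^sup>2\<close> where \<open>a\<close> is bounded and of the order of \<open>a\<^sup>2 ln (a\<^sup>2)\<close> where \<open>a\<close> is large
(\<open>lambda_B_le\<close>). Hence two things have to be shown.

First, \<open>a\<close> is close to \<open>sqrt C\<^sub>n\<close> in \<open>L\<^sup>2\<close>. By Poincare's inequality \<open>a\<close>, \<open>b\<close> and \<open>sqrt e\<close> are
close to the constants \<open>X = \<integral>a\<close>, \<open>Y = \<integral>b\<close> and \<open>sqrt e\<^sup>*\<close>. Therefore the smallness of the
reaction term forces \<open>X Y = 1\<close> and the conservation of charge forces \<open>X\<^sup>2 - Y\<^sup>2 = C\<^sub>n - C\<^sub>p\<close>, both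
up to errors of order \<open>sqrt P\<close> (\<open>product_mean\<close>, \<open>weighted_mass_near_mean\<close>). The identity
\<open>(X\<^sup>2 + Y\<^sup>2)\<^sup>2 = (X\<^sup>2 - Y\<^sup>2)\<^sup>2 + 4 (X Y)\<^sup>2\<close> turns this into \<open>\<bar>X - sqrt C\<^sub>n\<bar> = O(sqrt P)\<close>
(\<open>hyperbola_stability\<close>). All these bounds hold for every value of \<open>P\<close>, so small and large
productions need not be distinguished; the constants depend on the \<open>L\<^sup>1\<close> norms because a
quadratic deviation is bounded by a linear one times the square root of the mass.

Second, \<open>\<integral>a\<^sup>2 ln\<^sup>+ (a\<^sup>2 / U)\<close> is bounded by \<open>\<integral>\<bar>\<nabla>a\<bar>\<^sup>2\<close> when \<open>U\<close> is four times the mass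
(\<open>torus_log_Sobolev_tail\<close>). The mean of \<open>a\<^sup>2\<close> over a cube of side \<open>s\<close> is at most \<open>s\<^sup>-\<^sup>d \<integral>a\<^sup>2\<close>, so
where \<open>a\<^sup>2\<close> is four times larger than that, it is dominated by the mean of
\<open>4 (a(x + s z) - a(x))\<^sup>2\<close> over \<open>z\<close> in the unit cube. The mass carried by these points is thus of
order \<open>s\<^sup>2 \<integral>\<bar>\<nabla>a\<bar>\<^sup>2\<close>, and the sum over \<open>s = 2\<^sup>-\<^sup>j\<close> converges and produces the logarithm.

Both inequalities use the gradient only through the translation estimate
\<open>\<integral>(a(x + h) - a(x))\<^sup>2 \<le> \<bar>h\<bar>\<^sup>2 \<integral>\<bar>\<nabla>a\<bar>\<^sup>2\<close> (\<open>translation_estimate\<close>). To derive it from the weak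
formulation, note that moving a translation onto the test function identifies the increment
\<open>f(x + h) - f(x)\<close> with the integral of \<open>h \<bullet> \<nabla>f\<close> along the segment for almost every \<open>x\<close>
(\<open>weak_gradient_line_integral\<close>). So truncations of \<open>ln (n / sqrt e)\<close> are absolutely continuous
on almost every line, where the chain rule for the exponential is elementary; Fatou's lemma
removes the truncation.\<close>

section \<open>Periodic functions and integration over the torus\<close>

text \<open>The half-open cell contains exactly one point of every orbit under integer translations, while
\<open>torus\<close> lives on the closed cube; the two differ by a null set.\<close>

definition unit_cell :: "(real ^ 'd) set" where
  "unit_cell = {x. \<forall>i. 0 \<le> x $ i \<and> x $ i < 1}"

definition vfrac :: "real ^ 'd \<Rightarrow> real ^ 'd" where
  "vfrac x = (\<chi> i. frac (x $ i))"

definition int_vec :: "int ^ 'd \<Rightarrow> real ^ 'd" where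
  "int_vec z = (\<chi> i. of_int (z $ i))"

lemma borel_measurable_vec_nth [measurable]: "(\<lambda>x :: real ^ 'd. x $ i) \<in> borel_measurable borel"
  by (intro borel_measurable_continuous_onI continuous_intros)

lemma borel_measurable_vec_lambda:
  assumes "\<And>i. (\<lambda>x. f x i) \<in> borel_measurable M"
  shows "(\<lambda>x. (\<chi> i. f x i) :: real ^ 'd) \<in> borel_measurable M"
  using assms by (subst borel_measurable_euclidean_space) (auto simp: Basis_vec_def inner_axis)

lemma vfrac_in_unit_cell: "vfrac x \<in> unit_cell"
  by (simp add: vfrac_def unit_cell_def frac_lt_1)

lemma unit_cell_subset: "unit_cell \<subseteq> cbox 0 (1 :: real ^ 'd)"
  by (auto simp: unit_cell_def mem_box_cart less_imp_le)

lemma vfrac_eq_self: "x \<in> unit_cell \<Longrightarrow> vfrac x = x"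
  by (simp add: unit_cell_def vfrac_def vec_eq_iff frac_eq)

lemma vfrac_eq_add_int_vec: "vfrac x = x + int_vec (\<chi> i. - \<lfloor>x $ i\<rfloor>)"
  by (simp add: vfrac_def int_vec_def vec_eq_iff frac_def)

lemma add_int_vec_in_unit_cell_iff:
  "x + int_vec z \<in> unit_cell \<longleftrightarrow> z = (\<chi> i. - \<lfloor>x $ i\<rfloor>)"
proof -
  have "0 \<le> x $ i + of_int (z $ i) \<and> x $ i + of_int (z $ i) < 1 \<longleftrightarrow> z $ i = - \<lfloor>x $ i\<rfloor>" for i
    by linarith
  then show ?thesis by (auto simp: unit_cell_def int_vec_def vec_eq_iff)
qed

lemma vfrac_measurable [measurable]: "vfrac \<in> borel_measurable borel"
  unfolding vfrac_def frac_def by (rule borel_measurable_vec_lambda) measurable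

lemma int_vec_eq_sum: "int_vec z = (\<Sum>i\<in>UNIV. of_int (z $ i) *\<^sub>R axis i 1)"
  by (simp add: vec_eq_iff int_vec_def axis_def if_distrib[of "\<lambda>x. _ * x"] cong: if_cong)

lemma unit_cell_sets [measurable]: "unit_cell \<in> sets borel"
proof -
  have "unit_cell = {x :: real ^ 'd. vfrac x = x}"
    by (intro set_eqI iffI CollectI vfrac_eq_self) (simp_all, metis vfrac_in_unit_cell)
  also have "\<dots> \<in> sets borel" by measurable
  finally show ?thesis .
qed

lemma periodic_add_int:
  assumes "periodic f"
  shows "f (x + of_int k *\<^sub>R axis i 1) = f x"
proof -
  have nat: "f (x + of_nat m *\<^sub>R axis i 1) = f x" for m x
  proof (induction m)
    case (Suc m)
    have "f (x + of_nat (Suc m) *\<^sub>R axis i 1) = f ((x + of_nat m *\<^sub>R axis i 1) + axis i 1)"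
      by (simp add: algebra_simps)
    then show ?case using assms Suc by (simp add: periodic_def)
  qed simp
  show ?thesis
  proof (cases k)
    case (nonneg m) then show ?thesis using nat by simp
  next
    case (neg m)
    then show ?thesis
      using nat[of "x + of_int k *\<^sub>R axis i 1" "Suc m"] by (simp del: of_nat_Suc)
  qed
qed

lemma periodic_add_int_vec:
  assumes "periodic f"
  shows "f (x + int_vec z) = f x"
proof -
  have "f (x + (\<Sum>i\<in>A. of_int (z $ i) *\<^sub>R axis i 1)) = f x" if "finite A" for A
    using that
  proof (induction A)
    case (insert i A)
    then show ?case
      using periodic_add_int[OF assms, of "x + (\<Sum>i\<in>A. of_int (z $ i) *\<^sub>R axis i 1)" "z $ i" i]
      by (simp add: algebra_simps)
  qed simp
  then show ?thesis by (simp add: int_vec_eq_sum)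
qed

lemma periodic_vfrac: "periodic f \<Longrightarrow> f (vfrac x) = f x"
  by (simp add: vfrac_eq_add_int_vec periodic_add_int_vec)

lemma vfrac_add_axis: "vfrac (x + axis i 1) = vfrac x"
proof -
  have "frac (x $ j + axis i 1 $ j) = frac (x $ j)" for j
    by (simp add: axis_def frac_def)
  then show ?thesis by (simp add: vfrac_def)
qed

lemma periodic_comp_vfrac: "periodic (\<lambda>x. f (vfrac x))"
  by (simp add: periodic_def vfrac_add_axis)

lemma periodic_shift: "periodic f \<Longrightarrow> periodic (\<lambda>x. f (x + h))"
  by (simp add: periodic_def add.assoc add.commute[of _ h]) (simp add: add.assoc[symmetric])

lemma space_torus [simp]: "space torus = cbox 0 1"
  by (simp add: torus_def)

lemma measurable_torus_id [measurable]: "(\<lambda>x. x) \<in> borel_measurable torus"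
  unfolding torus_def by (rule measurable_restrict_space1) (simp add: measurable_completion)

lemma borel_measurable_torusI: "f \<in> borel \<rightarrow>\<^sub>M N \<Longrightarrow> f \<in> torus \<rightarrow>\<^sub>M N"
  using measurable_compose[OF measurable_torus_id] by blast

lemma nn_integral_torus:
  assumes [measurable]: "F \<in> borel_measurable borel"
  shows "(\<integral>\<^sup>+x. F x \<partial>torus) = (\<integral>\<^sup>+x. F x * indicator unit_cell x \<partial>lborel)"
proof -
  have hyp: "{x :: real ^ 'd. x $ i = 1} \<in> null_sets lborel" for i
  proof -
    have "{x :: real ^ 'd. x $ i = 1} \<in> null_sets lebesgue"
      using negligible_standard_hyperplane[of "axis i 1 :: real ^ 'd" 1]
      by (simp add: negligible_iff_null_sets axis_in_Basis_iff inner_axis)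
    then show ?thesis
      by (subst (asm) null_sets_completion_iff) (simp_all add: null_sets_completion_iff)
  qed
  have "(\<Union>i. {x :: real ^ 'd. x $ i = 1}) \<in> null_sets lborel"
    by (intro null_sets_UN') (use hyp in \<open>auto intro: countable_finite\<close>)
  then have ae: "AE x in (lborel :: (real ^ 'd) measure). \<forall>i. x $ i \<noteq> 1"
    by (auto dest: AE_not_in)
  have "(\<integral>\<^sup>+x. F x \<partial>torus) = (\<integral>\<^sup>+x. F x * indicator (cbox 0 1) x \<partial>lborel)"
    by (simp add: torus_def nn_integral_restrict_space nn_integral_completion)
  also have "\<dots> = (\<integral>\<^sup>+x. F x * indicator unit_cell x \<partial>lborel)"
    using ae by (intro nn_integral_cong_AE, eventually_elim)
      (auto simp: unit_cell_def mem_box_cart indicator_def less_le)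
  finally show ?thesis .
qed

lemma emeasure_torus: "emeasure torus (cbox 0 (1 :: real ^ 'd)) = 1"
proof -
  have inn: "(1 :: real ^ 'd) \<bullet> b = 1" if "b \<in> Basis" for b
    using that by (auto simp: Basis_vec_def inner_axis)
  have "emeasure torus (cbox 0 (1 :: real ^ 'd)) = emeasure lborel (cbox 0 (1 :: real ^ 'd))"
    by (simp add: torus_def emeasure_restrict_space)
  then show ?thesis by (simp add: emeasure_lborel_cbox_eq inn)
qed

lemma finite_measure_torus: "finite_measure torus"
  by (rule finite_measureI) (simp add: emeasure_torus)

interpretation torus: finite_measure torus
  by (rule finite_measure_torus)

lemma measure_torus [simp]: "measure torus (cbox 0 1) = 1"
  by (simp add: measure_def emeasure_torus)

lemma AE_torus_unit_cell: "AE x in torus. x \<in> unit_cell"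
proof -
  have "(\<integral>\<^sup>+x. indicator (- unit_cell) x \<partial>torus) = 0"
    by (subst nn_integral_torus) (auto simp: indicator_def nn_integral_0_iff_AE)
  then have "AE x in torus. indicator (- unit_cell) x = (0 :: ennreal)"
    by (subst (asm) nn_integral_0_iff_AE) (auto intro!: borel_measurable_torusI)
  then show ?thesis by (auto simp: indicator_def split: if_splits)
qed

text \<open>The integer translates of the cell tile the space. Cutting the translated cell into the pieces
that lie in the different tiles and moving each piece back into the cell by periodicity covers
the cell exactly once.\<close>

lemma nn_integral_torus_shift:
  fixes F :: "real ^ 'd \<Rightarrow> ennreal"
  assumes F [measurable]: "F \<in> borel_measurable borel" and per: "periodic F"
  shows "(\<integral>\<^sup>+x. F (x + h) \<partial>torus) = (\<integral>\<^sup>+x. F x \<partial>torus)"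
proof -
  have one: "(\<integral>\<^sup>+z. indicator unit_cell (y + int_vec z) \<partial>count_space (UNIV :: (int ^ 'd) set)) = 1" for y :: "real ^ 'd"
  proof -
    have "(\<lambda>z. indicator unit_cell (y + int_vec z) :: ennreal) = indicator {\<chi> i. - \<lfloor>y $ i\<rfloor>}"
      by (auto simp: fun_eq_iff indicator_def add_int_vec_in_unit_cell_iff)
    then show ?thesis by (simp add: one_ennreal_def)
  qed
  have shift: "(\<integral>\<^sup>+x. G (x + a) \<partial>lborel) = (\<integral>\<^sup>+x. G x \<partial>lborel)"
    if [measurable]: "G \<in> borel_measurable borel" for G :: "real ^ 'd \<Rightarrow> ennreal" and a
    by (subst (2) lborel_distr_plus[of a, symmetric]) (simp add: nn_integral_distr add.commute)
  have tonelli: "(\<integral>\<^sup>+x. (\<integral>\<^sup>+z. G z x \<partial>count_space UNIV) \<partial>lborel) = (\<integral>\<^sup>+z. (\<integral>\<^sup>+x. G z x \<partial>lborel) \<partial>count_space UNIV)"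
    if "\<And>z. G z \<in> borel_measurable borel" for G :: "int ^ 'd \<Rightarrow> real ^ 'd \<Rightarrow> ennreal"
    using that by (intro nn_integral_count_space_nn_integral) auto
  (* Insert the sum over all integer translates of the indicator at x + h, which is 1. *)
  have "(\<integral>\<^sup>+x. F (x + h) \<partial>torus) = 
     (\<integral>\<^sup>+x. (\<integral>\<^sup>+z. F (x + h) * indicator unit_cell x * indicator unit_cell (x + h + int_vec z) \<partial>count_space UNIV) \<partial>lborel)"
    by (simp add: nn_integral_torus nn_integral_cmult one)
  also have "\<dots> = (\<integral>\<^sup>+z. (\<integral>\<^sup>+x. F (x + h) * indicator unit_cell x * indicator unit_cell (x + h + int_vec z) \<partial>lborel) \<partial>count_space UNIV)"
    by (rule tonelli) measurable
  also have "\<dots> = (\<integral>\<^sup>+z. (\<integral>\<^sup>+x. F (x + (h + int_vec z)) * indicator unit_cell ((x + (h + int_vec z)) - (h + int_vec z)) * indicator unit_cell (x + (h + int_vec z)) \<partial>lborel) \<partial>count_space UNIV)"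
    by (simp add: periodic_add_int_vec[OF per] add.assoc[symmetric])
  also have "\<dots> = (\<integral>\<^sup>+z. (\<integral>\<^sup>+x. F x * indicator unit_cell (x - (h + int_vec z)) * indicator unit_cell x \<partial>lborel) \<partial>count_space UNIV)"
    by (subst shift) auto
  also have "\<dots> = (\<integral>\<^sup>+x. (\<integral>\<^sup>+z. F x * indicator unit_cell (x - (h + int_vec z)) * indicator unit_cell x \<partial>count_space UNIV) \<partial>lborel)"
    by (rule tonelli[symmetric]) measurable
  also have "\<dots> = (\<integral>\<^sup>+x. F x * indicator unit_cell x * (\<integral>\<^sup>+z. indicator unit_cell (x - (h + int_vec z)) \<partial>count_space UNIV) \<partial>lborel)"
    by (simp add: nn_integral_cmult[symmetric] mult_ac)
  (* Reflect the summation index, so that the tiling property applies at x - h. *)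
  also have "\<dots> = (\<integral>\<^sup>+x. F x * indicator unit_cell x * (\<integral>\<^sup>+z. indicator unit_cell ((x - h) + int_vec z) \<partial>count_space UNIV) \<partial>lborel)"
  proof -
    have "bij (uminus :: int ^ 'd \<Rightarrow> _)" by (rule bij_uminus)
    then have "(\<integral>\<^sup>+z. indicator unit_cell ((x - h) + int_vec z) \<partial>count_space UNIV) =
      (\<integral>\<^sup>+z. (indicator unit_cell ((x - h) + int_vec (- z)) :: ennreal) \<partial>count_space UNIV)" for x :: "real ^ 'd"
      by (rule nn_integral_bij_count_space[symmetric])
    moreover have "int_vec (- z) = - int_vec z" for z :: "int ^ 'd"
      by (simp add: int_vec_def vec_eq_iff)
    ultimately show ?thesis by (simp add: algebra_simps)
  qed
  also have "\<dots> = (\<integral>\<^sup>+x. F x \<partial>torus)"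
    by (simp add: one nn_integral_torus)
  finally show ?thesis .
qed

text \<open>Translation invariance as an equality of measures, from which it passes to Bochner integrals.\<close>

lemma distr_torus_shift:
  "distr torus borel (\<lambda>x. vfrac (x + h)) = distr torus borel (\<lambda>x :: real ^ 'd. vfrac x)"
proof (rule measure_eqI)
  fix A :: "(real ^ 'd) set" assume "A \<in> sets (distr torus borel (\<lambda>x. vfrac (x + h)))"
  then have [measurable]: "A \<in> sets borel" by simp
  have em: "emeasure (distr torus borel (\<lambda>x. vfrac (x + k))) A = (\<integral>\<^sup>+x. indicator A (vfrac (x + k)) \<partial>torus)" for k
    by (simp add: nn_integral_indicator[symmetric] nn_integral_distr del: nn_integral_indicator)
  show "emeasure (distr torus borel (\<lambda>x. vfrac (x + h))) A = emeasure (distr torus borel vfrac) A"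
    using em[of h] em[of 0] nn_integral_torus_shift[of "\<lambda>x. indicator A (vfrac x)" h]
    by (simp add: periodic_comp_vfrac)
qed simp

lemma
  fixes f :: "real ^ 'd \<Rightarrow> 'b :: {banach, second_countable_topology}"
  assumes f [measurable]: "f \<in> borel_measurable borel" and per: "periodic f"
  shows integral_torus_shift: "(\<integral>x. f (x + h) \<partial>torus) = (\<integral>x. f x \<partial>torus)"
    and integrable_torus_shift: "integrable torus (\<lambda>x. f (x + h)) \<longleftrightarrow> integrable torus f"
proof -
  have "(\<integral>x. f (x + h) \<partial>torus) = (\<integral>x. f x \<partial>distr torus borel (\<lambda>x. vfrac (x + h)))"
    by (subst integral_distr) (simp_all add: periodic_vfrac[OF per])
  also have "\<dots> = (\<integral>x. f x \<partial>torus)"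
    by (subst distr_torus_shift, subst integral_distr) (simp_all add: periodic_vfrac[OF per] borel_measurable_torusI)
  finally show "(\<integral>x. f (x + h) \<partial>torus) = (\<integral>x. f x \<partial>torus)" .
  have "integrable torus (\<lambda>x. f (x + h)) \<longleftrightarrow> integrable (distr torus borel (\<lambda>x. vfrac (x + h))) f"
    by (subst integrable_distr_eq) (simp_all add: periodic_vfrac[OF per])
  also have "\<dots> \<longleftrightarrow> integrable torus f"
    by (subst distr_torus_shift, subst integrable_distr_eq) (simp_all add: periodic_vfrac[OF per] borel_measurable_torusI)
  finally show "integrable torus (\<lambda>x. f (x + h)) \<longleftrightarrow> integrable torus f" .
qed

text \<open>Measurability on \<open>torus\<close> is Lebesgue measurability. Fubini arguments that involve \<open>f (x + h)\<close>
jointly in \<open>x\<close> and \<open>h\<close> need Borel functions, so every function is first replaced by a Borel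
version that is periodic again.\<close>

lemma borel_periodic_version_real:
  fixes f :: "real ^ 'd \<Rightarrow> real"
  assumes f: "f \<in> borel_measurable torus"
  obtains g where "g \<in> borel_measurable borel" "periodic g" "AE x in torus. g x = f x"
proof -
  have "(\<lambda>x. if x \<in> cbox 0 1 then f x else 0) \<in> borel_measurable lebesgue"
    using f unfolding torus_def by (rule borel_measurable_if_I) simp
  then obtain g where [measurable]: "g \<in> borel_measurable lborel"
    and ae: "AE x in lborel. (if x \<in> cbox 0 1 then f x else 0) = g x"
    using completion_ex_borel_measurable_real by blast
  have "AE x in lebesgue. (if x \<in> cbox 0 1 then f x else 0) = g x"
    using ae by (rule AE_completion)
  then have "AE x in torus. f x = g x"
    unfolding torus_def by (subst AE_restrict_space_iff) (auto elim!: AE_mp)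
  then have "AE x in torus. g (vfrac x) = f x"
    using AE_torus_unit_cell by eventually_elim (simp add: vfrac_eq_self)
  moreover have "(\<lambda>x. g (vfrac x)) \<in> borel_measurable borel" by measurable
  ultimately show thesis using that periodic_comp_vfrac by blast
qed

lemma borel_periodic_version_vec:
  fixes f :: "real ^ 'd \<Rightarrow> real ^ 'd"
  assumes f [measurable]: "f \<in> borel_measurable torus"
  obtains g where "g \<in> borel_measurable borel" "periodic g" "AE x in torus. g x = f x"
proof -
  have "\<exists>g. g \<in> borel_measurable borel \<and> periodic g \<and> (AE x in torus. g x = f x $ i)" for i
    by (rule borel_periodic_version_real[of "\<lambda>x. f x $ i"]) (measurable, blast)
  then obtain G where G: "\<And>i. G i \<in> borel_measurable borel" "\<And>i. periodic (G i)"
      "\<And>i. AE x in torus. G i x = f x $ i"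
    by metis
  have "AE x in torus. \<forall>i. G i x = f x $ i"
    using G(3) by (subst AE_all_countable) auto
  then have "AE x in torus. (\<chi> i. G i x) = f x"
    by eventually_elim (simp add: vec_eq_iff)
  moreover have "periodic (\<lambda>x. \<chi> i. G i x)" using G(2) by (simp add: periodic_def)
  moreover have "(\<lambda>x. \<chi> i. G i x) \<in> borel_measurable borel"
    using G(1) by (rule borel_measurable_vec_lambda)
  ultimately show thesis using that by blast
qed

section \<open>Test functions separate integrable functions\<close>

lemma has_real_derivative_min_0_square:
  "((\<lambda>r. (min 0 r)\<^sup>2) has_real_derivative 2 * min 0 r) (at (r :: real))"
proof -
  consider "r < 0" | "r > 0" | "r = 0" by linarith
  then show ?thesis
  proof cases
    case 1
    have "((\<lambda>r. r\<^sup>2) has_real_derivative 2 * min 0 r) (at r)"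
      using 1 by (auto intro!: derivative_eq_intros)
    then show ?thesis
      by (rule has_field_derivative_transform_within_open[of _ _ _ "{..<0}"]) (use 1 in auto)
  next
    case 2
    have "((\<lambda>r. 0) has_real_derivative 2 * min 0 r) (at r)"
      using 2 by (auto intro!: derivative_eq_intros)
    then show ?thesis
      by (rule has_field_derivative_transform_within_open[of _ _ _ "{0<..}"]) (use 2 in auto)
  next
    case 3
    have "((\<lambda>h. (min 0 h)\<^sup>2 / h) \<longlongrightarrow> 0) (at (0 :: real))"
    proof (rule Lim_null_comparison)
      show "\<forall>\<^sub>F h in at 0. norm ((min 0 h)\<^sup>2 / h) \<le> \<bar>h :: real\<bar>"
        by (rule always_eventually) (auto simp: min_def power2_eq_square)
      show "((\<lambda>h. \<bar>h :: real\<bar>) \<longlongrightarrow> 0) (at 0)"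
        by (intro tendsto_eq_intros) auto
    qed
    then show ?thesis using 3 by (simp add: DERIV_def)
  qed
qed

definition torus_test :: "(real ^ 'd \<Rightarrow> real) \<Rightarrow> (real ^ 'd \<Rightarrow> real ^ 'd) \<Rightarrow> bool" where
  "torus_test \<phi> \<psi> \<longleftrightarrow> periodic \<phi> \<and> continuous_on UNIV \<psi> \<and> (\<forall>x. GDERIV \<phi> x :> \<psi> x)"

lemma torus_test_continuous: "torus_test \<phi> \<psi> \<Longrightarrow> continuous_on UNIV \<phi>"
  unfolding torus_test_def gderiv_def
  by (meson continuous_at_imp_continuous_on has_derivative_continuous)

lemma torus_test_one: "torus_test (\<lambda>x. 1) (\<lambda>x. 0)"
  by (simp add: torus_test_def periodic_def GDERIV_const)

text \<open>Bounded approximation of the indicator of a corner by test functions. On the unit cell the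
periodic function \<open>sin (\<pi> t) sin (\<pi> (\<beta> - t))\<close> is negative exactly for \<open>t > \<beta>\<close>. Its squared
negative part is continuously differentiable, and the sum \<open>w\<close> of these squares over the
coordinates vanishes exactly on the corner, so that \<open>exp (- k w)\<close> converges to the indicator. A
sum in the exponent plays the part of a product of one-dimensional bumps.\<close>

lemma torus_test_corner:
  obtains \<phi> :: "nat \<Rightarrow> real ^ 'd \<Rightarrow> real" and \<psi>
    where "\<And>k. torus_test (\<phi> k) (\<psi> k)" "\<And>k x. 0 \<le> \<phi> k x \<and> \<phi> k x \<le> 1"
      "\<And>x. x \<in> unit_cell \<Longrightarrow> (\<lambda>k. \<phi> k x) \<longlonglongrightarrow> indicator {..b} x"
proof (cases "\<forall>i. 0 \<le> b $ i")
  case False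
  then obtain i where i: "b $ i < 0" by (auto simp: not_le)
  have "x \<notin> {..b}" if "x \<in> unit_cell" for x
    using that i by (auto simp: unit_cell_def less_eq_vec_def not_le intro!: exI[of _ i] elim: order.strict_trans2)
  then show thesis
    by (intro that[of "\<lambda>k x. 0" "\<lambda>k x. 0"]) (auto simp: torus_test_def periodic_def GDERIV_const)
next
  case True
  (* Corners that stick out of the cell may be cut off at 1, which keeps beta - t at most 1. *)
  define \<beta> where "\<beta> i = min 1 (b $ i)" for i
  have \<beta>: "0 \<le> \<beta> i" "\<beta> i \<le> 1" for i using True by (auto simp: \<beta>_def)
  define \<sigma> where "\<sigma> i t = sin (pi * t) * sin (pi * (\<beta> i - t))" for i t
  define \<sigma>' where "\<sigma>' i t = pi * cos (pi * t) * sin (pi * (\<beta> i - t)) - pi * sin (pi * t) * cos (pi * (\<beta> i - t))" for i t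
  define w where "w x = (\<Sum>i\<in>UNIV. (min 0 (\<sigma> i (x $ i)))\<^sup>2)" for x
  define w' where "w' x = (\<chi> i. 2 * min 0 (\<sigma> i (x $ i)) * \<sigma>' i (x $ i))" for x
  have \<sigma>: "(\<sigma> i has_real_derivative \<sigma>' i t) (at t)" for i t
    unfolding \<sigma>_def \<sigma>'_def by (auto intro!: derivative_eq_intros simp: algebra_simps)
  have \<sigma>_per: "\<sigma> i (t + 1) = \<sigma> i t" for i t
  proof -
    have "sin (pi * (\<beta> i - (t + 1))) = - sin (pi * (\<beta> i - t))"
      using sin_periodic_pi2[of "- (pi * (\<beta> i - t))"] sin_minus_pi[of "pi * (\<beta> i - t)"]
      by (simp add: algebra_simps)
    moreover have "sin (pi * (t + 1)) = - sin (pi * t)" by (simp add: algebra_simps)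
    ultimately show ?thesis by (simp add: \<sigma>_def)
  qed
  have w_per: "w (x + axis j 1) = w x" for x j
  proof -
    have "\<sigma> i (x $ i + axis j 1 $ i) = \<sigma> i (x $ i)" for i
      by (simp add: axis_def \<sigma>_per)
    then show ?thesis by (simp add: w_def)
  qed
  have w_deriv: "(w has_derivative (\<lambda>h. h \<bullet> w' x)) (at x)" for x
  proof -
    have "((\<lambda>x. (min 0 (\<sigma> i (x $ i)))\<^sup>2) has_derivative (\<lambda>h. h $ i * (2 * min 0 (\<sigma> i (x $ i)) * \<sigma>' i (x $ i)))) (at x)" for i
    proof -
      have "((\<lambda>t. (min 0 (\<sigma> i t))\<^sup>2) has_real_derivative 2 * min 0 (\<sigma> i (x $ i)) * \<sigma>' i (x $ i)) (at (x $ i))"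
        by (rule DERIV_chain2[OF has_real_derivative_min_0_square \<sigma>])
      then have "((\<lambda>t. (min 0 (\<sigma> i t))\<^sup>2) has_derivative (\<lambda>t. t * (2 * min 0 (\<sigma> i (x $ i)) * \<sigma>' i (x $ i)))) (at (x $ i))"
        by (simp add: has_field_derivative_def mult.commute[of _ "2 * _ * _"])
      moreover have "((\<lambda>x. x $ i) has_derivative (\<lambda>h. h $ i)) (at x)"
        by (rule bounded_linear_imp_has_derivative) (rule bounded_linear_vec_nth)
      ultimately show ?thesis by (rule has_derivative_compose[rotated])
    qed
    then show ?thesis
      unfolding w_def w'_def inner_vec_def by (auto intro!: has_derivative_sum)
  qed
  have w'_cont: "continuous_on UNIV w'"
    unfolding w'_def \<sigma>_def \<sigma>'_def by (intro continuous_on_vec_lambda continuous_intros)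
  have w_nonneg: "0 \<le> w x" for x unfolding w_def by (intro sum_nonneg) simp
  have w_zero: "w x = 0 \<longleftrightarrow> x \<le> b" if x: "x \<in> unit_cell" for x
  proof -
    have "min 0 (\<sigma> i (x $ i)) = 0 \<longleftrightarrow> x $ i \<le> b $ i" for i
    proof -
      have xi: "0 \<le> x $ i" "x $ i < 1" using x by (auto simp: unit_cell_def)
      then have s: "0 \<le> sin (pi * x $ i)" by (intro sin_ge_zero) auto
      show ?thesis
      proof (cases "x $ i \<le> \<beta> i")
        case True
        then have "pi * (\<beta> i - x $ i) \<le> pi * 1" using xi \<beta>[of i] by (intro mult_left_mono) auto
        then have "0 \<le> sin (pi * (\<beta> i - x $ i))" using True xi \<beta>[of i] by (intro sin_ge_zero) auto
        then have "0 \<le> \<sigma> i (x $ i)" using s by (simp add: \<sigma>_def)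
        moreover have "x $ i \<le> b $ i" using True by (simp add: \<beta>_def)
        ultimately show ?thesis by simp
      next
        case False
        then have lt: "b $ i < x $ i" using xi by (auto simp: \<beta>_def min_def split: if_splits)
        have pos: "0 < x $ i" using False \<beta>[of i] by linarith
        have "0 < sin (pi * (x $ i))" using pos xi by (intro sin_gt_zero) auto
        moreover have "0 < sin (pi * (x $ i - \<beta> i))"
        proof -
          have "pi * (x $ i - \<beta> i) < pi * 1" using xi \<beta>[of i] by (intro mult_strict_left_mono) auto
          then show ?thesis using False by (intro sin_gt_zero) auto
        qed
        moreover have "sin (pi * (\<beta> i - x $ i)) = - sin (pi * (x $ i - \<beta> i))"
          by (subst sin_minus[symmetric]) (simp add: algebra_simps)
        ultimately have "\<sigma> i (x $ i) < 0" by (simp add: \<sigma>_def)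
        then show ?thesis using lt by simp
      qed
    qed
    then show ?thesis by (simp add: w_def sum_nonneg_eq_0_iff less_eq_vec_def)
  qed
  show thesis
  proof (rule that[of "\<lambda>k x. exp (- real k * w x)" "\<lambda>k x. (exp (- real k * w x) * (- real k)) *\<^sub>R w' x"])
    fix k :: nat
    have cont: "continuous_on UNIV w"
      using w_deriv by (meson continuous_at_imp_continuous_on has_derivative_continuous)
    have "GDERIV (\<lambda>x. exp (- real k * w x)) x :> (exp (- real k * w x) * (- real k)) *\<^sub>R w' x" for x
      by (rule GDERIV_DERIV_compose[where f = w and g = "\<lambda>y. exp (- real k * y)"])
        (auto simp: gderiv_def w_deriv intro!: derivative_eq_intros)
    then show "torus_test (\<lambda>x. exp (- real k * w x)) (\<lambda>x. (exp (- real k * w x) * (- real k)) *\<^sub>R w' x)"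
      unfolding torus_test_def using cont w'_cont by (auto simp: periodic_def w_per intro!: continuous_intros)
    show "0 \<le> exp (- real k * w x) \<and> exp (- real k * w x) \<le> 1" for x
      using w_nonneg[of x] by simp
  next
    fix x :: "real ^ 'd" assume x: "x \<in> unit_cell"
    show "(\<lambda>k. exp (- real k * w x)) \<longlonglongrightarrow> indicator {..b} x"
    proof (cases "x \<le> b")
      case True then show ?thesis using w_zero[OF x] by simp
    next
      case False
      then have "w x > 0" using w_zero[OF x] w_nonneg[of x] by auto
      then have "(\<lambda>k. exp (- w x) ^ k) \<longlonglongrightarrow> 0" by (intro LIMSEQ_power_zero) simp
      then show ?thesis using False by (simp add: exp_of_nat_mult[symmetric] mult.commute)
    qed
  qed
qed

text \<open>Corners form an intersection-stable generator of the Borel sets, so by Dynkin's lemma the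
integral of \<open>q\<close> over every Borel set vanishes as soon as it does for corners.\<close>

lemma torus_test_separation:
  fixes q :: "real ^ 'd \<Rightarrow> real"
  assumes q [measurable]: "q \<in> borel_measurable borel" and int: "integrable torus q"
    and test: "\<And>\<phi> \<psi>. torus_test \<phi> \<psi> \<Longrightarrow> (\<integral>x. q x * \<phi> x \<partial>torus) = 0"
  shows "AE x in torus. q x = 0"
proof -
  define N where "N = distr torus borel (\<lambda>x :: real ^ 'd. x)"
  have [simp, measurable_cong]: "sets N = sets borel" and [simp]: "space N = UNIV"
    by (simp_all add: N_def)
  have intN: "integrable N q" using int by (simp add: N_def integrable_distr_eq)
  have eqN: "(\<integral>x. f x \<partial>N) = (\<integral>x. f x \<partial>torus)" if "f \<in> borel_measurable borel" for f :: "_ \<Rightarrow> real"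
    using that by (simp add: N_def integral_distr)
  have sint: "set_integrable N A q" if "A \<in> sets borel" for A
    using intN that unfolding set_integrable_def by (intro integrable_mult_indicator) auto
  have zero: "(LINT x:A|N. q x) = 0" if "A \<in> sets borel" for A
  proof -
    have A: "A \<in> sigma_sets UNIV (range (\<lambda>b :: real ^ 'd. {..b}))"
      using that by (subst (asm) borel_eq_atMost) simp
    have stable: "Int_stable (range (\<lambda>b :: real ^ 'd. {..b}))"
    proof (rule Int_stableI)
      fix A B assume "A \<in> range (\<lambda>b :: real ^ 'd. {..b})" "B \<in> range (\<lambda>b :: real ^ 'd. {..b})"
      then obtain a b where "A = {..a}" "B = {..b}" by auto
      then have "A \<inter> B = {..inf a b}" by auto
      then show "A \<inter> B \<in> range (\<lambda>b :: real ^ 'd. {..b})" by blast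
    qed
    have "range (\<lambda>b :: real ^ 'd. {..b}) \<subseteq> Pow UNIV" by simp
    from stable this A show ?thesis
    proof (induction rule: sigma_sets_induct_disjoint)
      case (basic A)
      then obtain b where A: "A = {..b}" by auto
      obtain \<phi> \<psi> where \<phi>: "\<And>k. torus_test (\<phi> k) (\<psi> k)" "\<And>k x. 0 \<le> \<phi> k x \<and> \<phi> k x \<le> 1"
          "\<And>x. x \<in> unit_cell \<Longrightarrow> (\<lambda>k. \<phi> k x) \<longlonglongrightarrow> indicator {..b} x"
        using torus_test_corner by blast
      have [measurable]: "\<phi> k \<in> borel_measurable torus" for k
        using torus_test_continuous[OF \<phi>(1)] by (intro borel_measurable_torusI borel_measurable_continuous_onI)
      have [measurable]: "q \<in> borel_measurable torus" by (intro borel_measurable_torusI) measurable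
      have "(\<lambda>k. \<integral>x. q x * \<phi> k x \<partial>torus) \<longlonglongrightarrow> (\<integral>x. q x * indicator {..b} x \<partial>torus)"
      proof (rule integral_dominated_convergence[where w = "\<lambda>x. \<bar>q x\<bar>"])
        show "(\<lambda>x. q x * indicator {..b} x) \<in> borel_measurable torus"
          by (intro borel_measurable_torusI) measurable
        show "AE x in torus. (\<lambda>k. q x * \<phi> k x) \<longlonglongrightarrow> q x * indicator {..b} x"
          using AE_torus_unit_cell by eventually_elim (auto intro!: tendsto_intros \<phi>(3))
        show "AE x in torus. norm (q x * \<phi> k x) \<le> \<bar>q x\<bar>" for k
          using \<phi>(2) by (auto simp: abs_mult intro!: mult_left_le)
      qed (use int in auto)
      then have "(\<integral>x. q x * indicator {..b} x \<partial>torus) = 0"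
        using test[OF \<phi>(1)] by (simp add: LIMSEQ_const_iff)
      then show ?case by (simp add: A set_lebesgue_integral_def mult.commute eqN)
    next
      case empty then show ?case by (simp add: set_lebesgue_integral_def)
    next
      case (compl A)
      then have [measurable]: "A \<in> sets borel" by (subst borel_eq_atMost) simp
      have "(\<integral>x. q x \<partial>torus) = 0" using test[OF torus_test_one] by simp
      moreover have "(LINT x:UNIV|N. q x) = (LINT x:A|N. q x) + (LINT x:UNIV - A|N. q x)"
        by (subst set_integral_Un[symmetric]) (auto intro!: sint)
      ultimately show ?case using compl by (simp add: set_lebesgue_integral_def eqN)
    next
      case (union A)
      then have A: "A i \<in> sets borel" for i by (subst borel_eq_atMost) auto
      have "(LINT x:(\<Union>i. A i)|N. q x) = (\<Sum>i. (LINT x:(A i)|N. q x))"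
        using union A by (intro lebesgue_integral_countable_add sint) (auto simp: disjoint_family_on_def)
      then show ?case using union by simp
    qed
  qed
  have "(\<integral>x. max 0 (q x) \<partial>N) = (LINT x:{x. 0 \<le> q x}|N. q x)"
    unfolding set_lebesgue_integral_def by (intro Bochner_Integration.integral_cong) (auto simp: indicator_def)
  moreover have "(\<integral>x. max 0 (- q x) \<partial>N) = - (LINT x:{x. q x \<le> 0}|N. q x)"
    unfolding set_lebesgue_integral_def integral_minus[symmetric]
    by (intro Bochner_Integration.integral_cong) (auto simp: indicator_def)
  ultimately have "(\<integral>x. max 0 (q x) \<partial>N) = 0" "(\<integral>x. max 0 (- q x) \<partial>N) = 0"
    by (auto simp: zero)
  then have "AE x in N. max 0 (q x) = 0" "AE x in N. max 0 (- q x) = 0"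
    using intN by (auto simp: integral_nonneg_eq_0_iff_AE)
  then have "AE x in N. q x = 0" by eventually_elim auto
  then show ?thesis unfolding N_def by (subst (asm) AE_distr_iff) auto
qed

section \<open>Weak gradients along lines\<close>

lemma has_weak_gradient_test:
  assumes "has_weak_gradient f g" "torus_test \<phi> \<psi>"
  shows "(\<integral>x. f x *\<^sub>R \<psi> x \<partial>torus) = - (\<integral>x. \<phi> x *\<^sub>R g x \<partial>torus)"
  using assms unfolding has_weak_gradient_def torus_test_def by blast

lemma torus_test_shift:
  assumes "torus_test \<phi> \<psi>"
  shows "torus_test (\<lambda>x. \<phi> (x + h)) (\<lambda>x. \<psi> (x + h))"
proof -
  have \<psi>c: "continuous_on UNIV \<psi>" using assms by (simp add: torus_test_def)
  have "((\<lambda>x. \<phi> (x + h)) has_derivative (\<lambda>k. k \<bullet> \<psi> (x + h))) (at x)" for x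
    by (rule has_derivative_compose[where f = "\<lambda>x. x + h" and f' = "\<lambda>x. x"])
      (use assms in \<open>auto intro!: derivative_eq_intros simp: torus_test_def gderiv_def\<close>)
  moreover have "continuous_on UNIV (\<lambda>x. \<psi> (x + h))"
    by (rule continuous_on_compose2[OF \<psi>c]) (auto intro!: continuous_intros)
  ultimately show ?thesis
    using assms by (auto simp: torus_test_def periodic_shift gderiv_def)
qed

lemma torus_test_line_integral:
  assumes "torus_test \<phi> \<psi>" "0 \<le> s"
  shows "(\<integral>r. indicator {0..s} r * (h \<bullet> \<psi> (x - r *\<^sub>R h)) \<partial>lborel) = \<phi> x - \<phi> (x - s *\<^sub>R h)"
proof -
  have d: "((\<lambda>r. - \<phi> (x - r *\<^sub>R h)) has_real_derivative h \<bullet> \<psi> (x - r *\<^sub>R h)) (at r)" for r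
  proof -
    have "((\<lambda>r. \<phi> (x - r *\<^sub>R h)) has_derivative (\<lambda>t. (- (t *\<^sub>R h)) \<bullet> \<psi> (x - r *\<^sub>R h))) (at r)"
      by (rule has_derivative_compose[where f = "\<lambda>r. x - r *\<^sub>R h" and f' = "\<lambda>t. - (t *\<^sub>R h)"])
        (use assms in \<open>auto intro!: derivative_eq_intros simp: torus_test_def gderiv_def\<close>)
    then have "((\<lambda>r. - \<phi> (x - r *\<^sub>R h)) has_derivative (\<lambda>t. - ((- (t *\<^sub>R h)) \<bullet> \<psi> (x - r *\<^sub>R h)))) (at r)"
      by (rule has_derivative_minus)
    then show ?thesis
      by (simp add: has_field_derivative_def mult.commute[of _ "h \<bullet> _", abs_def])
  qed
  have \<psi>c: "continuous_on UNIV \<psi>" using assms by (simp add: torus_test_def)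
  have "isCont (\<lambda>r. h \<bullet> \<psi> (x - r *\<^sub>R h)) r" for r
  proof -
    have "continuous_on UNIV (\<lambda>r. \<psi> (x - r *\<^sub>R h))"
      by (rule continuous_on_compose2[OF \<psi>c]) (auto intro!: continuous_intros)
    then have "continuous_on UNIV (\<lambda>r. h \<bullet> \<psi> (x - r *\<^sub>R h))" by (intro continuous_intros)
    then show ?thesis by (simp add: continuous_on_eq_continuous_at)
  qed
  then have "(\<integral>r. (h \<bullet> \<psi> (x - r *\<^sub>R h)) * indicator {0..s} r \<partial>lborel) = - \<phi> (x - s *\<^sub>R h) - - \<phi> (x - 0 *\<^sub>R h)"
    using assms(2) d by (intro integral_FTC_Icc_real) auto
  then show ?thesis by (simp add: mult.commute)
qed

text \<open>Integrability on the product of the torus with \<open>[0, s]\<close>, as needed for Fubini's theorem: the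
slices have uniformly bounded \<open>L\<^sup>1\<close> norm.\<close>

lemma integrable_torus_strip:
  fixes G :: "real ^ 'd \<Rightarrow> real \<Rightarrow> real"
  assumes G [measurable]: "(\<lambda>(x, r). G x r) \<in> borel_measurable (borel \<Otimes>\<^sub>M borel)"
    and bound: "\<And>r. 0 \<le> r \<Longrightarrow> r \<le> s \<Longrightarrow> (\<integral>\<^sup>+x. ennreal \<bar>G x r\<bar> \<partial>torus) \<le> ennreal C"
  shows "integrable (torus \<Otimes>\<^sub>M lborel) (\<lambda>(x, r). indicator {0..s} r * G x r)"
proof -
  interpret P: pair_sigma_finite "torus :: (real ^ 'd) measure" "lborel :: real measure" ..
  have meas [measurable]: "(\<lambda>(x, r). G x r) \<in> borel_measurable (torus \<Otimes>\<^sub>M borel)"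
  proof -
    have "(\<lambda>p. (fst p, snd p)) \<in> torus \<Otimes>\<^sub>M borel \<rightarrow>\<^sub>M borel \<Otimes>\<^sub>M borel" by measurable
    from measurable_compose[OF this G] show ?thesis by (simp add: case_prod_unfold)
  qed
  have "(\<integral>\<^sup>+p. ennreal (norm (case p of (x, r) \<Rightarrow> indicator {0..s} r * G x r)) \<partial>(torus \<Otimes>\<^sub>M lborel))
      = (\<integral>\<^sup>+r. (\<integral>\<^sup>+x. ennreal (norm (indicator {0..s} r * G x r)) \<partial>torus) \<partial>lborel)"
    by (subst P.nn_integral_snd[symmetric]) (auto simp: case_prod_unfold)
  also have "\<dots> \<le> (\<integral>\<^sup>+r. ennreal C * indicator {0..s} r \<partial>lborel)"
    using bound by (intro nn_integral_mono) (auto simp: indicator_def abs_mult)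
  also have "\<dots> = ennreal C * ennreal (if 0 \<le> s then s else 0)"
    by (subst nn_integral_cmult_indicator) auto
  also have "\<dots> < \<infinity>" by (simp add: ennreal_mult_less_top)
  finally show ?thesis
    by (intro integrableI_bounded) auto
qed

text \<open>Test the difference \<open>q\<close> of both sides with \<open>\<phi>\<close>. Translation invariance moves the increment of
\<open>f\<close> onto \<open>\<phi>\<close>, which is differentiable, so that its increment is the integral of \<open>h \<bullet> \<psi>\<close> along
the segment. The weak formulation for the translated test functions \<open>\<phi> (x - r h)\<close> replaces
\<open>f \<psi>\<close> by \<open>- \<phi> g\<close>, and another translation gives the line integral of \<open>g\<close> tested with \<open>\<phi>\<close>.\<close>

lemma weak_gradient_line_integral:
  fixes f :: "real ^ 'd \<Rightarrow> real"
  assumes f [measurable]: "f \<in> borel_measurable borel" and fper: "periodic f"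
    and g [measurable]: "g \<in> borel_measurable borel" and gper: "periodic g"
    and wg: "has_weak_gradient f g" and s: "0 \<le> s"
  shows "AE x in torus. f (x + s *\<^sub>R h) - f x = (\<integral>r. indicator {0..s} r * (h \<bullet> g (x + r *\<^sub>R h)) \<partial>lborel)"
proof -
  interpret P: pair_sigma_finite "torus :: (real ^ 'd) measure" "lborel :: real measure" ..
  have fint: "integrable torus f" and gint: "integrable torus g"
    using wg by (auto simp: has_weak_gradient_def)
  have gnorm: "(\<integral>\<^sup>+x. ennreal (norm (g x)) \<partial>torus) = ennreal (\<integral>x. norm (g x) \<partial>torus)"
    using gint by (intro nn_integral_eq_integral) auto
  have ghbound: "(\<integral>\<^sup>+x. ennreal \<bar>c x * (h \<bullet> g (x + r *\<^sub>R h))\<bar> \<partial>torus) \<le> ennreal (B * norm h * (\<integral>x. norm (g x) \<partial>torus))"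
    if c: "\<And>x. x \<in> cbox 0 1 \<Longrightarrow> \<bar>c x\<bar> \<le> B" and B: "0 \<le> B" for c B r
  proof -
    have "(\<integral>\<^sup>+x. ennreal \<bar>c x * (h \<bullet> g (x + r *\<^sub>R h))\<bar> \<partial>torus) \<le> (\<integral>\<^sup>+x. ennreal (B * norm h) * ennreal (norm (g (x + r *\<^sub>R h))) \<partial>torus)"
    proof (rule nn_integral_mono)
      fix x :: "real ^ 'd" assume "x \<in> space torus"
      then have "\<bar>c x\<bar> * \<bar>h \<bullet> g (x + r *\<^sub>R h)\<bar> \<le> B * (norm h * norm (g (x + r *\<^sub>R h)))"
        using c B by (intro mult_mono Cauchy_Schwarz_ineq2) auto
      then show "ennreal \<bar>c x * (h \<bullet> g (x + r *\<^sub>R h))\<bar> \<le> ennreal (B * norm h) * ennreal (norm (g (x + r *\<^sub>R h)))"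
        using B by (simp add: ennreal_mult[symmetric] abs_mult mult.assoc ennreal_leI)
    qed
    also have "\<dots> = ennreal (B * norm h) * (\<integral>\<^sup>+x. ennreal (norm (g (x + r *\<^sub>R h))) \<partial>torus)"
      by (intro nn_integral_cmult borel_measurable_torusI) measurable
    also have "(\<integral>\<^sup>+x. ennreal (norm (g (x + r *\<^sub>R h))) \<partial>torus) = (\<integral>\<^sup>+x. ennreal (norm (g x)) \<partial>torus)"
      using gper by (intro nn_integral_torus_shift) (auto simp: periodic_def)
    finally show ?thesis using B by (simp add: gnorm ennreal_mult)
  qed
  have Jint: "integrable torus (\<lambda>x. \<integral>r. indicator {0..s} r * (h \<bullet> g (x + r *\<^sub>R h)) \<partial>lborel)"
  proof -
    have "integrable (torus \<Otimes>\<^sub>M lborel) (\<lambda>(x, r). indicator {0..s} r * (h \<bullet> g (x + r *\<^sub>R h)))"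
      using ghbound[of "\<lambda>x. 1" 1] by (intro integrable_torus_strip) auto
    then show ?thesis by (rule P.integrable_fst[unfolded case_prod_conv])
  qed
  have fshift: "integrable torus (\<lambda>x. f (x + s *\<^sub>R h))"
    using fint fper by (simp add: integrable_torus_shift)
  define q where "q x = f (x + s *\<^sub>R h) - f x - (\<integral>r. indicator {0..s} r * (h \<bullet> g (x + r *\<^sub>R h)) \<partial>lborel)" for x
  have "AE x in torus. q x = 0"
  proof (rule torus_test_separation)
    show "q \<in> borel_measurable borel" unfolding q_def by measurable
    show "integrable torus q" unfolding q_def using fint fshift Jint by auto
    fix \<phi> :: "real ^ 'd \<Rightarrow> real" and \<psi> assume test: "torus_test \<phi> \<psi>"
    have \<phi>c: "continuous_on UNIV \<phi>" using test by (rule torus_test_continuous)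
    have \<psi>c: "continuous_on UNIV \<psi>" using test by (simp add: torus_test_def)
    have [measurable]: "\<phi> \<in> borel_measurable borel" "\<psi> \<in> borel_measurable borel"
      using \<phi>c \<psi>c by (auto intro: borel_measurable_continuous_onI)
    have \<phi>per: "periodic \<phi>" using test by (simp add: torus_test_def)
    obtain B where B: "0 \<le> B" "\<And>x. \<bar>\<phi> x\<bar> \<le> B"
    proof -
      have "bounded (\<phi> ` cbox 0 1)"
        by (intro compact_imp_bounded compact_continuous_image continuous_on_subset[OF \<phi>c]) auto
      then obtain B where B: "\<And>x. x \<in> cbox 0 1 \<Longrightarrow> \<bar>\<phi> x\<bar> \<le> B" "0 < B"
        unfolding bounded_pos by auto
      have "\<bar>\<phi> x\<bar> \<le> B" for x
        using B(1)[of "vfrac x"] unit_cell_subset vfrac_in_unit_cell[of x] periodic_vfrac[OF \<phi>per] by auto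
      then show thesis using B(2) that[of B] by auto
    qed
    obtain C where C: "0 \<le> C" "\<And>x r. x \<in> cbox 0 1 \<Longrightarrow> 0 \<le> r \<Longrightarrow> r \<le> s \<Longrightarrow> norm (\<psi> (x - r *\<^sub>R h)) \<le> C"
    proof -
      have "compact ((\<lambda>(x, r). \<psi> (x - r *\<^sub>R h)) ` (cbox 0 1 \<times> {0..s}))"
        unfolding case_prod_unfold
        by (intro compact_continuous_image compact_Times continuous_on_compose2[OF \<psi>c] continuous_intros) auto
      then obtain C where C: "0 < C" "\<And>y. y \<in> (\<lambda>(x, r). \<psi> (x - r *\<^sub>R h)) ` (cbox 0 1 \<times> {0..s}) \<Longrightarrow> norm y \<le> C"
        using compact_imp_bounded bounded_pos by metis
      have "norm (\<psi> (x - r *\<^sub>R h)) \<le> C" if "x \<in> cbox 0 1" "0 \<le> r" "r \<le> s" for x r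
        by (rule C(2), rule image_eqI[of _ _ "(x, r)"]) (use that in auto)
      then show thesis using C(1) that[of C] by auto
    qed
    have f\<psi>int: "integrable torus (\<lambda>x. f x *\<^sub>R \<psi> (x - r *\<^sub>R h))" if "0 \<le> r" "r \<le> s" for r
    proof (rule Bochner_Integration.integrable_bound)
      show "integrable torus (\<lambda>x. C * f x)" using fint by simp
      show "AE x in torus. norm (f x *\<^sub>R \<psi> (x - r *\<^sub>R h)) \<le> norm (C * f x)"
        using C(1) C(2)[OF _ that] by (intro AE_I2) (auto simp: abs_mult mult.commute[of C] intro!: mult_left_mono)
    qed (intro borel_measurable_torusI, measurable)
    have \<phi>gint: "integrable torus (\<lambda>x. \<phi> (x + k) *\<^sub>R g x)" for k
    proof (rule Bochner_Integration.integrable_bound)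
      show "integrable torus (\<lambda>x. B *\<^sub>R g x)" using gint by simp
      show "AE x in torus. norm (\<phi> (x + k) *\<^sub>R g x) \<le> norm (B *\<^sub>R g x)"
        using B by (intro AE_I2) (auto intro!: mult_right_mono)
    qed (intro borel_measurable_torusI, measurable)
    have f\<phi>int: "integrable torus (\<lambda>x. f x * \<phi> (x + k))" for k
    proof (rule Bochner_Integration.integrable_bound)
      show "integrable torus (\<lambda>x. B * f x)" using fint by simp
      show "AE x in torus. norm (f x * \<phi> (x + k)) \<le> norm (B * f x)"
        using B by (intro AE_I2) (auto simp: abs_mult mult.commute[of B] intro!: mult_left_mono)
    qed (intro borel_measurable_torusI, measurable)
    have weak: "(\<integral>x. f x * (h \<bullet> \<psi> (x - r *\<^sub>R h)) \<partial>torus) = - (\<integral>x. \<phi> x * (h \<bullet> g (x + r *\<^sub>R h)) \<partial>torus)"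
      if r: "0 \<le> r" "r \<le> s" for r
    proof -
      have "(\<integral>x. f x * (h \<bullet> \<psi> (x - r *\<^sub>R h)) \<partial>torus) = h \<bullet> (\<integral>x. f x *\<^sub>R \<psi> (x - r *\<^sub>R h) \<partial>torus)"
        by (subst integral_inner_right[symmetric]) (use f\<psi>int[OF r] in \<open>auto simp: inner_scaleR_right\<close>)
      also have "\<dots> = - (h \<bullet> (\<integral>x. \<phi> (x - r *\<^sub>R h) *\<^sub>R g x \<partial>torus))"
        using has_weak_gradient_test[OF wg torus_test_shift[OF test, of "- (r *\<^sub>R h)"]] by simp
      also have "h \<bullet> (\<integral>x. \<phi> (x - r *\<^sub>R h) *\<^sub>R g x \<partial>torus) = (\<integral>x. \<phi> (x - r *\<^sub>R h) * (h \<bullet> g x) \<partial>torus)"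
        by (subst integral_inner_right[symmetric]) (use \<phi>gint[of "- (r *\<^sub>R h)"] in \<open>auto simp: inner_scaleR_right\<close>)
      also have "\<dots> = (\<integral>x. \<phi> ((x + r *\<^sub>R h) - r *\<^sub>R h) * (h \<bullet> g (x + r *\<^sub>R h)) \<partial>torus)"
      proof -
        have "periodic (\<lambda>x. \<phi> (x - r *\<^sub>R h) * (h \<bullet> g x))"
          using periodic_shift[OF \<phi>per, of "- (r *\<^sub>R h)"] gper by (simp add: periodic_def)
        then show ?thesis
          by (intro integral_torus_shift[of "\<lambda>x. \<phi> (x - r *\<^sub>R h) * (h \<bullet> g x)", symmetric]) measurable
      qed
      finally show ?thesis by simp
    qed
    have "(\<integral>x. f x * (\<phi> x - \<phi> (x - s *\<^sub>R h)) \<partial>torus)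
        = (\<integral>x. (\<integral>r. indicator {0..s} r * (f x * (h \<bullet> \<psi> (x - r *\<^sub>R h))) \<partial>lborel) \<partial>torus)"
      by (subst torus_test_line_integral[OF test s, symmetric]) (simp add: integral_mult_right_zero[symmetric] mult_ac del: integral_mult_right_zero)
    also have "\<dots> = (\<integral>r. (\<integral>x. indicator {0..s} r * (f x * (h \<bullet> \<psi> (x - r *\<^sub>R h))) \<partial>torus) \<partial>lborel)"
    proof (rule P.Fubini_integral[symmetric], rule integrable_torus_strip)
      show "(\<lambda>(x, r). f x * (h \<bullet> \<psi> (x - r *\<^sub>R h))) \<in> borel_measurable (borel \<Otimes>\<^sub>M borel)"
        by measurable
      fix r assume r: "0 \<le> r" "r \<le> s"
      have "(\<integral>\<^sup>+x. ennreal \<bar>f x * (h \<bullet> \<psi> (x - r *\<^sub>R h))\<bar> \<partial>torus) \<le> (\<integral>\<^sup>+x. ennreal (norm h * C * \<bar>f x\<bar>) \<partial>torus)"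
      proof (intro nn_integral_mono ennreal_leI)
        fix x :: "real ^ 'd" assume "x \<in> space torus"
        then have "\<bar>h \<bullet> \<psi> (x - r *\<^sub>R h)\<bar> \<le> norm h * C"
          using C(2)[of x r] r by (intro order_trans[OF Cauchy_Schwarz_ineq2] mult_left_mono) auto
        then have "\<bar>f x\<bar> * \<bar>h \<bullet> \<psi> (x - r *\<^sub>R h)\<bar> \<le> \<bar>f x\<bar> * (norm h * C)" by (intro mult_left_mono) auto
        then show "\<bar>f x * (h \<bullet> \<psi> (x - r *\<^sub>R h))\<bar> \<le> norm h * C * \<bar>f x\<bar>" by (simp add: abs_mult mult_ac)
      qed
      also have "\<dots> = ennreal (\<integral>x. norm h * C * \<bar>f x\<bar> \<partial>torus)"
        using fint C(1) by (intro nn_integral_eq_integral) auto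
      finally show "(\<integral>\<^sup>+x. ennreal \<bar>f x * (h \<bullet> \<psi> (x - r *\<^sub>R h))\<bar> \<partial>torus) \<le> ennreal (\<integral>x. norm h * C * \<bar>f x\<bar> \<partial>torus)" .
    qed
    also have "\<dots> = (\<integral>r. - (\<integral>x. indicator {0..s} r * (\<phi> x * (h \<bullet> g (x + r *\<^sub>R h))) \<partial>torus) \<partial>lborel)"
      by (intro Bochner_Integration.integral_cong) (auto simp: indicator_def weak)
    also have "\<dots> = - (\<integral>x. (\<integral>r. indicator {0..s} r * (\<phi> x * (h \<bullet> g (x + r *\<^sub>R h))) \<partial>lborel) \<partial>torus)"
      unfolding integral_minus
      by (subst P.Fubini_integral) (auto intro!: integrable_torus_strip ghbound B)
    also have "\<dots> = - (\<integral>x. \<phi> x * (\<integral>r. indicator {0..s} r * (h \<bullet> g (x + r *\<^sub>R h)) \<partial>lborel) \<partial>torus)"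
      by (simp add: integral_mult_right_zero[symmetric] mult_ac del: integral_mult_right_zero)
    finally have 1: "(\<integral>x. f x * (\<phi> x - \<phi> (x - s *\<^sub>R h)) \<partial>torus)
       = - (\<integral>x. \<phi> x * (\<integral>r. indicator {0..s} r * (h \<bullet> g (x + r *\<^sub>R h)) \<partial>lborel) \<partial>torus)" .
    have 2: "(\<integral>x. f x * \<phi> (x - s *\<^sub>R h) \<partial>torus) = (\<integral>x. f (x + s *\<^sub>R h) * \<phi> x \<partial>torus)"
    proof -
      have "(\<integral>x. f x * \<phi> (x - s *\<^sub>R h) \<partial>torus) = (\<integral>x. f (x + s *\<^sub>R h) * \<phi> ((x + s *\<^sub>R h) - s *\<^sub>R h) \<partial>torus)"
      proof -
        have "periodic (\<lambda>x. f x * \<phi> (x - s *\<^sub>R h))"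
          using periodic_shift[OF \<phi>per, of "- (s *\<^sub>R h)"] fper by (simp add: periodic_def)
        then show ?thesis
          by (intro integral_torus_shift[of "\<lambda>x. f x * \<phi> (x - s *\<^sub>R h)", symmetric]) measurable
      qed
      then show ?thesis by simp
    qed
    have i1: "integrable torus (\<lambda>x. f (x + s *\<^sub>R h) * \<phi> x)"
    proof (rule Bochner_Integration.integrable_bound)
      show "integrable torus (\<lambda>x. B * f (x + s *\<^sub>R h))" using fshift by simp
      show "AE x in torus. norm (f (x + s *\<^sub>R h) * \<phi> x) \<le> norm (B * f (x + s *\<^sub>R h))"
        using B by (intro AE_I2) (auto simp: abs_mult mult.commute[of B] intro!: mult_left_mono)
    qed (intro borel_measurable_torusI, measurable)
    have i2: "integrable torus (\<lambda>x. (\<integral>r. indicator {0..s} r * (h \<bullet> g (x + r *\<^sub>R h)) \<partial>lborel) * \<phi> x)" (is "integrable _ (\<lambda>x. ?J x * _)")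
    proof (rule Bochner_Integration.integrable_bound)
      show "integrable torus (\<lambda>x. B * ?J x)" using Jint by simp
      show "AE x in torus. norm (?J x * \<phi> x) \<le> norm (B * ?J x)"
        using B by (intro AE_I2) (auto simp: abs_mult mult.commute[of B] intro!: mult_left_mono)
    qed (intro borel_measurable_torusI, measurable)
    have "(\<integral>x. q x * \<phi> x \<partial>torus) = (\<integral>x. f (x + s *\<^sub>R h) * \<phi> x \<partial>torus) - (\<integral>x. f x * \<phi> x \<partial>torus) - (\<integral>x. ?J x * \<phi> x \<partial>torus)"
      unfolding q_def left_diff_distrib using i1 i2 f\<phi>int[of 0] by simp
    also have "\<dots> = 0"
      using 1 2 f\<phi>int[of 0] f\<phi>int[of "- (s *\<^sub>R h)"] by (simp add: right_diff_distrib mult.commute[of "\<phi> _"])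
    finally show "(\<integral>x. q x * \<phi> x \<partial>torus) = 0" .
  qed
  then show ?thesis by eventually_elim (simp add: q_def)
qed

section \<open>Chain rule and translation estimate\<close>

text \<open>The path \<open>\<tau>\<close> is only absolutely continuous, so the fundamental theorem is not applied to
\<open>\<Phi> \<circ> \<tau>\<close>. On short intervals the mean value theorem gives the bound up to an error \<open>\<delta>\<close> in the
factor \<open>\<bar>\<phi> (\<tau> r)\<bar>\<close>, since \<open>\<tau>\<close> oscillates little there. Both sides are additive over adjacent
intervals, whence the bound holds on \<open>[0, 1]\<close> by bisection.\<close>

lemma chain_rule_along_path:
  fixes \<Phi> \<phi> \<gamma> \<tau> :: "real \<Rightarrow> real"
  assumes d\<Phi>: "\<And>y. (\<Phi> has_real_derivative \<phi> y) (at y)" and \<phi>: "continuous_on UNIV \<phi>"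
    and \<gamma>: "\<gamma> absolutely_integrable_on {0..1}"
    and \<tau>: "\<And>s. s \<in> {0..1} \<Longrightarrow> \<tau> s = c + integral {0..s} \<gamma>"
  shows "(\<lambda>r. \<bar>\<phi> (\<tau> r)\<bar> * \<bar>\<gamma> r\<bar>) absolutely_integrable_on {0..1}"
    and "\<bar>\<Phi> (\<tau> 1) - \<Phi> (\<tau> 0)\<bar> \<le> integral {0..1} (\<lambda>r. \<bar>\<phi> (\<tau> r)\<bar> * \<bar>\<gamma> r\<bar>)"
proof -
  have \<gamma>i: "\<gamma> integrable_on {0..1}" and a\<gamma>: "(\<lambda>r. \<bar>\<gamma> r\<bar>) absolutely_integrable_on {0..1}"
    using \<gamma> absolutely_integrable_norm[OF \<gamma>] by (auto simp: set_lebesgue_integral_eq_integral o_def)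
  then have a\<gamma>i: "(\<lambda>r. \<bar>\<gamma> r\<bar>) integrable_on {0..1}" by (simp add: set_lebesgue_integral_eq_integral)
  have \<tau>c: "continuous_on {0..1} \<tau>"
  proof -
    have "continuous_on {0..1} (\<lambda>s. c + integral {0..s} \<gamma>)"
      by (intro continuous_intros indefinite_integral_continuous_1 \<gamma>i)
    then show ?thesis using \<tau> by (subst continuous_on_cong[OF refl]) auto
  qed
  have \<phi>\<tau>: "continuous_on {0..1} (\<lambda>r. \<bar>\<phi> (\<tau> r)\<bar>)"
    by (intro continuous_on_rabs continuous_on_compose2[OF \<phi> \<tau>c]) auto
  show abs: "(\<lambda>r. \<bar>\<phi> (\<tau> r)\<bar> * \<bar>\<gamma> r\<bar>) absolutely_integrable_on {0..1}"
    by (rule absolutely_integrable_bounded_measurable_product_real)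
      (auto intro!: continuous_imp_measurable_on_sets_lebesgue \<phi>\<tau> a\<gamma> compact_imp_bounded compact_continuous_image)
  have main: "\<bar>\<Phi> (\<tau> 1) - \<Phi> (\<tau> 0)\<bar> \<le> integral {0..1} (\<lambda>r. (\<bar>\<phi> (\<tau> r)\<bar> + \<delta>) * \<bar>\<gamma> r\<bar>)" if \<delta>: "0 < \<delta>" for \<delta>
  proof -
    let ?k = "\<lambda>r. (\<bar>\<phi> (\<tau> r)\<bar> + \<delta>) * \<bar>\<gamma> r\<bar>"
    have ki: "?k integrable_on {0..1}"
      unfolding distrib_right
      by (intro integrable_add integrable_on_mult_right a\<gamma>i set_lebesgue_integral_eq_integral(1)[OF abs])
    have "0 \<le> (0::real) \<and> (1::real) \<le> 1 \<longrightarrow> \<bar>\<Phi> (\<tau> 1) - \<Phi> (\<tau> 0)\<bar> \<le> integral {0..1} ?k"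
    proof (rule Bolzano[where P = "\<lambda>a b. 0 \<le> a \<and> b \<le> 1 \<longrightarrow> \<bar>\<Phi> (\<tau> b) - \<Phi> (\<tau> a)\<bar> \<le> integral {a..b} ?k"])
      fix a b c :: real
      assume *: "0 \<le> a \<and> b \<le> 1 \<longrightarrow> \<bar>\<Phi> (\<tau> b) - \<Phi> (\<tau> a)\<bar> \<le> integral {a..b} ?k"
        "0 \<le> b \<and> c \<le> 1 \<longrightarrow> \<bar>\<Phi> (\<tau> c) - \<Phi> (\<tau> b)\<bar> \<le> integral {b..c} ?k" "a \<le> b" "b \<le> c"
      show "0 \<le> a \<and> c \<le> 1 \<longrightarrow> \<bar>\<Phi> (\<tau> c) - \<Phi> (\<tau> a)\<bar> \<le> integral {a..c} ?k"
      proof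
        assume ac: "0 \<le> a \<and> c \<le> 1"
        then have "?k integrable_on {a..c}" by (intro integrable_subinterval_real[OF ki]) auto
        then have "integral {a..b} ?k + integral {b..c} ?k = integral {a..c} ?k"
          using * by (intro Henstock_Kurzweil_Integration.integral_combine) auto
        then show "\<bar>\<Phi> (\<tau> c) - \<Phi> (\<tau> a)\<bar> \<le> integral {a..c} ?k" using * ac by linarith
      qed
    next
      fix x :: real assume x: "0 \<le> x" "x \<le> 1"
      have "isCont \<phi> (\<tau> x)" using \<phi> by (simp add: continuous_on_eq_continuous_at)
      then obtain \<epsilon> where \<epsilon>: "0 < \<epsilon>" "\<And>y. dist y (\<tau> x) < \<epsilon> \<Longrightarrow> dist (\<phi> y) (\<phi> (\<tau> x)) < \<delta> / 2"
        using \<delta> unfolding continuous_at_eps_delta by (metis half_gt_zero)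
      obtain d where d: "0 < d" "\<And>r. r \<in> {0..1} \<Longrightarrow> dist r x < d \<Longrightarrow> dist (\<tau> r) (\<tau> x) < \<epsilon>"
        using \<tau>c x \<epsilon>(1) unfolding continuous_on_iff by (metis atLeastAtMost_iff)
      show "\<exists>d>0. \<forall>a b. a \<le> x \<and> x \<le> b \<and> b - a < d \<longrightarrow> (0 \<le> a \<and> b \<le> 1 \<longrightarrow> \<bar>\<Phi> (\<tau> b) - \<Phi> (\<tau> a)\<bar> \<le> integral {a..b} ?k)"
      proof (intro exI[of _ d] conjI allI impI d(1))
        fix a b assume ab: "a \<le> x \<and> x \<le> b \<and> b - a < d" and ab01: "0 \<le> a \<and> b \<le> 1"
        let ?M = "\<bar>\<phi> (\<tau> x)\<bar> + \<delta> / 2"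
        have near: "dist (\<tau> r) (\<tau> x) < \<epsilon>" if "r \<in> {a..b}" for r
          using that ab ab01 by (intro d(2)) (auto simp: dist_real_def)
        have "norm (\<Phi> (\<tau> b) - \<Phi> (\<tau> a)) \<le> ?M * norm (\<tau> b - \<tau> a)"
        proof (rule field_differentiable_bound[where S = "ball (\<tau> x) \<epsilon>" and f' = \<phi>])
          show "norm (\<phi> z) \<le> ?M" if "z \<in> ball (\<tau> x) \<epsilon>" for z
          proof -
            have "\<bar>\<phi> z - \<phi> (\<tau> x)\<bar> < \<delta> / 2"
              using \<epsilon>(2)[of z] that by (simp add: dist_commute dist_real_def)
            then show ?thesis unfolding real_norm_def by linarith
          qed
        qed (use d\<Phi> near ab in \<open>auto intro: has_field_derivative_at_within simp: dist_commute\<close>)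
        also have "\<tau> b - \<tau> a = integral {a..b} \<gamma>"
        proof -
          have "\<gamma> integrable_on {0..b}" using ab01 by (intro integrable_subinterval_real[OF \<gamma>i]) auto
          then have "integral {0..a} \<gamma> + integral {a..b} \<gamma> = integral {0..b} \<gamma>"
            using ab ab01 by (intro Henstock_Kurzweil_Integration.integral_combine) auto
          then show ?thesis using \<tau>[of a] \<tau>[of b] ab ab01 by auto
        qed
        also have "?M * norm (integral {a..b} \<gamma>) \<le> ?M * integral {a..b} (\<lambda>r. \<bar>\<gamma> r\<bar>)"
          using ab01 \<delta> by (intro mult_left_mono integral_norm_bound_integral
            integrable_subinterval_real[OF \<gamma>i] integrable_subinterval_real[OF a\<gamma>i]) auto
        also have "\<dots> = integral {a..b} (\<lambda>r. ?M * \<bar>\<gamma> r\<bar>)" by simp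
        also have "\<dots> \<le> integral {a..b} ?k"
        proof (rule integral_le)
          show "(\<lambda>r. ?M * \<bar>\<gamma> r\<bar>) integrable_on {a..b}"
            using ab01 by (intro integrable_on_mult_right integrable_subinterval_real[OF a\<gamma>i]) auto
          show "?k integrable_on {a..b}" using ab01 by (intro integrable_subinterval_real[OF ki]) auto
          fix r assume r: "r \<in> {a..b}"
          have "?M \<le> \<bar>\<phi> (\<tau> r)\<bar> + \<delta>" using \<epsilon>(2)[OF near[OF r]] unfolding dist_real_def by linarith
          then show "?M * \<bar>\<gamma> r\<bar> \<le> ?k r" by (intro mult_right_mono) auto
        qed
        finally show "\<bar>\<Phi> (\<tau> b) - \<Phi> (\<tau> a)\<bar> \<le> integral {a..b} ?k" by simp
      qed
    qed simp
    then show ?thesis by simp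
  qed
  show "\<bar>\<Phi> (\<tau> 1) - \<Phi> (\<tau> 0)\<bar> \<le> integral {0..1} (\<lambda>r. \<bar>\<phi> (\<tau> r)\<bar> * \<bar>\<gamma> r\<bar>)"
  proof (rule field_le_epsilon)
    fix e :: real assume e: "0 < e"
    define G where "G = integral {0..1} (\<lambda>r. \<bar>\<gamma> r\<bar>)"
    have G: "0 \<le> G" unfolding G_def by (rule integral_nonneg[OF a\<gamma>i]) auto
    define \<delta> where "\<delta> = e / (G + 1)"
    have \<delta>: "0 < \<delta>" "\<delta> * G \<le> e" using e G by (auto simp: \<delta>_def field_simps)
    have "integral {0..1} (\<lambda>r. (\<bar>\<phi> (\<tau> r)\<bar> + \<delta>) * \<bar>\<gamma> r\<bar>)
        = integral {0..1} (\<lambda>r. \<bar>\<phi> (\<tau> r)\<bar> * \<bar>\<gamma> r\<bar>) + \<delta> * G"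
      unfolding distrib_right G_def
      by (subst integral_add) (auto intro!: integrable_on_mult_right a\<gamma>i set_lebesgue_integral_eq_integral(1)[OF abs])
    then show "\<bar>\<Phi> (\<tau> 1) - \<Phi> (\<tau> 0)\<bar> \<le> integral {0..1} (\<lambda>r. \<bar>\<phi> (\<tau> r)\<bar> * \<bar>\<gamma> r\<bar>) + e"
      using main[OF \<delta>(1)] \<delta>(2) by linarith
  qed
qed

lemma (in finite_measure) square_integral_le_nn_integral:
  fixes f :: "'a \<Rightarrow> real"
  assumes f: "integrable M f" and one: "measure M (space M) = 1"
  shows "ennreal ((\<integral>x. f x \<partial>M)\<^sup>2) \<le> (\<integral>\<^sup>+x. ennreal ((f x)\<^sup>2) \<partial>M)"
proof (cases "(\<integral>\<^sup>+x. ennreal ((f x)\<^sup>2) \<partial>M) = \<infinity>")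
  case False
  have [measurable]: "f \<in> borel_measurable M" using f by auto
  have sq: "integrable M (\<lambda>x. (f x)\<^sup>2)"
    using False by (intro integrableI_bounded) (auto simp: top.not_eq_extremum)
  define y where "y = (\<integral>x. f x \<partial>M)"
  have "y\<^sup>2 = (\<integral>x. 2 * y * f x - y\<^sup>2 \<partial>M)"
    using f one by (simp add: y_def power2_eq_square)
  also have "\<dots> \<le> (\<integral>x. (f x)\<^sup>2 \<partial>M)"
  proof (rule integral_mono)
    show "2 * y * f x - y\<^sup>2 \<le> (f x)\<^sup>2" for x
      using zero_le_power2[of "f x - y"] by (simp add: power2_diff algebra_simps)
  qed (use f sq in auto)
  finally have "ennreal (y\<^sup>2) \<le> ennreal (\<integral>x. (f x)\<^sup>2 \<partial>M)" by (rule ennreal_leI)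
  also have "\<dots> = (\<integral>\<^sup>+x. ennreal ((f x)\<^sup>2) \<partial>M)"
    by (rule nn_integral_eq_integral[symmetric]) (use sq in auto)
  finally show ?thesis by (simp add: y_def)
qed simp

text \<open>For almost every \<open>x\<close> the function \<open>r \<mapsto> v (x + r h)\<close> agrees for almost every \<open>r\<close>, and also for
\<open>r = 0\<close> and \<open>r = 1\<close>, with an absolutely continuous path with derivative \<open>h \<bullet> g (x + r h)\<close>. The
chain rule along this path bounds the increment of \<open>\<Phi> \<circ> v\<close>. After squaring by Jensen's
inequality, integration over \<open>x\<close> makes the bound independent of \<open>r\<close> by translation invariance.\<close>

lemma translation_estimate_weak_gradient:
  fixes v :: "real ^ 'd \<Rightarrow> real"
  assumes v [measurable]: "v \<in> borel_measurable borel" and vper: "periodic v"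
    and g [measurable]: "g \<in> borel_measurable borel" and gper: "periodic g"
    and wg: "has_weak_gradient v g"
    and d\<Phi>: "\<And>y. (\<Phi> has_real_derivative \<phi> y) (at y)" and \<phi>: "continuous_on UNIV \<phi>"
  shows "(\<integral>\<^sup>+x. ennreal ((\<Phi> (v (x + h)) - \<Phi> (v x))\<^sup>2) \<partial>torus)
    \<le> ennreal ((norm h)\<^sup>2) * (\<integral>\<^sup>+x. ennreal ((\<phi> (v x))\<^sup>2 * (norm (g x))\<^sup>2) \<partial>torus)"
proof -
  interpret P: pair_sigma_finite "torus :: (real ^ 'd) measure" "lborel :: real measure" ..
  define I where "I = restrict_space lborel {0..1::real}"
  interpret I: finite_measure I
    by (rule finite_measureI) (simp add: I_def emeasure_restrict_space space_restrict_space)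
  have I1: "measure I (space I) = 1"
    by (simp add: I_def measure_restrict_space space_restrict_space)
  have id_I: "(\<lambda>r. r) \<in> borel_measurable I"
    unfolding I_def by (intro measurable_restrict_space1) simp
  interpret Q: pair_sigma_finite "torus :: (real ^ 'd) measure" I ..
  have [measurable]: "\<phi> \<in> borel_measurable borel" using \<phi> by (rule borel_measurable_continuous_onI)
  have "continuous_on UNIV \<Phi>" using d\<Phi> by (meson DERIV_isCont continuous_at_imp_continuous_on)
  then have [measurable]: "\<Phi> \<in> borel_measurable borel" by (rule borel_measurable_continuous_onI)
  define J where "J x s = (\<integral>r. indicator {0..s} r * (h \<bullet> g (x + r *\<^sub>R h)) \<partial>lborel)" for x s
  have J_eq: "J x s = (\<integral>r. (if 0 \<le> r \<and> r \<le> s then h \<bullet> g (x + r *\<^sub>R h) else 0) \<partial>lborel)" for x s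
    unfolding J_def by (intro Bochner_Integration.integral_cong) (auto simp: indicator_def)
  have J_meas [measurable]: "(\<lambda>p. J (fst p) (snd p)) \<in> borel_measurable (torus \<Otimes>\<^sub>M lborel)"
    unfolding J_eq by measurable
  have line: "AE x in torus. v (x + s *\<^sub>R h) - v x = J x s" if "0 \<le> s" for s
    unfolding J_def by (rule weak_gradient_line_integral[OF v vper g gper wg that])
  have "AE s in lborel. AE x in torus. 0 \<le> s \<longrightarrow> v (x + s *\<^sub>R h) - v x = J x s"
  proof (rule AE_I2)
    show "AE x in torus. 0 \<le> s \<longrightarrow> v (x + s *\<^sub>R h) - v x = J x s" for s
      using line[of s] by (cases "0 \<le> s") auto
  qed
  (* The exceptional null set of x depends on s; Fubini turns this into one null set of x
     outside of which almost every s is good. *)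
  moreover have "{p \<in> space (torus \<Otimes>\<^sub>M lborel). 0 \<le> snd p \<longrightarrow> v (fst p + snd p *\<^sub>R h) - v (fst p) = J (fst p) (snd p)}
      \<in> sets (torus \<Otimes>\<^sub>M lborel)"
    by measurable
  ultimately have ae1: "AE x in torus. AE s in lborel. 0 \<le> s \<longrightarrow> v (x + s *\<^sub>R h) - v x = J x s"
    using P.AE_commute[of "\<lambda>x s. 0 \<le> s \<longrightarrow> v (x + s *\<^sub>R h) - v x = J x s"] by blast
  have ae2: "AE x in torus. v (x + h) - v x = J x 1" using line[of 1] by simp
  have gint: "integrable torus g" using wg by (simp add: has_weak_gradient_def)
  have ae3: "AE x in torus. integrable lborel (\<lambda>r. indicator {0..1} r * (h \<bullet> g (x + r *\<^sub>R h)))"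
  proof -
    have "integrable (torus \<Otimes>\<^sub>M lborel) (\<lambda>(x, r). indicator {0..1} r * (h \<bullet> g (x + r *\<^sub>R h)))"
    proof (rule integrable_torus_strip)
      fix r :: real
      have "(\<integral>\<^sup>+x. ennreal \<bar>h \<bullet> g (x + r *\<^sub>R h)\<bar> \<partial>torus) = (\<integral>\<^sup>+x. ennreal \<bar>h \<bullet> g x\<bar> \<partial>torus)"
        using gper by (intro nn_integral_torus_shift[where F = "\<lambda>x. ennreal \<bar>h \<bullet> g x\<bar>"]) (auto simp: periodic_def)
      also have "\<dots> = ennreal (\<integral>x. \<bar>h \<bullet> g x\<bar> \<partial>torus)"
        using gint by (intro nn_integral_eq_integral) auto
      finally show "(\<integral>\<^sup>+x. ennreal \<bar>h \<bullet> g (x + r *\<^sub>R h)\<bar> \<partial>torus) \<le> ennreal (\<integral>x. \<bar>h \<bullet> g x\<bar> \<partial>torus)" by simp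
    qed measurable
    from P.AE_integrable_fst[OF this] show ?thesis by simp
  qed
  let ?k = "\<lambda>x r. \<bar>\<phi> (v (x + r *\<^sub>R h))\<bar> * (norm h * norm (g (x + r *\<^sub>R h)))"
  have "AE x in torus. ennreal ((\<Phi> (v (x + h)) - \<Phi> (v x))\<^sup>2) \<le> (\<integral>\<^sup>+r. ennreal ((?k x r)\<^sup>2) \<partial>I)"
    using ae1 ae2 ae3
  proof eventually_elim
    fix x
    assume a1: "AE s in lborel. 0 \<le> s \<longrightarrow> v (x + s *\<^sub>R h) - v x = J x s"
      and a2: "v (x + h) - v x = J x 1"
      and a3: "integrable lborel (\<lambda>r. indicator {0..1} r * (h \<bullet> g (x + r *\<^sub>R h)))"
    define \<gamma> where "\<gamma> r = h \<bullet> g (x + r *\<^sub>R h)" for r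
    have [measurable]: "\<gamma> \<in> borel_measurable borel" unfolding \<gamma>_def by measurable
    have s\<gamma>: "set_integrable lborel {0..s} \<gamma>" if "s \<le> 1" for s
    proof -
      have "set_integrable lborel {0..1} \<gamma>" using a3 by (simp add: set_integrable_def \<gamma>_def)
      then show ?thesis by (rule set_integrable_subset) (use that in auto)
    qed
    have J_int: "J x s = integral {0..s} \<gamma>" if "s \<le> 1" for s
      using set_borel_integral_eq_integral(2)[OF s\<gamma>[OF that]]
      by (simp add: J_def set_lebesgue_integral_def \<gamma>_def)
    have abs\<gamma>: "\<gamma> absolutely_integrable_on {0..1}"
      using s\<gamma>[of 1] unfolding set_integrable_def by (simp add: integrable_completion)
    define \<tau> where "\<tau> s = v x + integral {0..s} \<gamma>" for s
    have \<tau>0: "\<tau> 0 = v x" and \<tau>1: "\<tau> 1 = v (x + h)"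
      using a2 J_int[of 1] by (simp_all add: \<tau>_def)
    note chain = chain_rule_along_path[OF d\<Phi> \<phi> abs\<gamma>, of \<tau> "v x", OF \<tau>_def]
    define K where "K r = \<bar>\<phi> (v (x + r *\<^sub>R h))\<bar> * \<bar>\<gamma> r\<bar>" for r
    have Km [measurable]: "K \<in> borel_measurable borel" unfolding K_def by measurable
    have aeK: "AE r in lborel. r \<in> {0..1} \<longrightarrow> \<bar>\<phi> (\<tau> r)\<bar> * \<bar>\<gamma> r\<bar> = K r"
      using a1
    proof eventually_elim
      fix r assume *: "0 \<le> r \<longrightarrow> v (x + r *\<^sub>R h) - v x = J x r"
      show "r \<in> {0..1} \<longrightarrow> \<bar>\<phi> (\<tau> r)\<bar> * \<bar>\<gamma> r\<bar> = K r"
      proof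
        assume r: "r \<in> {0..1}"
        then have "v (x + r *\<^sub>R h) = \<tau> r" using * J_int[of r] by (simp add: \<tau>_def algebra_simps)
        then show "\<bar>\<phi> (\<tau> r)\<bar> * \<bar>\<gamma> r\<bar> = K r" by (simp add: K_def)
      qed
    qed
    have aeK': "AE r in lebesgue. indicator {0..1} r *\<^sub>R (\<bar>\<phi> (\<tau> r)\<bar> * \<bar>\<gamma> r\<bar>) = indicator {0..1} r *\<^sub>R K r"
      using AE_completion[OF aeK] by eventually_elim (auto simp: indicator_def)
    have intK: "set_integrable lebesgue {0..1} K"
      unfolding set_integrable_def
    proof (rule integrable_cong_AE_imp[OF chain(1)[unfolded set_integrable_def]])
      show "AE r in lebesgue. indicator {0..1} r *\<^sub>R (\<bar>\<phi> (\<tau> r)\<bar> * \<bar>\<gamma> r\<bar>) = indicator {0..1} r *\<^sub>R K r"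
        by (rule aeK')
      show "(\<lambda>r. indicator {0..1} r *\<^sub>R K r) \<in> borel_measurable lebesgue"
        by (intro measurable_completion borel_measurable_scaleR) (use Km in auto)
    qed
    have eqK: "integral {0..1} (\<lambda>r. \<bar>\<phi> (\<tau> r)\<bar> * \<bar>\<gamma> r\<bar>) = (LINT r:{0..1}|lebesgue. K r)"
      unfolding set_lebesgue_integral_eq_integral(2)[OF chain(1), symmetric] set_lebesgue_integral_def
      using chain(1) aeK' unfolding set_integrable_def
      by (intro integral_cong_AE) (auto intro!: measurable_completion)
    have intK': "integrable I K"
      unfolding I_def using intK by (subst integrable_restrict_space)
        (auto simp: set_integrable_def integrable_completion)
    have "(LINT r:{0..1}|lebesgue. K r) = (\<integral>r. K r \<partial>I)"
      unfolding I_def by (subst integral_restrict_space) (auto simp: set_lebesgue_integral_def integral_completion)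
    then have le: "\<bar>\<Phi> (v (x + h)) - \<Phi> (v x)\<bar> \<le> (\<integral>r. K r \<partial>I)"
      using chain(2) eqK by (simp add: \<tau>0 \<tau>1)
    have "ennreal ((\<Phi> (v (x + h)) - \<Phi> (v x))\<^sup>2) \<le> ennreal ((\<integral>r. K r \<partial>I)\<^sup>2)"
      using le by (intro ennreal_leI) (metis abs_ge_zero power2_abs power_mono)
    also have "\<dots> \<le> (\<integral>\<^sup>+r. ennreal ((K r)\<^sup>2) \<partial>I)"
      by (rule I.square_integral_le_nn_integral[OF intK' I1])
    also have "\<dots> \<le> (\<integral>\<^sup>+r. ennreal ((?k x r)\<^sup>2) \<partial>I)"
      by (intro nn_integral_mono ennreal_leI power_mono)
        (auto simp: K_def \<gamma>_def intro!: mult_left_mono Cauchy_Schwarz_ineq2)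
    finally show "ennreal ((\<Phi> (v (x + h)) - \<Phi> (v x))\<^sup>2) \<le> (\<integral>\<^sup>+r. ennreal ((?k x r)\<^sup>2) \<partial>I)" .
  qed
  then have "(\<integral>\<^sup>+x. ennreal ((\<Phi> (v (x + h)) - \<Phi> (v x))\<^sup>2) \<partial>torus) \<le> (\<integral>\<^sup>+x. (\<integral>\<^sup>+r. ennreal ((?k x r)\<^sup>2) \<partial>I) \<partial>torus)"
    by (rule nn_integral_mono_AE)
  also have "\<dots> = (\<integral>\<^sup>+r. (\<integral>\<^sup>+x. ennreal ((?k x r)\<^sup>2) \<partial>torus) \<partial>I)"
    supply id_I [measurable]
    by (rule Q.Fubini'[symmetric]) measurable
  also have "\<dots> = (\<integral>\<^sup>+r. (\<integral>\<^sup>+x. ennreal ((\<bar>\<phi> (v x)\<bar> * (norm h * norm (g x)))\<^sup>2) \<partial>torus) \<partial>I)"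
    using vper gper by (intro nn_integral_cong nn_integral_torus_shift[where F = "\<lambda>x. ennreal ((\<bar>\<phi> (v x)\<bar> * (norm h * norm (g x)))\<^sup>2)"])
      (auto simp: periodic_def)
  also have "\<dots> = (\<integral>\<^sup>+x. ennreal ((\<bar>\<phi> (v x)\<bar> * (norm h * norm (g x)))\<^sup>2) \<partial>torus)"
    using I1 by (simp add: I.emeasure_eq_measure)
  also have "\<dots> = (\<integral>\<^sup>+x. ennreal ((norm h)\<^sup>2) * ennreal ((\<phi> (v x))\<^sup>2 * (norm (g x))\<^sup>2) \<partial>torus)"
    by (intro nn_integral_cong) (simp add: ennreal_mult[symmetric] power_mult_distrib mult_ac)
  also have "\<dots> = ennreal ((norm h)\<^sup>2) * (\<integral>\<^sup>+x. ennreal ((\<phi> (v x))\<^sup>2 * (norm (g x))\<^sup>2) \<partial>torus)"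
    by (rule nn_integral_cmult) (intro borel_measurable_torusI, measurable)
  finally show ?thesis .
qed

lemma has_weak_gradient_cong_AE:
  assumes wg: "has_weak_gradient f g"
    and [measurable]: "f' \<in> borel_measurable torus" "g' \<in> borel_measurable torus"
    and ff: "AE x in torus. f' x = f x" and gg: "AE x in torus. g' x = g x"
  shows "has_weak_gradient f' g'"
proof -
  have fi: "integrable torus f" and gi: "integrable torus g" using wg by (auto simp: has_weak_gradient_def)
  have [measurable]: "f \<in> borel_measurable torus" "g \<in> borel_measurable torus" using fi gi by auto
  show ?thesis
    unfolding has_weak_gradient_def
  proof (intro conjI allI impI)
    show "integrable torus f'" using fi ff by (subst integrable_cong_AE[where g = f]) auto
    show "integrable torus g'" using gi gg by (subst integrable_cong_AE[where g = g]) auto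
    fix \<phi> :: "real ^ 'a \<Rightarrow> real" and \<psi>
    assume "periodic \<phi> \<and> continuous_on UNIV \<psi> \<and> (\<forall>x. GDERIV \<phi> x :> \<psi> x)"
    then have test: "torus_test \<phi> \<psi>" by (simp add: torus_test_def)
    then have "\<phi> \<in> borel_measurable borel" "\<psi> \<in> borel_measurable borel"
      by (auto intro!: borel_measurable_continuous_onI torus_test_continuous simp: torus_test_def)
    then have [measurable]: "\<phi> \<in> borel_measurable torus" "\<psi> \<in> borel_measurable torus"
      by (auto intro: borel_measurable_torusI)
    have "(\<integral>x. f' x *\<^sub>R \<psi> x \<partial>torus) = (\<integral>x. f x *\<^sub>R \<psi> x \<partial>torus)"
      using ff by (intro integral_cong_AE) auto
    moreover have "(\<integral>x. \<phi> x *\<^sub>R g' x \<partial>torus) = (\<integral>x. \<phi> x *\<^sub>R g x \<partial>torus)"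
      using gg by (intro integral_cong_AE) auto
    ultimately show "(\<integral>x. f' x *\<^sub>R \<psi> x \<partial>torus) = - (\<integral>x. \<phi> x *\<^sub>R g' x \<partial>torus)"
      using has_weak_gradient_test[OF wg test] by simp
  qed
qed

text \<open>The estimate for the truncations of \<open>w\<close> does not involve the truncation level on its right-hand
side, because their gradients vanish outside \<open>\<bar>w\<bar> < m\<close>. Fatou's lemma therefore gives it for
\<open>w\<close>, even if \<open>w\<close> is not integrable.\<close>

lemma translation_estimate:
  fixes v :: "real ^ 'd \<Rightarrow> real"
  assumes v [measurable]: "v \<in> borel_measurable borel" and vper: "periodic v"
    and vw: "AE x in torus. v x = w x" and grad: "has_gradient w g"
    and d\<Phi>: "\<And>y. (\<Phi> has_real_derivative \<phi> y) (at y)" and \<phi>: "continuous_on UNIV \<phi>"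
  shows "(\<integral>\<^sup>+x. ennreal ((\<Phi> (v (x + h)) - \<Phi> (v x))\<^sup>2) \<partial>torus)
    \<le> ennreal ((norm h)\<^sup>2) * (\<integral>\<^sup>+x. ennreal ((\<phi> (w x))\<^sup>2 * (norm (g x))\<^sup>2) \<partial>torus)" (is "_ \<le> ?R")
proof -
  have "continuous_on UNIV \<Phi>" using d\<Phi> by (meson DERIV_isCont continuous_at_imp_continuous_on)
  then have [measurable]: "\<Phi> \<in> borel_measurable borel" by (rule borel_measurable_continuous_onI)
  define T where "T j x = truncate (real (Suc j)) (v x)" for j x
  have [measurable]: "T j \<in> borel_measurable borel" for j unfolding T_def truncate_def by measurable
  have bound: "(\<integral>\<^sup>+x. ennreal ((\<Phi> (T j (x + h)) - \<Phi> (T j x))\<^sup>2) \<partial>torus) \<le> ?R" for j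
  proof -
    define gj where "gj x = (if \<bar>w x\<bar> < real (Suc j) then g x else 0)" for x
    have wg: "has_weak_gradient (\<lambda>x. truncate (real (Suc j)) (w x)) gj"
      using grad unfolding has_gradient_def gj_def by (metis of_nat_0_less_iff zero_less_Suc)
    then have "gj \<in> borel_measurable torus" by (auto simp: has_weak_gradient_def)
    then obtain g' where g' [measurable]: "g' \<in> borel_measurable borel" and g'per: "periodic g'"
        and g'ae: "AE x in torus. g' x = gj x"
      by (rule borel_periodic_version_vec)
    have Tw: "AE x in torus. T j x = truncate (real (Suc j)) (w x)"
      using vw by eventually_elim (simp add: T_def)
    have wg': "has_weak_gradient (T j) g'"
      by (rule has_weak_gradient_cong_AE[OF wg _ _ Tw g'ae]) (auto intro!: borel_measurable_torusI)
    have Tper: "periodic (T j)" using vper by (simp add: periodic_def T_def)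
    have "(\<integral>\<^sup>+x. ennreal ((\<Phi> (T j (x + h)) - \<Phi> (T j x))\<^sup>2) \<partial>torus)
       \<le> ennreal ((norm h)\<^sup>2) * (\<integral>\<^sup>+x. ennreal ((\<phi> (T j x))\<^sup>2 * (norm (g' x))\<^sup>2) \<partial>torus)"
      by (rule translation_estimate_weak_gradient[OF _ Tper g' g'per wg' d\<Phi> \<phi>]) measurable
    also have "\<dots> \<le> ?R"
    proof (intro mult_left_mono nn_integral_mono_AE)
      show "AE x in torus. ennreal ((\<phi> (T j x))\<^sup>2 * (norm (g' x))\<^sup>2) \<le> ennreal ((\<phi> (w x))\<^sup>2 * (norm (g x))\<^sup>2)"
        using g'ae Tw by eventually_elim (auto simp: gj_def truncate_def)
    qed simp
    finally show ?thesis .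
  qed
  have T_lim: "\<forall>\<^sub>F j in sequentially. T j x = v x" for x
  proof -
    obtain N where "\<bar>v x\<bar> \<le> real N" using real_arch_simple by blast
    then show ?thesis
      unfolding T_def truncate_def by (intro eventually_sequentiallyI[of N]) auto
  qed
  have "(\<integral>\<^sup>+x. ennreal ((\<Phi> (v (x + h)) - \<Phi> (v x))\<^sup>2) \<partial>torus)
     = (\<integral>\<^sup>+x. liminf (\<lambda>j. ennreal ((\<Phi> (T j (x + h)) - \<Phi> (T j x))\<^sup>2)) \<partial>torus)"
  proof (rule nn_integral_cong)
    fix x
    have "\<forall>\<^sub>F j in sequentially. ennreal ((\<Phi> (T j (x + h)) - \<Phi> (T j x))\<^sup>2) = ennreal ((\<Phi> (v (x + h)) - \<Phi> (v x))\<^sup>2)"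
      using T_lim[of x] T_lim[of "x + h"] by eventually_elim simp
    then have "(\<lambda>j. ennreal ((\<Phi> (T j (x + h)) - \<Phi> (T j x))\<^sup>2)) \<longlonglongrightarrow> ennreal ((\<Phi> (v (x + h)) - \<Phi> (v x))\<^sup>2)"
      by (rule tendsto_eventually)
    then show "ennreal ((\<Phi> (v (x + h)) - \<Phi> (v x))\<^sup>2) = liminf (\<lambda>j. ennreal ((\<Phi> (T j (x + h)) - \<Phi> (T j x))\<^sup>2))"
      by (rule lim_imp_Liminf[OF trivial_limit_sequentially, symmetric])
  qed
  also have "\<dots> \<le> liminf (\<lambda>j. \<integral>\<^sup>+x. ennreal ((\<Phi> (T j (x + h)) - \<Phi> (T j x))\<^sup>2) \<partial>torus)"
    by (rule nn_integral_liminf) (intro borel_measurable_torusI, measurable)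
  also have "\<dots> \<le> ?R"
    by (rule order_trans[OF Liminf_le_Limsup Limsup_bounded]) (use bound in auto)
  finally show ?thesis .
qed

section \<open>Poincare and logarithmic Sobolev inequalities\<close>

lemma torus_pair_measurable:
  assumes "(\<lambda>(x, z). G x z) \<in> borel_measurable (borel \<Otimes>\<^sub>M borel)"
  shows "(\<lambda>(x, z). G x z) \<in> borel_measurable (torus \<Otimes>\<^sub>M torus)"
proof -
  have "(\<lambda>p. (fst p, snd p)) \<in> torus \<Otimes>\<^sub>M torus \<rightarrow>\<^sub>M borel \<Otimes>\<^sub>M borel" by measurable
  from measurable_compose[OF this assms] show ?thesis by (simp add: case_prod_unfold)
qed

lemma norm_square_le_card:
  fixes z :: "real ^ 'd"
  assumes "z \<in> cbox 0 1"
  shows "(norm z)\<^sup>2 \<le> real CARD('d)"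
proof -
  have "(norm z)\<^sup>2 = (\<Sum>i\<in>UNIV. (z $ i)\<^sup>2)"
    by (simp only: power2_norm_eq_inner inner_vec_def) (simp add: power2_eq_square)
  also have "\<dots> \<le> (\<Sum>i\<in>(UNIV :: 'd set). 1)"
    using assms by (intro sum_mono) (auto simp: mem_box_cart power_le_one)
  finally show ?thesis by simp
qed

lemma mean_translation_estimate:
  fixes a :: "real ^ 'd \<Rightarrow> real"
  assumes [measurable]: "a \<in> borel_measurable borel"
    and est: "\<And>h. (\<integral>\<^sup>+x. ennreal ((a (x + h) - a x)\<^sup>2) \<partial>torus) \<le> ennreal ((norm h)\<^sup>2) * F"
  shows "(\<integral>\<^sup>+x. (\<integral>\<^sup>+z. ennreal ((a (x + s *\<^sub>R z) - a x)\<^sup>2) \<partial>torus) \<partial>torus) \<le> ennreal (s\<^sup>2 * real CARD('d)) * F"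
proof -
  interpret P: pair_sigma_finite "torus :: (real ^ 'd) measure" "torus :: (real ^ 'd) measure" ..
  have "(\<integral>\<^sup>+x. (\<integral>\<^sup>+z. ennreal ((a (x + s *\<^sub>R z) - a x)\<^sup>2) \<partial>torus) \<partial>torus)
      = (\<integral>\<^sup>+z. (\<integral>\<^sup>+x. ennreal ((a (x + s *\<^sub>R z) - a x)\<^sup>2) \<partial>torus) \<partial>torus)"
    by (rule P.Fubini'[symmetric], rule torus_pair_measurable) measurable
  also have "\<dots> \<le> (\<integral>\<^sup>+z. ennreal (s\<^sup>2 * real CARD('d)) * F \<partial>(torus :: (real ^ 'd) measure))"
  proof (rule nn_integral_mono)
    fix z :: "real ^ 'd" assume "z \<in> space torus"
    then have "(norm (s *\<^sub>R z))\<^sup>2 \<le> s\<^sup>2 * real CARD('d)"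
      using norm_square_le_card[of z] by (simp add: power_mult_distrib mult_left_mono)
    then have "ennreal ((norm (s *\<^sub>R z))\<^sup>2) * F \<le> ennreal (s\<^sup>2 * real CARD('d)) * F"
      by (intro mult_right_mono ennreal_leI) auto
    then show "(\<integral>\<^sup>+x. ennreal ((a (x + s *\<^sub>R z) - a x)\<^sup>2) \<partial>torus) \<le> ennreal (s\<^sup>2 * real CARD('d)) * F"
      using est order_trans by blast
  qed
  also have "\<dots> = ennreal (s\<^sup>2 * real CARD('d)) * F"
    by (simp add: emeasure_torus)
  finally show ?thesis .
qed

text \<open>The deviation of \<open>a x\<close> from the mean is the average of \<open>a x - a (x + z)\<close> over the unit cube.\<close>

lemma torus_Poincare:
  fixes a :: "real ^ 'd \<Rightarrow> real"
  assumes [measurable]: "a \<in> borel_measurable borel" and per: "periodic a" and int: "integrable torus a"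
    and est: "\<And>h. (\<integral>\<^sup>+x. ennreal ((a (x + h) - a x)\<^sup>2) \<partial>torus) \<le> ennreal ((norm h)\<^sup>2) * F"
  shows "(\<integral>\<^sup>+x. ennreal ((a x - (\<integral>x. a x \<partial>torus))\<^sup>2) \<partial>torus) \<le> ennreal (real CARD('d)) * F"
proof -
  have "(\<integral>\<^sup>+x. ennreal ((a x - (\<integral>x. a x \<partial>torus))\<^sup>2) \<partial>torus)
      \<le> (\<integral>\<^sup>+x. (\<integral>\<^sup>+z. ennreal ((a (x + 1 *\<^sub>R z) - a x)\<^sup>2) \<partial>torus) \<partial>torus)"
  proof (rule nn_integral_mono)
    fix x :: "real ^ 'd"
    have "integrable torus (\<lambda>z. a (z + x))" using int per by (simp add: integrable_torus_shift)
    then have i: "integrable torus (\<lambda>z. a (x + z) - a x)" by (simp add: add.commute)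
    have "(\<integral>z. a (x + z) - a x \<partial>torus) = (\<integral>z. a (z + x) \<partial>torus) - a x"
      using \<open>integrable torus (\<lambda>z. a (z + x))\<close> by (simp add: add.commute)
    then have "(a x - (\<integral>x. a x \<partial>torus))\<^sup>2 = (\<integral>z. a (x + z) - a x \<partial>torus)\<^sup>2"
      using per by (simp add: integral_torus_shift power2_commute)
    then show "ennreal ((a x - (\<integral>x. a x \<partial>torus))\<^sup>2) \<le> (\<integral>\<^sup>+z. ennreal ((a (x + 1 *\<^sub>R z) - a x)\<^sup>2) \<partial>torus)"
      using torus.square_integral_le_nn_integral[OF i] by simp
  qed
  also have "\<dots> \<le> ennreal (1\<^sup>2 * real CARD('d)) * F" by (rule mean_translation_estimate) (use est in auto)
  finally show ?thesis by simp
qed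

text \<open>The cube of side \<open>s \<le> 1\<close> at \<open>x\<close> is contained in the unit cell translated to \<open>x\<close>, over which the
integral of \<open>G\<close> does not depend on \<open>x\<close>.\<close>

lemma small_cube_average_le:
  fixes G :: "real ^ 'd \<Rightarrow> ennreal"
  assumes [measurable]: "G \<in> borel_measurable borel" and per: "periodic G" and s: "0 < s" "s \<le> 1"
  shows "(\<integral>\<^sup>+z. G (x + s *\<^sub>R z) \<partial>torus) \<le> ennreal (1 / s ^ CARD('d)) * (\<integral>\<^sup>+x. G x \<partial>torus)"
proof -
  define H where "H y = G y * indicator unit_cell ((1 / s) *\<^sub>R (y - x))" for y
  have [measurable]: "H \<in> borel_measurable borel" unfolding H_def by measurable
  have "(\<integral>\<^sup>+y. H y \<partial>lborel) = (\<integral>\<^sup>+z. ennreal (s ^ CARD('d)) * H (x + s *\<^sub>R z) \<partial>lborel)"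
    using s by (subst lborel_affine[of s x]) (auto simp: nn_integral_density nn_integral_distr)
  also have "\<dots> = ennreal (s ^ CARD('d)) * (\<integral>\<^sup>+z. G (x + s *\<^sub>R z) \<partial>torus)"
    using s by (simp add: nn_integral_cmult nn_integral_torus H_def)
  finally have eq: "(\<integral>\<^sup>+y. H y \<partial>lborel) = ennreal (s ^ CARD('d)) * (\<integral>\<^sup>+z. G (x + s *\<^sub>R z) \<partial>torus)" .
  have "(\<integral>\<^sup>+y. H y \<partial>lborel) \<le> (\<integral>\<^sup>+y. G y * indicator unit_cell (y - x) \<partial>lborel)"
  proof (rule nn_integral_mono)
    fix y :: "real ^ 'd"
    have "y - x \<in> unit_cell" if "(1 / s) *\<^sub>R (y - x) \<in> unit_cell"
    proof -
      have "0 \<le> y $ i - x $ i \<and> y $ i - x $ i < 1" for i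
      proof -
        have "0 \<le> (y $ i - x $ i) / s" "(y $ i - x $ i) / s < 1"
          using that by (auto simp: unit_cell_def)
        then show ?thesis using s by (simp add: field_simps zero_le_divide_iff)
      qed
      then show ?thesis by (simp add: unit_cell_def)
    qed
    then show "H y \<le> G y * indicator unit_cell (y - x)" by (auto simp: H_def indicator_def)
  qed
  also have "\<dots> = (\<integral>\<^sup>+y. G (x + y) * indicator unit_cell y \<partial>lborel)"
    by (subst lborel_distr_plus[of x, symmetric]) (simp add: nn_integral_distr)
  also have "\<dots> = (\<integral>\<^sup>+y. G (y + x) \<partial>torus)" by (simp add: nn_integral_torus add.commute)
  also have "\<dots> = (\<integral>\<^sup>+y. G y \<partial>torus)" using per by (intro nn_integral_torus_shift) auto
  finally have le: "ennreal (s ^ CARD('d)) * (\<integral>\<^sup>+z. G (x + s *\<^sub>R z) \<partial>torus) \<le> (\<integral>\<^sup>+y. G y \<partial>torus)"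
    unfolding eq .
  have "(\<integral>\<^sup>+z. G (x + s *\<^sub>R z) \<partial>torus)
      = ennreal (1 / s ^ CARD('d)) * (ennreal (s ^ CARD('d)) * (\<integral>\<^sup>+z. G (x + s *\<^sub>R z) \<partial>torus))"
    using s by (simp add: mult.assoc[symmetric] ennreal_mult[symmetric])
  also have "\<dots> \<le> ennreal (1 / s ^ CARD('d)) * (\<integral>\<^sup>+y. G y \<partial>torus)"
    using le by (rule mult_left_mono) simp
  finally show ?thesis .
qed

text \<open>The mean of \<open>a\<^sup>2\<close> over the cube of side \<open>s\<close> at \<open>x\<close> is at most \<open>m = \<Lambda> / s ^ d\<close>. As
\<open>a(x)\<^sup>2 \<le> 2 (a(x + s z) - a(x))\<^sup>2 + 2 a(x + s z)\<^sup>2\<close>, averaging over \<open>z\<close> yields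
\<open>a(x)\<^sup>2 \<le> 2 D(x) + 2 m\<close>, and the last term is absorbed when \<open>4 m < a(x)\<^sup>2\<close>.\<close>

lemma high_level_mass_le:
  fixes a :: "real ^ 'd \<Rightarrow> real"
  assumes [measurable]: "a \<in> borel_measurable borel" and per: "periodic a"
    and mass: "(\<integral>\<^sup>+x. ennreal ((a x)\<^sup>2) \<partial>torus) \<le> ennreal \<Lambda>" and \<Lambda>: "0 \<le> \<Lambda>"
    and est: "\<And>h. (\<integral>\<^sup>+x. ennreal ((a (x + h) - a x)\<^sup>2) \<partial>torus) \<le> ennreal ((norm h)\<^sup>2) * F"
    and s: "0 < s" "s \<le> 1"
  shows "(\<integral>\<^sup>+x. ennreal ((a x)\<^sup>2) * indicator {x. 4 * \<Lambda> / s ^ CARD('d) < (a x)\<^sup>2} x \<partial>torus)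
       \<le> ennreal (4 * s\<^sup>2 * real CARD('d)) * F"
proof -
  define D where "D x = (\<integral>\<^sup>+z. ennreal ((a (x + s *\<^sub>R z) - a x)\<^sup>2) \<partial>torus)" for x
  have Dm [measurable]: "D \<in> borel_measurable torus"
    unfolding D_def
    by (intro torus.borel_measurable_nn_integral torus_pair_measurable) measurable
  have pt: "ennreal ((a x)\<^sup>2) * indicator {x. 4 * \<Lambda> / s ^ CARD('d) < (a x)\<^sup>2} x \<le> 4 * D x" for x
  proof (cases "4 * \<Lambda> / s ^ CARD('d) < (a x)\<^sup>2")
    case True
    define m where "m = \<Lambda> / s ^ CARD('d)"
    have m: "0 \<le> m" "4 * m < (a x)\<^sup>2" using True \<Lambda> s by (auto simp: m_def)
    have avg: "(\<integral>\<^sup>+z. ennreal ((a (x + s *\<^sub>R z))\<^sup>2) \<partial>torus) \<le> ennreal m"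
    proof -
      have "(\<integral>\<^sup>+z. ennreal ((a (x + s *\<^sub>R z))\<^sup>2) \<partial>torus) \<le> ennreal (1 / s ^ CARD('d)) * (\<integral>\<^sup>+x. ennreal ((a x)\<^sup>2) \<partial>torus)"
        using per s by (intro small_cube_average_le[where G = "\<lambda>x. ennreal ((a x)\<^sup>2)"]) (auto simp: periodic_def)
      also have "\<dots> \<le> ennreal (1 / s ^ CARD('d)) * ennreal \<Lambda>" using mass by (rule mult_left_mono) simp
      also have "\<dots> = ennreal m" using s \<Lambda> by (simp add: m_def ennreal_mult[symmetric])
      finally show ?thesis .
    qed
    have "ennreal ((a x)\<^sup>2) = (\<integral>\<^sup>+z. ennreal ((a x)\<^sup>2) \<partial>(torus :: (real ^ 'd) measure))"
      by (simp add: emeasure_torus)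
    also have "\<dots> \<le> (\<integral>\<^sup>+z. 2 * ennreal ((a (x + s *\<^sub>R z) - a x)\<^sup>2) + 2 * ennreal ((a (x + s *\<^sub>R z))\<^sup>2) \<partial>torus)"
    proof (rule nn_integral_mono)
      fix z :: "real ^ 'd"
      have "(a x)\<^sup>2 \<le> 2 * (a (x + s *\<^sub>R z) - a x)\<^sup>2 + 2 * (a (x + s *\<^sub>R z))\<^sup>2"
        using zero_le_power2[of "2 * a (x + s *\<^sub>R z) - a x"] by (simp add: power2_eq_square algebra_simps)
      then have "ennreal ((a x)\<^sup>2) \<le> ennreal (2 * (a (x + s *\<^sub>R z) - a x)\<^sup>2 + 2 * (a (x + s *\<^sub>R z))\<^sup>2)"
        by (rule ennreal_leI)
      then show "ennreal ((a x)\<^sup>2) \<le> 2 * ennreal ((a (x + s *\<^sub>R z) - a x)\<^sup>2) + 2 * ennreal ((a (x + s *\<^sub>R z))\<^sup>2)"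
        by (simp add: ennreal_mult)
    qed
    also have "\<dots> = 2 * D x + 2 * (\<integral>\<^sup>+z. ennreal ((a (x + s *\<^sub>R z))\<^sup>2) \<partial>torus)"
      unfolding D_def by (subst nn_integral_add) (auto simp: nn_integral_cmult intro!: borel_measurable_torusI)
    also have "\<dots> \<le> 2 * D x + 2 * ennreal m" using avg by (intro add_left_mono mult_left_mono) auto
    finally have le: "ennreal ((a x)\<^sup>2) \<le> 2 * D x + 2 * ennreal m" .
    have "ennreal ((a x)\<^sup>2) \<le> 4 * D x"
    proof (cases "D x")
      case (real r)
      have "ennreal ((a x)\<^sup>2) \<le> ennreal (2 * r + 2 * m)"
        using le real m by (simp add: ennreal_mult)
      then have "(a x)\<^sup>2 \<le> 2 * r + 2 * m" using real m by (subst (asm) ennreal_le_iff) auto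
      then have "(a x)\<^sup>2 \<le> 4 * r" using m by linarith
      then have "ennreal ((a x)\<^sup>2) \<le> ennreal (4 * r)" by (rule ennreal_leI)
      then show ?thesis using real by (simp add: ennreal_mult)
    next
      case top
      then show ?thesis by (simp add: ennreal_mult_top)
    qed
    then show ?thesis using True by simp
  qed simp
  have "(\<integral>\<^sup>+x. ennreal ((a x)\<^sup>2) * indicator {x. 4 * \<Lambda> / s ^ CARD('d) < (a x)\<^sup>2} x \<partial>torus) \<le> (\<integral>\<^sup>+x. 4 * D x \<partial>torus)"
    using pt by (intro nn_integral_mono)
  also have "\<dots> = 4 * (\<integral>\<^sup>+x. D x \<partial>torus)" by (rule nn_integral_cmult) (rule Dm)
  also have "\<dots> \<le> 4 * (ennreal (s\<^sup>2 * real CARD('d)) * F)"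
    unfolding D_def by (intro mult_left_mono mean_translation_estimate) (use est in auto)
  also have "\<dots> = ennreal (4 * s\<^sup>2 * real CARD('d)) * F"
    by (simp add: ennreal_mult mult.assoc)
  finally show ?thesis .
qed

text \<open>The number of \<open>j\<close> for which \<open>a(x)\<^sup>2\<close> exceeds the level \<open>4 \<Lambda> 2\<^sup>j\<^sup>d\<close> is at least
\<open>ln (a(x)\<^sup>2 / (4 \<Lambda>)) / (d ln 2)\<close>, so the left-hand side is bounded by \<open>d ln 2\<close> times the sum over
\<open>j\<close> of the masses above these levels. With \<open>s = 2\<^sup>-\<^sup>j\<close> they form a geometric series of ratio \<open>1/4\<close>.\<close>

lemma torus_log_Sobolev_tail:
  fixes a :: "real ^ 'd \<Rightarrow> real"
  assumes a [measurable]: "a \<in> borel_measurable borel" and per: "periodic a"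
    and mass: "(\<integral>\<^sup>+x. ennreal ((a x)\<^sup>2) \<partial>torus) \<le> ennreal \<Lambda>" and \<Lambda>: "0 < \<Lambda>"
    and est: "\<And>h. (\<integral>\<^sup>+x. ennreal ((a (x + h) - a x)\<^sup>2) \<partial>torus) \<le> ennreal ((norm h)\<^sup>2) * F"
  shows "(\<integral>\<^sup>+x. ennreal ((a x)\<^sup>2 * ln (max 1 ((a x)\<^sup>2 / (4 * \<Lambda>)))) \<partial>torus)
       \<le> ennreal (16 / 3 * (real CARD('d))\<^sup>2 * ln 2) * F"
proof -
  define d where "d = CARD('d)"
  have d: "0 < d" by (simp add: d_def)
  define s where "s j = (1 / 2 :: real) ^ j" for j :: nat
  have s: "0 < s j" "s j \<le> 1" for j by (auto simp: s_def power_le_one)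
  define A where "A j = {x. 4 * \<Lambda> / s j ^ d < (a x)\<^sup>2}" for j
  have A [measurable]: "A j \<in> sets borel" for j unfolding A_def by measurable
  let ?c = "ennreal (real d * ln 2)"
  let ?f = "\<lambda>j x. ?c * (ennreal ((a x)\<^sup>2) * indicator (A j) x)"
  have pt: "ennreal ((a x)\<^sup>2 * ln (max 1 ((a x)\<^sup>2 / (4 * \<Lambda>)))) \<le> (\<Sum>j. ?f j x)" for x
  proof (cases "1 < (a x)\<^sup>2 / (4 * \<Lambda>)")
    case True
    define L where "L = ln ((a x)\<^sup>2 / (4 * \<Lambda>))"
    have L: "0 < L" "exp L = (a x)\<^sup>2 / (4 * \<Lambda>)" using True by (auto simp: L_def)
    define N where "N = nat \<lceil>L / (real d * ln 2)\<rceil>"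
    have inA: "x \<in> A j" if "j < N" for j
    proof -
      have "real j < L / (real d * ln 2)" using that unfolding N_def by linarith
      then have "real (j * d) * ln 2 < L" using d by (simp add: field_simps)
      then have "exp (real (j * d) * ln 2) < exp L" by simp
      also have "exp (real (j * d) * ln 2) = 1 / s j ^ d"
      proof -
        have "exp (real (j * d) * ln 2) = exp (ln 2) ^ (j * d)" by (rule exp_of_nat_mult)
        then show ?thesis by (simp add: s_def power_mult[symmetric] power_one_over)
      qed
      finally have "1 / s j ^ d < (a x)\<^sup>2 / (4 * \<Lambda>)" using L by simp
      then show ?thesis using \<Lambda> by (simp add: A_def field_simps)
    qed
    have "L \<le> real N * (real d * ln 2)"
    proof -
      have "L / (real d * ln 2) \<le> real N" unfolding N_def by linarith
      then show ?thesis using d by (simp add: field_simps)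
    qed
    then have "(a x)\<^sup>2 * L \<le> (a x)\<^sup>2 * (real N * (real d * ln 2))" by (rule mult_left_mono) simp
    then have "ennreal ((a x)\<^sup>2 * L) \<le> ennreal ((a x)\<^sup>2 * (real N * (real d * ln 2)))" by (rule ennreal_leI)
    also have "\<dots> = (\<Sum>j<N. ?f j x)"
      using inA by (simp add: ennreal_mult ennreal_of_nat_eq_real_of_nat mult_ac)
    also have "\<dots> \<le> (\<Sum>j. ?f j x)" by (rule sum_le_suminf) auto
    finally show ?thesis using True by (simp add: L_def)
  qed simp
  have "(\<integral>\<^sup>+x. ennreal ((a x)\<^sup>2 * ln (max 1 ((a x)\<^sup>2 / (4 * \<Lambda>)))) \<partial>torus) \<le> (\<integral>\<^sup>+x. (\<Sum>j. ?f j x) \<partial>torus)"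
    using pt by (intro nn_integral_mono)
  also have "\<dots> = (\<Sum>j. \<integral>\<^sup>+x. ?f j x \<partial>torus)"
    by (rule nn_integral_suminf) (intro borel_measurable_torusI, measurable)
  also have "\<dots> = (\<Sum>j. ?c * (\<integral>\<^sup>+x. ennreal ((a x)\<^sup>2) * indicator (A j) x \<partial>torus))"
    by (intro suminf_cong nn_integral_cmult borel_measurable_torusI) measurable
  also have "\<dots> \<le> (\<Sum>j. ?c * (ennreal (4 * (s j)\<^sup>2 * real d) * F))"
    unfolding A_def d_def using mass \<Lambda> s
    by (intro suminf_le mult_left_mono high_level_mass_le[OF a per mass _ est]) auto
  also have "\<dots> = (\<Sum>j. ennreal (real d * ln 2 * (4 * (s j)\<^sup>2 * real d)) * F)"
    by (simp add: ennreal_mult mult.assoc)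
  also have "\<dots> = (\<Sum>j. ennreal (real d * ln 2 * (4 * (s j)\<^sup>2 * real d))) * F"
    by (rule ennreal_suminf_multc)
  also have "(\<Sum>j. ennreal (real d * ln 2 * (4 * (s j)\<^sup>2 * real d))) = ennreal (16 / 3 * (real CARD('d))\<^sup>2 * ln 2)"
  proof (rule suminf_ennreal_eq)
    have "(\<lambda>j. (1 / 4 :: real) ^ j) sums (1 / (1 - 1 / 4))" by (rule geometric_sums) simp
    then have "(\<lambda>j. (real d)\<^sup>2 * ln 2 * 4 * (1 / 4 :: real) ^ j) sums ((real d)\<^sup>2 * ln 2 * 4 * (1 / (1 - 1 / 4)))"
      by (rule sums_mult)
    moreover have "(s j)\<^sup>2 = (1 / 4) ^ j" for j
      by (simp add: s_def power_mult[symmetric] mult.commute[of j] power2_eq_square flip: power_mult_distrib)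
    ultimately show "(\<lambda>j. real d * ln 2 * (4 * (s j)\<^sup>2 * real d)) sums (16 / 3 * (real CARD('d))\<^sup>2 * ln 2)"
      by (simp add: d_def power2_eq_square mult_ac)
  qed simp
  finally show ?thesis .
qed

section \<open>Entropy, reaction and mean values\<close>

lemma lambda_B_nonneg: "0 < \<nu> \<Longrightarrow> 0 \<le> lambda_B \<nu>"
proof -
  assume \<nu>: "0 < \<nu>"
  have "ln (1 / \<nu>) \<le> 1 / \<nu> - 1" using \<nu> by (intro ln_le_minus_one) auto
  then have "- ln \<nu> \<le> 1 / \<nu> - 1" using \<nu> by (simp add: ln_div)
  then have "\<nu> * (- ln \<nu>) \<le> \<nu> * (1 / \<nu> - 1)" using \<nu> by (intro mult_left_mono) auto
  then show ?thesis using \<nu> by (simp add: lambda_B_def right_diff_distrib)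
qed

lemma lambda_B_le_square: "0 < \<nu> \<Longrightarrow> lambda_B \<nu> \<le> (\<nu> - 1)\<^sup>2"
proof -
  assume \<nu>: "0 < \<nu>"
  then have "\<nu> * ln \<nu> \<le> \<nu> * (\<nu> - 1)" by (intro mult_left_mono ln_le_minus_one) auto
  then show ?thesis by (simp add: lambda_B_def power2_eq_square algebra_simps)
qed

text \<open>Up to \<open>a\<^sup>2 = exp 1 * U\<close> the quadratic bound \<open>lambda_B \<nu> \<le> (\<nu> - 1)\<^sup>2\<close> is good enough. Above this
level \<open>ln (a\<^sup>2 / U) \<ge> 1\<close>, so the constant \<open>ln (U / C)\<close>, by which \<open>ln (a\<^sup>2 / C)\<close> and \<open>ln (a\<^sup>2 / U)\<close>
differ, can be absorbed into a factor.\<close>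

lemma lambda_B_le:
  assumes a: "0 < a" and C: "0 < C" and U: "C \<le> U"
  shows "lambda_B (a\<^sup>2 / C) \<le> (sqrt (exp 1 * U / C) + 1)\<^sup>2 / C * (a - sqrt C)\<^sup>2
           + (1 + ln (U / C)) / C * (a\<^sup>2 * ln (max 1 (a\<^sup>2 / U)))"
proof -
  have pos: "0 < a\<^sup>2" "0 < a\<^sup>2 / C" "0 < U" "0 \<le> ln (U / C)" using a C U by auto
  have log: "0 \<le> (1 + ln (U / C)) / C * (a\<^sup>2 * ln (max 1 (a\<^sup>2 / U)))"
    using pos C by (intro mult_nonneg_nonneg divide_nonneg_nonneg) auto
  show ?thesis
  proof (cases "a\<^sup>2 \<le> exp 1 * U")
    case True
    define r where "r = a / sqrt C"
    have r: "0 < r" "a\<^sup>2 / C = r\<^sup>2" using a C by (auto simp: r_def power_divide)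
    have "lambda_B (a\<^sup>2 / C) \<le> (r\<^sup>2 - 1)\<^sup>2" using lambda_B_le_square pos(2) r(2) by metis
    also have "\<dots> = (r + 1)\<^sup>2 * (r - 1)\<^sup>2" by (simp add: power2_eq_square algebra_simps)
    also have "\<dots> \<le> (sqrt (exp 1 * U / C) + 1)\<^sup>2 * (r - 1)\<^sup>2"
    proof (intro mult_right_mono power_mono add_mono)
      have "r\<^sup>2 \<le> exp 1 * U / C" using True C unfolding r(2)[symmetric] by (intro divide_right_mono) auto
      then show "r \<le> sqrt (exp 1 * U / C)" by (rule real_le_rsqrt)
    qed (use r in auto)
    also have "(r - 1)\<^sup>2 = (a - sqrt C)\<^sup>2 / C"
    proof -
      have "r - 1 = (a - sqrt C) / sqrt C" using C by (simp add: r_def diff_divide_distrib)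
      then show ?thesis using C by (simp add: power_divide)
    qed
    finally show ?thesis using log by simp
  next
    case False
    define L where "L = ln (a\<^sup>2 / U)"
    have big: "exp 1 < a\<^sup>2 / U" using False pos by (simp add: field_simps)
    then have L: "1 \<le> L" unfolding L_def using pos by (subst ln_ge_iff) auto
    have e1: "1 < (exp 1 :: real)" by simp
    have max: "max 1 (a\<^sup>2 / U) = a\<^sup>2 / U" using big e1 by (intro max_absorb2) linarith
    have "1 \<le> a\<^sup>2 / U" using big e1 by linarith
    also have "\<dots> \<le> a\<^sup>2 / C" using U C by (intro divide_left_mono) auto
    finally have "lambda_B (a\<^sup>2 / C) \<le> a\<^sup>2 / C * ln (a\<^sup>2 / C)" by (simp add: lambda_B_def)
    also have "ln (a\<^sup>2 / C) = L + ln (U / C)" using a C pos by (simp add: L_def ln_div)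
    also have "\<dots> \<le> (1 + ln (U / C)) * L"
      using mult_left_mono[OF L pos(4)] by (simp add: algebra_simps)
    then have "a\<^sup>2 / C * (L + ln (U / C)) \<le> a\<^sup>2 / C * ((1 + ln (U / C)) * L)"
      using pos by (intro mult_left_mono) auto
    also have "\<dots> = (1 + ln (U / C)) / C * (a\<^sup>2 * ln (max 1 (a\<^sup>2 / U)))"
      by (simp add: max L_def)
    finally show ?thesis using C by (simp add: add_increasing)
  qed
qed

text \<open>The dissipation of the reaction controls the distance of \<open>sqrt (n p / e) = a b\<close> from 1; here \<open>r\<close>
stands for \<open>a b\<close>.\<close>

lemma reaction_lower_bound:
  assumes r: "(0::real) < r"
  shows "(r - 1)\<^sup>2 \<le> (r\<^sup>2 - 1) * ln (r\<^sup>2)"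
proof -
  have sq: "(r\<^sup>2 - 1)\<^sup>2 = (r - 1)\<^sup>2 * (r + 1)\<^sup>2" by (simp add: power2_eq_square algebra_simps)
  show ?thesis
  proof (cases "1 \<le> r")
    case True
    have "ln (1 / r\<^sup>2) \<le> 1 / r\<^sup>2 - 1" using r by (intro ln_le_minus_one) auto
    then have ln: "1 - 1 / r\<^sup>2 \<le> ln (r\<^sup>2)" using r by (simp add: ln_div)
    have r1: "0 \<le> r\<^sup>2 - 1" using True by simp
    have "(r - 1)\<^sup>2 \<le> (r - 1)\<^sup>2 * ((r + 1)\<^sup>2 / r\<^sup>2)"
    proof -
      have "1 \<le> (r + 1)\<^sup>2 / r\<^sup>2" using r by (simp add: power_mono)
      then show ?thesis using mult_left_mono[of 1 "(r + 1)\<^sup>2 / r\<^sup>2" "(r - 1)\<^sup>2"] by simp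
    qed
    also have "\<dots> = (r\<^sup>2 - 1) * (1 - 1 / r\<^sup>2)"
      using sq r by (simp add: field_simps power2_eq_square)
    also have "\<dots> \<le> (r\<^sup>2 - 1) * ln (r\<^sup>2)" using ln r1 by (rule mult_left_mono)
    finally show ?thesis .
  next
    case False
    have "ln (r\<^sup>2) \<le> r\<^sup>2 - 1" using r by (intro ln_le_minus_one) auto
    moreover have "r\<^sup>2 - 1 \<le> 0" using False r by (simp add: power_le_one)
    ultimately have "(r\<^sup>2 - 1) * (r\<^sup>2 - 1) \<le> (r\<^sup>2 - 1) * ln (r\<^sup>2)" by (rule mult_left_mono_neg)
    moreover have "(r - 1)\<^sup>2 * 1 \<le> (r - 1)\<^sup>2 * (r + 1)\<^sup>2"
      using r by (intro mult_left_mono) auto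
    ultimately show ?thesis using sq by (simp add: power2_eq_square)
  qed
qed

text \<open>In the first quadrant \<open>(\<alpha>, \<beta>)\<close> is the only intersection of the hyperbolas \<open>X Y = 1\<close> and
\<open>X\<^sup>2 - Y\<^sup>2 = \<alpha>\<^sup>2 - \<beta>\<^sup>2\<close>. Writing \<open>p = X\<^sup>2 + Y\<^sup>2\<close> and
\<open>q = X\<^sup>2 - Y\<^sup>2\<close> we have \<open>p\<^sup>2 = q\<^sup>2 + 4 (X Y)\<^sup>2\<close>. In the difference of this identity for \<open>(X, Y)\<close>
and \<open>(\<alpha>, \<beta>)\<close> every term contains a factor bounded by \<open>p + p'\<close>, which cancels, so the bound is
linear for arbitrarily large deviations.\<close>

lemma hyperbola_stability:
  fixes X Y \<alpha> \<beta> :: real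
  assumes XY: "0 \<le> X" "0 \<le> Y" and pos: "0 < \<alpha>" "0 < \<beta>" "\<alpha> * \<beta> = 1"
    and prod: "\<bar>X * Y - 1\<bar> \<le> \<epsilon>" and diff: "\<bar>(X\<^sup>2 - Y\<^sup>2) - (\<alpha>\<^sup>2 - \<beta>\<^sup>2)\<bar> \<le> \<delta>"
  shows "\<bar>X - \<alpha>\<bar> \<le> (\<epsilon> + \<delta>) / \<alpha>" and "\<bar>Y - \<beta>\<bar> \<le> (\<epsilon> + \<delta>) / \<beta>"
proof -
  define p where "p = X\<^sup>2 + Y\<^sup>2"
  define p' where "p' = \<alpha>\<^sup>2 + \<beta>\<^sup>2"
  define q where "q = X\<^sup>2 - Y\<^sup>2"
  define q' where "q' = \<alpha>\<^sup>2 - \<beta>\<^sup>2"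
  have p: "0 \<le> p" "0 < p'" using pos by (auto simp: p_def p'_def intro: add_pos_pos)
  have "\<bar>x\<^sup>2 - y\<^sup>2\<bar> \<le> x\<^sup>2 + y\<^sup>2" for x y :: real
    using zero_le_power2[of x] zero_le_power2[of y] by linarith
  then have q: "\<bar>q\<bar> \<le> p" "\<bar>q'\<bar> \<le> p'" by (auto simp: p_def p'_def q_def q'_def)
  have XYp: "X * Y \<le> p / 2" using sum_squares_bound[of X Y] by (simp add: p_def)
  have 1: "1 \<le> p' / 2" using sum_squares_bound[of \<alpha> \<beta>] pos by (simp add: p'_def)
  have "(p - p') * (p + p') = (q - q') * (q + q') + 4 * ((X * Y - 1) * (X * Y + 1))"
  proof -
    have "p * p = q * q + 4 * (X * Y) * (X * Y)"
      by (simp add: p_def q_def power2_eq_square algebra_simps)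
    moreover have "p' * p' = q' * q' + 4 * (\<alpha> * \<beta>) * (\<alpha> * \<beta>)"
      by (simp add: p'_def q'_def power2_eq_square algebra_simps)
    ultimately show ?thesis using pos by (simp add: algebra_simps)
  qed
  then have "\<bar>p - p'\<bar> * (p + p') = \<bar>(q - q') * (q + q') + 4 * ((X * Y - 1) * (X * Y + 1))\<bar>"
    using p by (metis abs_mult abs_of_pos add_nonneg_pos)
  also have "\<dots> \<le> \<bar>q - q'\<bar> * \<bar>q + q'\<bar> + 4 * (\<bar>X * Y - 1\<bar> * \<bar>X * Y + 1\<bar>)"
    by (rule order_trans[OF abs_triangle_ineq]) (simp add: abs_mult)
  also have "\<dots> \<le> \<delta> * (p + p') + 4 * (\<epsilon> * ((p + p') / 2))"
    using q XYp 1 XY diff prod by (intro add_mono mult_mono) (auto simp: q_def q'_def)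
  also have "\<dots> = (\<delta> + 2 * \<epsilon>) * (p + p')" by (simp add: algebra_simps)
  finally have "\<bar>p - p'\<bar> \<le> \<delta> + 2 * \<epsilon>" using p by simp
  then have sq: "\<bar>X\<^sup>2 - \<alpha>\<^sup>2\<bar> \<le> \<epsilon> + \<delta>" "\<bar>Y\<^sup>2 - \<beta>\<^sup>2\<bar> \<le> \<epsilon> + \<delta>"
    using diff unfolding p_def p'_def by linarith+
  have root: "\<bar>x - c\<bar> \<le> e / c" if "0 \<le> x" "0 < c" "\<bar>x\<^sup>2 - c\<^sup>2\<bar> \<le> e" for x c e :: real
  proof -
    have "\<bar>x - c\<bar> * c \<le> \<bar>x - c\<bar> * (x + c)" using that by (intro mult_left_mono) auto
    also have "\<dots> = \<bar>x\<^sup>2 - c\<^sup>2\<bar>"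
    proof -
      have "x\<^sup>2 - c\<^sup>2 = (x - c) * (x + c)" by (simp add: power2_eq_square algebra_simps)
      then show ?thesis using that by (simp add: abs_mult)
    qed
    finally show ?thesis using that by (simp add: field_simps)
  qed
  show "\<bar>X - \<alpha>\<bar> \<le> (\<epsilon> + \<delta>) / \<alpha>" "\<bar>Y - \<beta>\<bar> \<le> (\<epsilon> + \<delta>) / \<beta>"
    using root XY pos sq by blast+
qed

lemma (in finite_measure) integrable_of_square_integrable:
  fixes f :: "'a \<Rightarrow> real"
  assumes [measurable]: "f \<in> borel_measurable M" and sq: "integrable M (\<lambda>x. (f x)\<^sup>2)"
  shows "integrable M f"
proof (rule Bochner_Integration.integrable_bound)
  show "integrable M (\<lambda>x. (f x)\<^sup>2 + 1)" using sq by auto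
  show "AE x in M. norm (f x) \<le> norm ((f x)\<^sup>2 + 1)"
  proof (intro AE_I2)
    fix x
    have "2 * \<bar>f x\<bar> \<le> (f x)\<^sup>2 + 1" using sum_squares_bound[of "\<bar>f x\<bar>" 1] by simp
    then show "norm (f x) \<le> norm ((f x)\<^sup>2 + 1)" by simp
  qed
qed simp

lemma integrable_mult_of_squares:
  fixes f g :: "'a \<Rightarrow> real"
  assumes [measurable]: "f \<in> borel_measurable M" "g \<in> borel_measurable M"
    and sq: "integrable M (\<lambda>x. (f x)\<^sup>2)" "integrable M (\<lambda>x. (g x)\<^sup>2)"
  shows "integrable M (\<lambda>x. f x * g x)"
    and "\<bar>\<integral>x. f x * g x \<partial>M\<bar> \<le> ((\<integral>x. (f x)\<^sup>2 \<partial>M) + (\<integral>x. (g x)\<^sup>2 \<partial>M)) / 2"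
proof -
  have le: "\<bar>f x * g x\<bar> \<le> ((f x)\<^sup>2 + (g x)\<^sup>2) / 2" for x
    using sum_squares_bound[of "\<bar>f x\<bar>" "\<bar>g x\<bar>"] by (simp add: abs_mult)
  show int: "integrable M (\<lambda>x. f x * g x)"
  proof (rule Bochner_Integration.integrable_bound)
    show "integrable M (\<lambda>x. ((f x)\<^sup>2 + (g x)\<^sup>2) / 2)" using sq by auto
    show "AE x in M. norm (f x * g x) \<le> norm (((f x)\<^sup>2 + (g x)\<^sup>2) / 2)"
      using le by (intro AE_I2) auto
  qed simp
  have "\<bar>\<integral>x. f x * g x \<partial>M\<bar> \<le> (\<integral>x. \<bar>f x * g x\<bar> \<partial>M)" by (rule integral_abs_bound)
  also have "\<dots> \<le> (\<integral>x. ((f x)\<^sup>2 + (g x)\<^sup>2) / 2 \<partial>M)"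
    using int sq le by (intro integral_mono) auto
  also have "\<dots> = ((\<integral>x. (f x)\<^sup>2 \<partial>M) + (\<integral>x. (g x)\<^sup>2 \<partial>M)) / 2" using sq by simp
  finally show "\<bar>\<integral>x. f x * g x \<partial>M\<bar> \<le> ((\<integral>x. (f x)\<^sup>2 \<partial>M) + (\<integral>x. (g x)\<^sup>2 \<partial>M)) / 2" .
qed

lemma (in finite_measure) square_integral_le:
  fixes f :: "'a \<Rightarrow> real"
  assumes f: "integrable M f" and sq: "integrable M (\<lambda>x. (f x)\<^sup>2)" and one: "measure M (space M) = 1"
  shows "(\<integral>x. f x \<partial>M)\<^sup>2 \<le> (\<integral>x. (f x)\<^sup>2 \<partial>M)"
    and "(\<integral>x. (f x - c)\<^sup>2 \<partial>M) = (\<integral>x. (f x - (\<integral>x. f x \<partial>M))\<^sup>2 \<partial>M) + ((\<integral>x. f x \<partial>M) - c)\<^sup>2"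
proof -
  define y where "y = (\<integral>x. f x \<partial>M)"
  have exp: "(\<integral>x. (f x - c)\<^sup>2 \<partial>M) = (\<integral>x. (f x)\<^sup>2 \<partial>M) - 2 * c * y + c\<^sup>2" for c
  proof -
    have "(\<integral>x. (f x - c)\<^sup>2 \<partial>M) = (\<integral>x. (f x)\<^sup>2 - 2 * c * f x + c\<^sup>2 \<partial>M)"
      by (simp add: power2_diff algebra_simps)
    also have "\<dots> = (\<integral>x. (f x)\<^sup>2 \<partial>M) - 2 * c * y + c\<^sup>2" using f sq one by (simp add: y_def)
    finally show ?thesis .
  qed
  show "(\<integral>x. (f x - c)\<^sup>2 \<partial>M) = (\<integral>x. (f x - (\<integral>x. f x \<partial>M))\<^sup>2 \<partial>M) + ((\<integral>x. f x \<partial>M) - c)\<^sup>2"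
    unfolding y_def[symmetric] exp by (simp add: power2_eq_square algebra_simps)
  have "0 \<le> (\<integral>x. (f x - y)\<^sup>2 \<partial>M)" by simp
  then show "(\<integral>x. f x \<partial>M)\<^sup>2 \<le> (\<integral>x. (f x)\<^sup>2 \<partial>M)"
    unfolding exp by (simp add: y_def[symmetric] power2_eq_square)
qed

text \<open>Applied with \<open>w = sqrt e\<close>, where \<open>w a\<^sup>2 = n\<close>, this says that the total charge is determined by
the mean of \<open>a\<close> up to \<open>O(z)\<close>. The only delicate terms are quadratic in the deviation of \<open>a\<close>;
since \<open>D = \<integral>(a - X)\<^sup>2\<close> is bounded both by \<open>z\<^sup>2\<close> and by \<open>S\<close>, it is at most \<open>sqrt S * z\<close>.\<close>

lemma (in finite_measure) weighted_mass_near_mean: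
  fixes a w :: "'a \<Rightarrow> real"
  assumes [measurable]: "a \<in> borel_measurable M" "w \<in> borel_measurable M"
    and one: "measure M (space M) = 1"
    and sq: "integrable M (\<lambda>x. (a x)\<^sup>2)" and S: "(\<integral>x. (a x)\<^sup>2 \<partial>M) \<le> S"
    and w: "AE x in M. 0 \<le> w x \<and> w x \<le> W" and \<omega>: "0 \<le> \<omega>" "\<omega> \<le> W"
    and X: "0 \<le> (\<integral>x. a x \<partial>M)"
    and Da: "(\<integral>x. (a x - (\<integral>x. a x \<partial>M))\<^sup>2 \<partial>M) \<le> z\<^sup>2"
    and Dw: "(\<integral>x. (w x - \<omega>)\<^sup>2 \<partial>M) \<le> z\<^sup>2" and z: "0 \<le> z"
  shows "integrable M (\<lambda>x. w x * (a x)\<^sup>2)"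
    and "\<bar>(\<integral>x. w x * (a x)\<^sup>2 \<partial>M) - \<omega> * (\<integral>x. a x \<partial>M)\<^sup>2\<bar> \<le> (3 * W * sqrt S + S) * z"
proof -
  define X where "X = (\<integral>x. a x \<partial>M)"
  define D where "D = (\<integral>x. (a x - X)\<^sup>2 \<partial>M)"
  have ia: "integrable M a" by (rule integrable_of_square_integrable) (use sq in auto)
  have ww: "AE x in M. \<bar>w x\<bar> \<le> W" "AE x in M. \<bar>w x - \<omega>\<bar> \<le> W"
  proof -
    show "AE x in M. \<bar>w x\<bar> \<le> W" using w by eventually_elim auto
    show "AE x in M. \<bar>w x - \<omega>\<bar> \<le> W" using w by eventually_elim (use \<omega> in linarith)
  qed
  have iw: "integrable M w" by (rule integrable_const_bound[of _ W]) (use ww in auto)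
  have iE: "integrable M (\<lambda>x. (w x - \<omega>)\<^sup>2)"
  proof (rule integrable_const_bound[of _ "W\<^sup>2"])
    show "AE x in M. norm ((w x - \<omega>)\<^sup>2) \<le> W\<^sup>2"
      using ww(2) by eventually_elim (simp add: abs_le_square_iff[symmetric])
  qed simp
  have iD: "integrable M (\<lambda>x. (a x - X)\<^sup>2)" unfolding power2_diff using sq ia by auto
  have wint: "integrable M (\<lambda>x. w x * f x)" if "integrable M f" for f :: "'a \<Rightarrow> real"
  proof (rule Bochner_Integration.integrable_bound)
    show "integrable M (\<lambda>x. W * f x)" using that by simp
    show "AE x in M. norm (w x * f x) \<le> norm (W * f x)"
      using ww(1) by eventually_elim (use \<omega> in \<open>auto simp: abs_mult intro!: mult_right_mono\<close>)
  qed (use that in measurable)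
  show "integrable M (\<lambda>x. w x * (a x)\<^sup>2)" by (rule wint[OF sq])
  have D0: "0 \<le> D" by (simp add: D_def)
  have X0: "0 \<le> X" using X by (simp add: X_def)
  have XS: "X\<^sup>2 \<le> S" using square_integral_le(1)[OF ia sq one] S by (simp add: X_def)
  have S0: "0 \<le> S" using XS by (rule order_trans[OF zero_le_power2])
  have XS': "X \<le> sqrt S" using XS by (rule real_le_rsqrt)
  have "(\<integral>x. (a x)\<^sup>2 \<partial>M) = D + X\<^sup>2"
    using square_integral_le(2)[OF ia sq one, of 0] by (simp add: D_def X_def)
  then have DS: "D \<le> S" using S zero_le_power2[of X] by linarith
  have small: "q \<le> r * z" if "0 \<le> q" "q \<le> r\<^sup>2" "q \<le> z\<^sup>2" "0 \<le> r" for q r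
  proof -
    have "q * q \<le> r\<^sup>2 * z\<^sup>2" using that by (intro mult_mono) auto
    then have "q\<^sup>2 \<le> (r * z)\<^sup>2" by (simp add: power2_eq_square algebra_simps)
    then show ?thesis using that z by (simp add: abs_le_square_iff[symmetric])
  qed
  have Dz: "D \<le> sqrt S * z" using DS S0 D0 Da by (intro small) (auto simp: D_def X_def)
  have cross: "integrable M (\<lambda>x. (w x - \<omega>) * (a x - X))" "\<bar>\<integral>x. (w x - \<omega>) * (a x - X) \<partial>M\<bar> \<le> W * z"
  proof -
    show "integrable M (\<lambda>x. (w x - \<omega>) * (a x - X))"
      by (rule integrable_mult_of_squares) (use iE iD in auto)
    have "\<bar>\<integral>x. (w x - \<omega>) * (a x - X) \<partial>M\<bar> \<le> (\<integral>x. W * \<bar>a x - X\<bar> \<partial>M)"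
    proof (rule order_trans[OF integral_abs_bound], rule integral_mono_AE)
      show "AE x in M. \<bar>(w x - \<omega>) * (a x - X)\<bar> \<le> W * \<bar>a x - X\<bar>"
        using ww(2) by eventually_elim (auto simp: abs_mult intro!: mult_right_mono)
    qed (use ia \<open>integrable M (\<lambda>x. (w x - \<omega>) * (a x - X))\<close> in auto)
    also have "\<dots> = W * (\<integral>x. \<bar>a x - X\<bar> \<partial>M)" by simp
    also have "(\<integral>x. \<bar>a x - X\<bar> \<partial>M) \<le> z"
    proof -
      have "(\<integral>x. \<bar>a x - X\<bar> \<partial>M)\<^sup>2 \<le> (\<integral>x. \<bar>a x - X\<bar>\<^sup>2 \<partial>M)"
        using ia iD one by (intro square_integral_le(1)) auto
      also have "\<dots> \<le> z\<^sup>2" using Da by (simp add: X_def)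
      finally show ?thesis using z by (simp add: abs_le_square_iff[symmetric])
    qed
    finally show "\<bar>\<integral>x. (w x - \<omega>) * (a x - X) \<partial>M\<bar> \<le> W * z" using \<omega> by (simp add: mult_left_mono)
  qed
  have lin: "\<bar>\<integral>x. w x - \<omega> \<partial>M\<bar> \<le> z"
  proof -
    have "(\<integral>x. w x - \<omega> \<partial>M)\<^sup>2 \<le> z\<^sup>2"
      using square_integral_le(1)[of "\<lambda>x. w x - \<omega>", OF _ iE one] iw Dw by auto
    then show ?thesis using z by (simp add: abs_le_square_iff[symmetric])
  qed
  have quad: "integrable M (\<lambda>x. w x * (a x - X)\<^sup>2)" "0 \<le> (\<integral>x. w x * (a x - X)\<^sup>2 \<partial>M)" "(\<integral>x. w x * (a x - X)\<^sup>2 \<partial>M) \<le> W * D"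
  proof -
    show "integrable M (\<lambda>x. w x * (a x - X)\<^sup>2)" by (rule wint[OF iD])
    show "0 \<le> (\<integral>x. w x * (a x - X)\<^sup>2 \<partial>M)"
      by (rule integral_nonneg_AE) (use w in \<open>auto elim!: eventually_mono\<close>)
    have "(\<integral>x. w x * (a x - X)\<^sup>2 \<partial>M) \<le> (\<integral>x. W * (a x - X)\<^sup>2 \<partial>M)"
    proof (rule integral_mono_AE)
      show "AE x in M. w x * (a x - X)\<^sup>2 \<le> W * (a x - X)\<^sup>2"
        using w by eventually_elim (auto intro!: mult_right_mono)
    qed (use wint[OF iD] iD in auto)
    then show "(\<integral>x. w x * (a x - X)\<^sup>2 \<partial>M) \<le> W * D" by (simp add: D_def)
  qed
  have split: "w x * (a x)\<^sup>2 - \<omega> * X\<^sup>2 = w x * (a x - X)\<^sup>2 + 2 * X * ((w x - \<omega>) * (a x - X)) + 2 * X * \<omega> * (a x - X) + X\<^sup>2 * (w x - \<omega>)" for x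
    by (simp add: power2_eq_square algebra_simps)
  have "(\<integral>x. w x * (a x)\<^sup>2 \<partial>M) - \<omega> * X\<^sup>2 = (\<integral>x. w x * (a x)\<^sup>2 - \<omega> * X\<^sup>2 \<partial>M)"
    using wint[OF sq] one by simp
  also have "\<dots> = (\<integral>x. w x * (a x - X)\<^sup>2 \<partial>M) + 2 * X * (\<integral>x. (w x - \<omega>) * (a x - X) \<partial>M)
       + 2 * X * \<omega> * (\<integral>x. a x - X \<partial>M) + X\<^sup>2 * (\<integral>x. w x - \<omega> \<partial>M)"
    unfolding split using quad cross ia iw by simp
  also have "(\<integral>x. a x - X \<partial>M) = 0" using ia one by (simp add: X_def)
  finally have "\<bar>(\<integral>x. w x * (a x)\<^sup>2 \<partial>M) - \<omega> * X\<^sup>2\<bar>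
      \<le> W * D + 2 * X * (W * z) + X\<^sup>2 * z"
  proof -
    assume eq: "(\<integral>x. w x * (a x)\<^sup>2 \<partial>M) - \<omega> * X\<^sup>2 = (\<integral>x. w x * (a x - X)\<^sup>2 \<partial>M) + 2 * X * (\<integral>x. (w x - \<omega>) * (a x - X) \<partial>M)
       + 2 * X * \<omega> * 0 + X\<^sup>2 * (\<integral>x. w x - \<omega> \<partial>M)"
    have "\<bar>2 * X * (\<integral>x. (w x - \<omega>) * (a x - X) \<partial>M)\<bar> \<le> 2 * X * (W * z)"
      using cross(2) X0 by (simp add: abs_mult mult_left_mono)
    moreover have "\<bar>X\<^sup>2 * (\<integral>x. w x - \<omega> \<partial>M)\<bar> \<le> X\<^sup>2 * z"
      unfolding abs_mult using lin by (simp add: mult_left_mono)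
    ultimately show ?thesis using eq quad by linarith
  qed
  also have "\<dots> \<le> W * (sqrt S * z) + 2 * sqrt S * (W * z) + S * z"
    using Dz XS XS' \<omega> z S0 by (intro add_mono mult_left_mono mult_right_mono) auto
  finally have "\<bar>(\<integral>x. w x * (a x)\<^sup>2 \<partial>M) - \<omega> * X\<^sup>2\<bar> \<le> (3 * W * sqrt S + S) * z" by (simp add: algebra_simps)
  then show "\<bar>(\<integral>x. w x * (a x)\<^sup>2 \<partial>M) - \<omega> * (\<integral>x. a x \<partial>M)\<^sup>2\<bar> \<le> (3 * W * sqrt S + S) * z"
    by (simp add: X_def)
qed

text \<open>The covariance \<open>\<integral>a b - X Y\<close> is quadratic in the deviations of \<open>a\<close> and \<open>b\<close>, which are bounded by
\<open>sqrt S * z\<close>.\<close>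

lemma (in finite_measure) product_mean:
  fixes a b :: "'a \<Rightarrow> real"
  assumes [measurable]: "a \<in> borel_measurable M" "b \<in> borel_measurable M"
    and one: "measure M (space M) = 1"
    and sqa: "integrable M (\<lambda>x. (a x)\<^sup>2)" "(\<integral>x. (a x)\<^sup>2 \<partial>M) \<le> S"
    and sqb: "integrable M (\<lambda>x. (b x)\<^sup>2)" "(\<integral>x. (b x)\<^sup>2 \<partial>M) \<le> S"
    and Da: "(\<integral>x. (a x - (\<integral>x. a x \<partial>M))\<^sup>2 \<partial>M) \<le> z\<^sup>2"
    and Db: "(\<integral>x. (b x - (\<integral>x. b x \<partial>M))\<^sup>2 \<partial>M) \<le> z\<^sup>2"
    and R: "integrable M (\<lambda>x. (a x * b x - 1)\<^sup>2)" "(\<integral>x. (a x * b x - 1)\<^sup>2 \<partial>M) \<le> z\<^sup>2" and z: "0 \<le> z"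
  shows "\<bar>(\<integral>x. a x \<partial>M) * (\<integral>x. b x \<partial>M) - 1\<bar> \<le> (sqrt S + 1) * z"
proof -
  define X where "X = (\<integral>x. a x \<partial>M)"
  define Y where "Y = (\<integral>x. b x \<partial>M)"
  have ia: "integrable M a" and ib: "integrable M b"
    by (rule integrable_of_square_integrable; use sqa sqb in simp)+
  have iDa: "integrable M (\<lambda>x. (a x - X)\<^sup>2)" and iDb: "integrable M (\<lambda>x. (b x - Y)\<^sup>2)"
    unfolding power2_diff using sqa sqb ia ib by auto
  have S0: "0 \<le> S" using sqa(2) by (rule order_trans[rotated]) simp
  have small: "(\<integral>x. (f x - (\<integral>x. f x \<partial>M))\<^sup>2 \<partial>M) \<le> sqrt S * z"
    if "integrable M f" "integrable M (\<lambda>x. (f x)\<^sup>2)" "(\<integral>x. (f x)\<^sup>2 \<partial>M) \<le> S"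
      "(\<integral>x. (f x - (\<integral>x. f x \<partial>M))\<^sup>2 \<partial>M) \<le> z\<^sup>2" for f :: "'a \<Rightarrow> real"
  proof -
    let ?D = "\<integral>x. (f x - (\<integral>x. f x \<partial>M))\<^sup>2 \<partial>M"
    have "(\<integral>x. (f x)\<^sup>2 \<partial>M) = ?D + (\<integral>x. f x \<partial>M)\<^sup>2"
      using square_integral_le(2)[OF that(1,2) one, of 0] by simp
    then have "?D \<le> S" using that(3) zero_le_power2[of "\<integral>x. f x \<partial>M"] by linarith
    then have "?D * ?D \<le> S * z\<^sup>2" using that(4) S0 by (intro mult_mono) auto
    then have "?D\<^sup>2 \<le> (sqrt S * z)\<^sup>2" using S0 by (simp add: power2_eq_square algebra_simps)
    then show ?thesis using z S0 by (simp add: abs_le_square_iff[symmetric])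
  qed
  have cov: "\<bar>\<integral>x. (a x - X) * (b x - Y) \<partial>M\<bar> \<le> sqrt S * z"
  proof -
    have "\<bar>\<integral>x. (a x - X) * (b x - Y) \<partial>M\<bar> \<le> ((\<integral>x. (a x - X)\<^sup>2 \<partial>M) + (\<integral>x. (b x - Y)\<^sup>2 \<partial>M)) / 2"
      by (rule integrable_mult_of_squares) (use iDa iDb in auto)
    then show ?thesis
      using small[OF ia sqa Da] small[OF ib sqb Db] by (simp add: X_def Y_def)
  qed
  have iab: "integrable M (\<lambda>x. a x * b x)"
    by (rule integrable_mult_of_squares) (use sqa sqb in auto)
  have "(\<integral>x. (a x - X) * (b x - Y) \<partial>M) = (\<integral>x. a x * b x - X * b x - Y * a x + X * Y \<partial>M)"
    by (intro Bochner_Integration.integral_cong) (auto simp: algebra_simps)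
  also have "\<dots> = (\<integral>x. a x * b x \<partial>M) - X * Y"
    using iab ia ib one by (simp add: X_def Y_def)
  also have "(\<integral>x. a x * b x \<partial>M) = (\<integral>x. a x * b x - 1 \<partial>M) + 1"
    using iab one by simp
  finally have eq: "X * Y - 1 = (\<integral>x. a x * b x - 1 \<partial>M) - (\<integral>x. (a x - X) * (b x - Y) \<partial>M)" by simp
  have "(\<integral>x. a x * b x - 1 \<partial>M)\<^sup>2 \<le> z\<^sup>2"
    using square_integral_le(1)[of "\<lambda>x. a x * b x - 1", OF _ R(1) one] iab R(2) by auto
  then have "\<bar>\<integral>x. a x * b x - 1 \<partial>M\<bar> \<le> z" using z by (simp add: abs_le_square_iff[symmetric])
  then have "\<bar>X * Y - 1\<bar> \<le> sqrt S * z + z" using eq cov by linarith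
  then show ?thesis by (simp add: X_def Y_def algebra_simps)
qed

section \<open>Root densities\<close>

lemma has_gradient_measurable:
  fixes v :: "real ^ 'd \<Rightarrow> real"
  assumes "has_gradient v g"
  shows "g \<in> borel_measurable torus"
proof (rule borel_measurable_LIMSEQ_metric)
  fix j :: nat
  have "has_weak_gradient (\<lambda>x. truncate (real (Suc j)) (v x)) (\<lambda>x. if \<bar>v x\<bar> < real (Suc j) then g x else 0)"
    using assms unfolding has_gradient_def by (metis of_nat_0_less_iff zero_less_Suc)
  then show "(\<lambda>x. if \<bar>v x\<bar> < real (Suc j) then g x else 0) \<in> borel_measurable torus"
    by (auto simp: has_weak_gradient_def)
next
  fix x
  obtain N where "\<bar>v x\<bar> < real N" using reals_Archimedean2 by blast
  then have "\<forall>\<^sub>F j in sequentially. (if \<bar>v x\<bar> < real (Suc j) then g x else 0) = g x"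
    by (intro eventually_sequentiallyI[of N]) auto
  then show "(\<lambda>j. if \<bar>v x\<bar> < real (Suc j) then g x else 0) \<longlonglongrightarrow> g x"
    by (rule tendsto_eventually)
qed

lemma nn_integral_le_divide:
  fixes f :: "'a \<Rightarrow> real"
  assumes [measurable]: "f \<in> borel_measurable M" and C: "0 < C" and P: "0 \<le> P"
    and le: "(\<integral>\<^sup>+x. ennreal (C * f x) \<partial>M) \<le> ennreal P"
  shows "(\<integral>\<^sup>+x. ennreal (f x) \<partial>M) \<le> ennreal (P / C)"
proof -
  have "(\<integral>\<^sup>+x. ennreal (f x) \<partial>M) = (\<integral>\<^sup>+x. ennreal (1 / C) * ennreal (C * f x) \<partial>M)"
    using C by (intro nn_integral_cong) (simp add: ennreal_mult'[symmetric])
  also have "\<dots> = ennreal (1 / C) * (\<integral>\<^sup>+x. ennreal (C * f x) \<partial>M)"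
    by (rule nn_integral_cmult) measurable
  also have "\<dots> \<le> ennreal (1 / C) * ennreal P" using le by (rule mult_left_mono) simp
  also have "\<dots> = ennreal (P / C)" using C P by (simp add: ennreal_mult'[symmetric])
  finally show ?thesis .
qed

lemma integral_le_of_nn_integral_le:
  fixes f :: "'a \<Rightarrow> real"
  assumes [measurable]: "f \<in> borel_measurable M" and nonneg: "\<And>x. 0 \<le> f x" and C: "0 \<le> C"
    and le: "(\<integral>\<^sup>+x. ennreal (f x) \<partial>M) \<le> ennreal C"
  shows "integrable M f" and "(\<integral>x. f x \<partial>M) \<le> C"
proof -
  have "(\<integral>\<^sup>+x. ennreal (f x) \<partial>M) < \<infinity>" using le by (rule le_less_trans) simp
  then show int: "integrable M f" using nonneg by (intro integrableI_nonneg) auto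
  have "ennreal (\<integral>x. f x \<partial>M) = (\<integral>\<^sup>+x. ennreal (f x) \<partial>M)"
    using int nonneg by (intro nn_integral_eq_integral[symmetric]) auto
  then have "ennreal (\<integral>x. f x \<partial>M) \<le> ennreal C" using le by simp
  then show "(\<integral>x. f x \<partial>M) \<le> C" using C by (simp add: ennreal_le_iff)
qed

text \<open>The chain rule with \<open>\<Phi> y = exp (y / 2)\<close> is applied to a Borel version \<open>v\<close> of
\<open>ln (n / sqrt e)\<close>, and \<open>a = \<Phi> \<circ> v\<close>. As \<open>\<phi>(v)\<^sup>2 = exp v / 4\<close>, the right-hand side of the
translation estimate is bounded by a multiple of the Fisher information of \<open>n\<close>.\<close>

lemma density_root:
  fixes n e :: "real ^ 'd \<Rightarrow> real"
  assumes n: "integrable torus n" and npos: "AE x in torus. 0 < n x"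
    and e [measurable]: "e \<in> borel_measurable torus" and e_lo: "0 < e_lo" "\<And>x. e_lo \<le> e x"
    and grad: "has_gradient (\<lambda>x. ln (n x / sqrt (e x))) g"
    and fisher: "(\<integral>\<^sup>+x. ennreal (n x * (norm (g x))\<^sup>2) \<partial>torus) \<le> ennreal F" and F: "0 \<le> F"
  obtains a where "a \<in> borel_measurable borel" "periodic a" "\<And>x. 0 < a x"
    "AE x in torus. (a x)\<^sup>2 = n x / sqrt (e x)"
    "\<And>h. (\<integral>\<^sup>+x. ennreal ((a (x + h) - a x)\<^sup>2) \<partial>torus) \<le> ennreal ((norm h)\<^sup>2) * ennreal (F / (4 * sqrt e_lo))"
    "(\<integral>\<^sup>+x. ennreal ((a x)\<^sup>2) \<partial>torus) \<le> ennreal (L1_norm n / sqrt e_lo)"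
proof -
  have [measurable]: "n \<in> borel_measurable torus" "g \<in> borel_measurable torus"
    using n has_gradient_measurable[OF grad] by auto
  obtain v where v [measurable]: "v \<in> borel_measurable borel" and vper: "periodic v"
    and vae: "AE x in torus. v x = ln (n x / sqrt (e x))"
    by (rule borel_periodic_version_real[of "\<lambda>x. ln (n x / sqrt (e x))"]) measurable
  define a where "a x = exp (v x / 2)" for x
  have [measurable]: "a \<in> borel_measurable borel" unfolding a_def by measurable
  have sq: "(a x)\<^sup>2 = exp (v x)" for x by (simp add: a_def exp_double[symmetric])
  have esq: "0 < sqrt (e x)" "sqrt e_lo \<le> sqrt (e x)" for x using e_lo(1) e_lo(2)[of x] by auto
  have ae: "AE x in torus. (a x)\<^sup>2 = n x / sqrt (e x)"
    using vae npos by eventually_elim (use esq in \<open>simp add: sq\<close>)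
  have le: "n x / sqrt (e x) \<le> n x / sqrt e_lo" if "0 < n x" for x
    using that esq[of x] e_lo by (intro divide_left_mono) auto
  show thesis
  proof (rule that[of a])
    show "periodic a" using vper by (simp add: periodic_def a_def)
    show "AE x in torus. (a x)\<^sup>2 = n x / sqrt (e x)" by (rule ae)
    fix h
    let ?w = "\<lambda>x. ln (n x / sqrt (e x))"
    have "(\<integral>\<^sup>+x. ennreal ((a (x + h) - a x)\<^sup>2) \<partial>torus)
      \<le> ennreal ((norm h)\<^sup>2) * (\<integral>\<^sup>+x. ennreal ((exp (?w x / 2) / 2)\<^sup>2 * (norm (g x))\<^sup>2) \<partial>torus)"
      unfolding a_def
      by (rule translation_estimate[OF v vper vae grad, where \<Phi> = "\<lambda>y. exp (y / 2)" and \<phi> = "\<lambda>y. exp (y / 2) / 2"])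
        (auto intro!: derivative_eq_intros continuous_intros)
    also have "\<dots> \<le> ennreal ((norm h)\<^sup>2) * (\<integral>\<^sup>+x. ennreal (1 / (4 * sqrt e_lo)) * ennreal (n x * (norm (g x))\<^sup>2) \<partial>torus)"
    proof (intro mult_left_mono nn_integral_mono_AE)
      show "AE x in torus. ennreal ((exp (?w x / 2) / 2)\<^sup>2 * (norm (g x))\<^sup>2) \<le> ennreal (1 / (4 * sqrt e_lo)) * ennreal (n x * (norm (g x))\<^sup>2)"
        using npos
      proof eventually_elim
        fix x assume pos: "0 < n x"
        have "(exp (?w x / 2) / 2)\<^sup>2 = exp (?w x) / 4"
          by (simp add: power_divide exp_double[symmetric])
        also have "\<dots> = n x / sqrt (e x) / 4" using pos esq[of x] by simp
        also have "\<dots> \<le> n x / sqrt e_lo / 4" using le[OF pos] by simp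
        finally have "(exp (?w x / 2) / 2)\<^sup>2 * (norm (g x))\<^sup>2 \<le> n x / sqrt e_lo / 4 * (norm (g x))\<^sup>2"
          by (rule mult_right_mono) simp
        also have "\<dots> = 1 / (4 * sqrt e_lo) * (n x * (norm (g x))\<^sup>2)" by simp
        finally show "ennreal ((exp (?w x / 2) / 2)\<^sup>2 * (norm (g x))\<^sup>2) \<le> ennreal (1 / (4 * sqrt e_lo)) * ennreal (n x * (norm (g x))\<^sup>2)"
          using e_lo pos by (simp add: ennreal_mult[symmetric] ennreal_leI)
      qed
    qed simp
    also have "\<dots> = ennreal ((norm h)\<^sup>2) * (ennreal (1 / (4 * sqrt e_lo)) * (\<integral>\<^sup>+x. ennreal (n x * (norm (g x))\<^sup>2) \<partial>torus))"
      by (subst nn_integral_cmult) auto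
    also have "\<dots> \<le> ennreal ((norm h)\<^sup>2) * (ennreal (1 / (4 * sqrt e_lo)) * ennreal F)"
      using fisher by (intro mult_left_mono) auto
    also have "ennreal (1 / (4 * sqrt e_lo)) * ennreal F = ennreal (F / (4 * sqrt e_lo))"
      using e_lo F by (simp add: ennreal_mult[symmetric])
    finally show "(\<integral>\<^sup>+x. ennreal ((a (x + h) - a x)\<^sup>2) \<partial>torus) \<le> ennreal ((norm h)\<^sup>2) * ennreal (F / (4 * sqrt e_lo))" .
  next
    have "(\<integral>\<^sup>+x. ennreal ((a x)\<^sup>2) \<partial>torus) \<le> (\<integral>\<^sup>+x. ennreal (\<bar>n x\<bar> / sqrt e_lo) \<partial>torus)"
      using ae npos by (intro nn_integral_mono_AE, eventually_elim) (auto intro!: ennreal_leI le)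
    also have "\<dots> = ennreal (\<integral>x. \<bar>n x\<bar> / sqrt e_lo \<partial>torus)"
      using n e_lo by (intro nn_integral_eq_integral) auto
    also have "(\<integral>x. \<bar>n x\<bar> / sqrt e_lo \<partial>torus) = L1_norm n / sqrt e_lo"
      by (simp add: L1_norm_def)
    finally show "(\<integral>\<^sup>+x. ennreal ((a x)\<^sup>2) \<partial>torus) \<le> ennreal (L1_norm n / sqrt e_lo)" .
  qed (auto simp: a_def)
qed

text \<open>Bound for the relative entropy of one species, when \<open>\<Lambda>\<close> bounds the mass of \<open>a\<^sup>2\<close>, \<open>f\<close> is the
constant in the translation estimate of \<open>a\<close> and \<open>r\<close> is the squared distance of the mean of \<open>a\<close> from \<open>sqrt C\<close>. The prefactors are
those of \<open>lambda_B_le\<close> for \<open>U = 4 \<Lambda>\<close>, the level from which on the logarithmic Sobolev inequality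
applies; the bound is homogeneous in \<open>(f, r)\<close>. The first argument only transports the dimension.\<close>

definition entropy_const :: "'d itself \<Rightarrow> real \<Rightarrow> real \<Rightarrow> real \<Rightarrow> real \<Rightarrow> real" where
  "entropy_const _ \<Lambda> C f r =
     (sqrt (exp 1 * (4 * \<Lambda>) / C) + 1)\<^sup>2 / C * (real CARD('d) * f + r)
     + (1 + ln (4 * \<Lambda> / C)) / C * (16 / 3 * (real CARD('d))\<^sup>2 * ln 2 * f)"

lemma entropy_const_scale: "entropy_const TYPE('d) \<Lambda> C f r * t = entropy_const TYPE('d) \<Lambda> C (f * t) (r * t)"
  by (simp add: entropy_const_def algebra_simps)

lemma entropy_const_mono:
  assumes "r \<le> r'" "0 < C"
  shows "entropy_const TYPE('d) \<Lambda> C f r \<le> entropy_const TYPE('d) \<Lambda> C f r'"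
  unfolding entropy_const_def using assms
  by (intro add_right_mono mult_left_mono divide_nonneg_nonneg) auto

lemma entropy_const_nonneg:
  assumes "0 < C" "C \<le> 4 * \<Lambda>" "0 \<le> f" "0 \<le> r"
  shows "0 \<le> entropy_const TYPE('d) \<Lambda> C f r"
  unfolding entropy_const_def using assms
  by (intro add_nonneg_nonneg mult_nonneg_nonneg divide_nonneg_nonneg) (auto intro!: ln_ge_zero)

text \<open>For the relative entropy, the quadratic part of \<open>lambda_B_le\<close> is the variance of \<open>a\<close> plus the
squared distance of its mean from \<open>sqrt C\<close>, and the logarithmic part is the tail controlled by
the logarithmic Sobolev inequality.\<close>

lemma root_density_estimates:
  fixes a :: "real ^ 'd \<Rightarrow> real"
  assumes a [measurable]: "a \<in> borel_measurable borel" and per: "periodic a" and pos: "\<And>x. 0 < a x"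
    and est: "\<And>h. (\<integral>\<^sup>+x. ennreal ((a (x + h) - a x)\<^sup>2) \<partial>torus) \<le> ennreal ((norm h)\<^sup>2) * ennreal f"
    and f: "0 \<le> f"
    and mass: "(\<integral>\<^sup>+x. ennreal ((a x)\<^sup>2) \<partial>torus) \<le> ennreal \<Lambda>" and \<Lambda>: "0 < \<Lambda>"
  shows "integrable torus (\<lambda>x. (a x)\<^sup>2)" and "(\<integral>x. (a x)\<^sup>2 \<partial>torus) \<le> \<Lambda>"
    and "(\<integral>x. (a x - (\<integral>x. a x \<partial>torus))\<^sup>2 \<partial>torus) \<le> real CARD('d) * f"
    and "0 < C \<Longrightarrow> C \<le> 4 * \<Lambda> \<Longrightarrow> (\<integral>\<^sup>+x. ennreal (lambda_B ((a x)\<^sup>2 / C)) \<partial>torus)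
          \<le> ennreal (entropy_const TYPE('d) \<Lambda> C f (((\<integral>x. a x \<partial>torus) - sqrt C)\<^sup>2))"
proof -
  have [measurable]: "a \<in> borel_measurable torus" by (rule borel_measurable_torusI) measurable
  show sq: "integrable torus (\<lambda>x. (a x)\<^sup>2)" and "(\<integral>x. (a x)\<^sup>2 \<partial>torus) \<le> \<Lambda>"
    using integral_le_of_nn_integral_le[OF _ _ _ mass] \<Lambda> by auto
  have int: "integrable torus a" by (rule torus.integrable_of_square_integrable) (use sq in auto)
  have "(\<integral>\<^sup>+x. ennreal ((a x - (\<integral>x. a x \<partial>torus))\<^sup>2) \<partial>torus) \<le> ennreal (real CARD('d)) * ennreal f"
    by (rule torus_Poincare[OF a per int est])
  also have "\<dots> = ennreal (real CARD('d) * f)" using f by (simp add: ennreal_mult)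
  finally have poinc: "(\<integral>\<^sup>+x. ennreal ((a x - (\<integral>x. a x \<partial>torus))\<^sup>2) \<partial>torus) \<le> ennreal (real CARD('d) * f)" .
  show var: "(\<integral>x. (a x - (\<integral>x. a x \<partial>torus))\<^sup>2 \<partial>torus) \<le> real CARD('d) * f"
    using integral_le_of_nn_integral_le(2)[OF _ _ _ poinc] f by auto
  assume C: "0 < C" "C \<le> 4 * \<Lambda>"
  define A where "A = (sqrt (exp 1 * (4 * \<Lambda>) / C) + 1)\<^sup>2 / C"
  define B where "B = (1 + ln (4 * \<Lambda> / C)) / C"
  have AB: "0 \<le> A" "0 \<le> B" using C by (auto simp: A_def B_def)
  have isq: "integrable torus (\<lambda>x. (a x - sqrt C)\<^sup>2)" unfolding power2_diff using sq int by auto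
  have "(\<integral>\<^sup>+x. ennreal (lambda_B ((a x)\<^sup>2 / C)) \<partial>torus)
      \<le> (\<integral>\<^sup>+x. ennreal (A * (a x - sqrt C)\<^sup>2) + ennreal B * ennreal ((a x)\<^sup>2 * ln (max 1 ((a x)\<^sup>2 / (4 * \<Lambda>)))) \<partial>torus)"
  proof (rule nn_integral_mono)
    fix x
    have "lambda_B ((a x)\<^sup>2 / C) \<le> A * (a x - sqrt C)\<^sup>2 + B * ((a x)\<^sup>2 * ln (max 1 ((a x)\<^sup>2 / (4 * \<Lambda>))))"
      unfolding A_def B_def by (rule lambda_B_le[OF pos C])
    then have "ennreal (lambda_B ((a x)\<^sup>2 / C)) \<le> ennreal (A * (a x - sqrt C)\<^sup>2 + B * ((a x)\<^sup>2 * ln (max 1 ((a x)\<^sup>2 / (4 * \<Lambda>)))))"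
      by (rule ennreal_leI)
    then show "ennreal (lambda_B ((a x)\<^sup>2 / C)) \<le> ennreal (A * (a x - sqrt C)\<^sup>2) + ennreal B * ennreal ((a x)\<^sup>2 * ln (max 1 ((a x)\<^sup>2 / (4 * \<Lambda>))))"
      using AB by (simp add: ennreal_mult ennreal_plus)
  qed
  also have "\<dots> = (\<integral>\<^sup>+x. ennreal (A * (a x - sqrt C)\<^sup>2) \<partial>torus)
      + ennreal B * (\<integral>\<^sup>+x. ennreal ((a x)\<^sup>2 * ln (max 1 ((a x)\<^sup>2 / (4 * \<Lambda>)))) \<partial>torus)"
    by (subst nn_integral_add) (auto simp: nn_integral_cmult)
  also have "(\<integral>\<^sup>+x. ennreal (A * (a x - sqrt C)\<^sup>2) \<partial>torus) = ennreal (\<integral>x. A * (a x - sqrt C)\<^sup>2 \<partial>torus)"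
    using isq AB by (intro nn_integral_eq_integral) auto
  also have "\<dots> \<le> ennreal (A * (real CARD('d) * f + ((\<integral>x. a x \<partial>torus) - sqrt C)\<^sup>2))"
  proof (rule ennreal_leI)
    have "(\<integral>x. (a x - sqrt C)\<^sup>2 \<partial>torus) \<le> real CARD('d) * f + ((\<integral>x. a x \<partial>torus) - sqrt C)\<^sup>2"
      using torus.square_integral_le(2)[OF int sq, of "sqrt C"] var by simp
    then show "(\<integral>x. A * (a x - sqrt C)\<^sup>2 \<partial>torus) \<le> A * (real CARD('d) * f + ((\<integral>x. a x \<partial>torus) - sqrt C)\<^sup>2)"
      using AB by (simp add: mult_left_mono)
  qed
  also have "ennreal B * (\<integral>\<^sup>+x. ennreal ((a x)\<^sup>2 * ln (max 1 ((a x)\<^sup>2 / (4 * \<Lambda>)))) \<partial>torus)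
      \<le> ennreal B * (ennreal (16 / 3 * (real CARD('d))\<^sup>2 * ln 2) * ennreal f)"
    by (intro mult_left_mono torus_log_Sobolev_tail[OF a per mass \<Lambda> est]) simp
  also have "ennreal B * (ennreal (16 / 3 * (real CARD('d))\<^sup>2 * ln 2) * ennreal f)
      = ennreal (B * (16 / 3 * (real CARD('d))\<^sup>2 * ln 2 * f))"
    using AB f by (simp add: ennreal_mult[symmetric])
  finally show "(\<integral>\<^sup>+x. ennreal (lambda_B ((a x)\<^sup>2 / C)) \<partial>torus)
      \<le> ennreal (entropy_const TYPE('d) \<Lambda> C f (((\<integral>x. a x \<partial>torus) - sqrt C)\<^sup>2))"
    using AB f by (simp add: entropy_const_def A_def[symmetric] B_def[symmetric] ennreal_plus[symmetric] add_mono del: ennreal_plus)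
qed

section \<open>Entropy and entropy production\<close>

lemma reaction_density_measurable [measurable]:
  fixes n p e :: "'a \<Rightarrow> real"
  assumes [measurable]: "n \<in> borel_measurable M" "p \<in> borel_measurable M" "e \<in> borel_measurable M"
  shows "(\<lambda>x. reaction_density (n x) (p x) (e x)) \<in> borel_measurable M"
  unfolding reaction_density_def by measurable

lemma reaction_density_ge:
  fixes n p e a b :: real
  assumes a: "0 < a" "a\<^sup>2 = n / sqrt e" and b: "0 < b" "b\<^sup>2 = p / sqrt e" and e: "0 < e_lo" "e_lo \<le> e"
  shows "ennreal (e_lo * (a * b - 1)\<^sup>2) \<le> reaction_density n p e"
proof -
  have e0: "0 < e" using e by linarith
  have np: "n * p = e * (a * b)\<^sup>2"
    using a b e0 by (simp add: power_mult_distrib)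
  have "e_lo * (a * b - 1)\<^sup>2 \<le> e * (((a * b)\<^sup>2 - 1) * ln ((a * b)\<^sup>2))"
    using a b e by (intro mult_mono reaction_lower_bound) auto
  also have "\<dots> = (n * p - e) * ln (n * p / e)"
    using e0 by (simp add: np algebra_simps)
  finally show ?thesis
    using a b e0 by (simp add: reaction_density_def np ennreal_leI)
qed

lemma has_gradient_gradient: "has_gradient v g \<Longrightarrow> has_gradient v (gradient v)"
  unfolding gradient_def by (rule someI[where P = "has_gradient v"])

text \<open>A finite production ensures that the gradients exist and, because the reaction density is
infinite where \<open>n p = 0\<close>, that both densities are positive almost everywhere. Each nonnegative
term of the production is bounded by the whole.\<close>

lemma production_controls:
  fixes n p e k :: "real ^ 'd \<Rightarrow> real"
  assumes c: "0 < c" and k_lo: "0 < k_lo" and \<kappa>: "0 < \<kappa>" and e_lo: "0 < e_lo"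
    and k: "k \<in> borel_measurable torus" "\<And>x. k_lo \<le> k x"
    and n: "integrable torus n" "\<And>x. 0 \<le> n x" and p: "integrable torus p" "\<And>x. 0 \<le> p x"
    and e: "integrable torus e" "\<And>x. e_lo \<le> e x \<and> e x \<le> e_hi"
    and P: "entropy_production \<kappa> c k n p e = ennreal P" "0 \<le> P"
  obtains gn gp ge where
    "has_gradient (\<lambda>x. ln (n x / sqrt (e x))) gn" "has_gradient (\<lambda>x. ln (p x / sqrt (e x))) gp" "has_gradient e ge"
    "(\<integral>\<^sup>+x. ennreal (n x * (norm (gn x))\<^sup>2) \<partial>torus) \<le> ennreal (P / \<kappa>)"
    "(\<integral>\<^sup>+x. ennreal (p x * (norm (gp x))\<^sup>2) \<partial>torus) \<le> ennreal (P / \<kappa>)"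
    "(\<integral>\<^sup>+x. ennreal ((norm (ge x))\<^sup>2) \<partial>torus) \<le> ennreal (P / (\<kappa> * c * sqrt e_lo / (4 * e_hi\<^sup>2)))"
    "AE x in torus. 0 < n x \<and> 0 < p x"
    "(\<integral>\<^sup>+x. ennreal k_lo * reaction_density (n x) (p x) (e x) \<partial>torus) \<le> ennreal P"
proof -
  let ?vn = "\<lambda>x. ln (n x / sqrt (e x))" and ?vp = "\<lambda>x. ln (p x / sqrt (e x))"
  define gn where "gn = gradient ?vn"
  define gp where "gp = gradient ?vp"
  define ge where "ge = gradient e"
  have ex: "(\<exists>g. has_gradient ?vn g) \<and> (\<exists>g. has_gradient ?vp g) \<and> (\<exists>g. has_gradient e g)"
  proof (rule ccontr)
    assume "\<not> ?thesis"
    then have "entropy_production \<kappa> c k n p e = \<infinity>" by (simp only: entropy_production_def Let_def if_False)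
    then show False using P by simp
  qed
  have grads: "has_gradient ?vn gn" "has_gradient ?vp gp" "has_gradient e ge"
    unfolding gn_def gp_def ge_def using ex has_gradient_gradient by blast+
  define I where "I x = n x * (norm (gn x))\<^sup>2 + p x * (norm (gp x))\<^sup>2
      + (n x + p x + c * sqrt (e x)) / 4 * (norm (ge x /\<^sub>R e x))\<^sup>2" for x
  have prod: "(\<integral>\<^sup>+x. ennreal (\<kappa> * I x) + ennreal (k x) * reaction_density (n x) (p x) (e x) \<partial>torus) = ennreal P"
    using P(1) unfolding entropy_production_def Let_def gn_def[symmetric] gp_def[symmetric] ge_def[symmetric] I_def
    by (simp only: ex simp_thms if_True)
  have [measurable]: "n \<in> borel_measurable torus" "p \<in> borel_measurable torus" "e \<in> borel_measurable torus" "k \<in> borel_measurable torus"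
    "gn \<in> borel_measurable torus" "gp \<in> borel_measurable torus" "ge \<in> borel_measurable torus"
    using n p e k grads by (auto intro: has_gradient_measurable)
  have e0: "0 < e x" "e x \<le> e_hi" "sqrt e_lo \<le> sqrt (e x)" "0 < sqrt (e x)" for x
    using e(2)[of x] e_lo by auto
  have part: "(\<integral>\<^sup>+x. ennreal (f x) \<partial>torus) \<le> ennreal (P / C)"
    if [measurable]: "f \<in> borel_measurable torus" and "0 < C" "\<And>x. C * f x \<le> \<kappa> * I x" for f C
  proof (rule nn_integral_le_divide)
    have "(\<integral>\<^sup>+x. ennreal (C * f x) \<partial>torus) \<le> (\<integral>\<^sup>+x. ennreal (\<kappa> * I x) + ennreal (k x) * reaction_density (n x) (p x) (e x) \<partial>torus)"
      using that(3) by (intro nn_integral_mono add_increasing2) (auto intro: ennreal_leI)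
    then show "(\<integral>\<^sup>+x. ennreal (C * f x) \<partial>torus) \<le> ennreal P" by (simp add: prod)
  qed (use that P in auto)
  have N0: "0 \<le> n x * (norm (gn x))\<^sup>2" "0 \<le> p x * (norm (gp x))\<^sup>2"
      "0 \<le> (n x + p x + c * sqrt (e x)) / 4 * (norm (ge x /\<^sub>R e x))\<^sup>2" for x
    using n(2)[of x] p(2)[of x] c e0(4)[of x]
    by (auto intro!: mult_nonneg_nonneg add_nonneg_nonneg)
  have 1: "(\<integral>\<^sup>+x. ennreal (n x * (norm (gn x))\<^sup>2) \<partial>torus) \<le> ennreal (P / \<kappa>)"
    using \<kappa> N0 by (intro part) (auto simp: I_def)
  have 2: "(\<integral>\<^sup>+x. ennreal (p x * (norm (gp x))\<^sup>2) \<partial>torus) \<le> ennreal (P / \<kappa>)"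
    using \<kappa> N0 by (intro part) (auto simp: I_def)
  have e_hi: "0 < e_hi" using e0[of 0] by linarith
  have 3: "(\<integral>\<^sup>+x. ennreal ((norm (ge x))\<^sup>2) \<partial>torus) \<le> ennreal (P / (\<kappa> * c * sqrt e_lo / (4 * e_hi\<^sup>2)))"
  proof (rule part)
    fix x
    have "(norm (ge x))\<^sup>2 / e_hi\<^sup>2 \<le> (norm (ge x))\<^sup>2 / (e x)\<^sup>2"
      using e0[of x] by (intro divide_left_mono power_mono) auto
    also have "\<dots> = (norm (ge x /\<^sub>R e x))\<^sup>2"
      by (simp add: power_mult_distrib divide_inverse power_inverse mult.commute)
    finally have g: "(norm (ge x))\<^sup>2 / e_hi\<^sup>2 \<le> (norm (ge x /\<^sub>R e x))\<^sup>2" .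
    have "c * sqrt e_lo \<le> n x + p x + c * sqrt (e x)"
      using n(2)[of x] p(2)[of x] mult_left_mono[OF e0(3)[of x], of c] c by linarith
    moreover have "0 \<le> n x + p x + c * sqrt (e x)"
      using n(2)[of x] p(2)[of x] c e0(4)[of x] by auto
    ultimately have "c * sqrt e_lo / 4 * ((norm (ge x))\<^sup>2 / e_hi\<^sup>2) \<le> (n x + p x + c * sqrt (e x)) / 4 * (norm (ge x /\<^sub>R e x))\<^sup>2"
      using g c e_lo by (intro mult_mono) (auto simp del: norm_scaleR)
    also have "\<dots> \<le> I x" unfolding I_def using N0(1,2)[of x] by linarith
    finally have "\<kappa> * (c * sqrt e_lo / 4 * ((norm (ge x))\<^sup>2 / e_hi\<^sup>2)) \<le> \<kappa> * I x"
      using \<kappa> by (intro mult_left_mono) auto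
    then show "\<kappa> * c * sqrt e_lo / (4 * e_hi\<^sup>2) * (norm (ge x))\<^sup>2 \<le> \<kappa> * I x"
      by (simp add: mult_ac)
  qed (use \<kappa> c e_lo e_hi in auto)
  have "(\<integral>\<^sup>+x. ennreal k_lo * reaction_density (n x) (p x) (e x) \<partial>torus)
      \<le> (\<integral>\<^sup>+x. ennreal (\<kappa> * I x) + ennreal (k x) * reaction_density (n x) (p x) (e x) \<partial>torus)"
    using k(2) by (intro nn_integral_mono add_increasing mult_right_mono ennreal_leI) auto
  then have 5: "(\<integral>\<^sup>+x. ennreal k_lo * reaction_density (n x) (p x) (e x) \<partial>torus) \<le> ennreal P" by (simp add: prod)
  have "AE x in torus. ennreal k_lo * reaction_density (n x) (p x) (e x) \<noteq> \<infinity>"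
  proof (rule nn_integral_PInf_AE)
    show "(\<integral>\<^sup>+x. ennreal k_lo * reaction_density (n x) (p x) (e x) \<partial>torus) \<noteq> \<infinity>"
      using le_less_trans[OF 5 ennreal_less_top] by auto
  qed measurable
  then have 4: "AE x in torus. 0 < n x \<and> 0 < p x"
  proof eventually_elim
    fix x assume "ennreal k_lo * reaction_density (n x) (p x) (e x) \<noteq> \<infinity>"
    then have "n x * p x \<noteq> 0" using k_lo by (auto simp: reaction_density_def ennreal_mult_top)
    then show "0 < n x \<and> 0 < p x" using n(2)[of x] p(2)[of x] by (auto simp: less_le)
  qed
  show thesis by (rule that[OF grads 1 2 3 4 5])
qed

lemma sqrt_diff_square_le:
  fixes x y :: real
  assumes "0 \<le> x" "0 < y"
  shows "(sqrt x - sqrt y)\<^sup>2 \<le> (x - y)\<^sup>2 / y"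
proof -
  have "(sqrt x - sqrt y)\<^sup>2 * y \<le> (sqrt x - sqrt y)\<^sup>2 * (sqrt x + sqrt y)\<^sup>2"
  proof (rule mult_left_mono)
    have "(sqrt y)\<^sup>2 \<le> (sqrt x + sqrt y)\<^sup>2" using assms by (intro power_mono) auto
    then show "y \<le> (sqrt x + sqrt y)\<^sup>2" using assms by simp
  qed simp
  also have "\<dots> = ((sqrt x)\<^sup>2 - (sqrt y)\<^sup>2)\<^sup>2"
    by (simp add: power2_eq_square algebra_simps)
  finally show ?thesis using assms by (simp add: field_simps)
qed

text \<open>Here \<open>\<Phi>\<close> is the identity: \<open>e\<close> itself satisfies the translation estimate, hence Poincare's
inequality around its mean \<open>E0\<close>.\<close>

lemma sqrt_energy_deviation_le:
  fixes e :: "real ^ 'd \<Rightarrow> real"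
  assumes e: "integrable torus e" "\<And>x. 0 \<le> e x" "(\<integral>x. e x \<partial>torus) = E0" "0 < E0"
    and grad: "has_gradient e g" and F: "(\<integral>\<^sup>+x. ennreal ((norm (g x))\<^sup>2) \<partial>torus) \<le> ennreal F" "0 \<le> F"
  shows "(\<integral>\<^sup>+x. ennreal ((sqrt (e x) - sqrt E0)\<^sup>2) \<partial>torus) \<le> ennreal (real CARD('d) * F / E0)"
proof -
  have [measurable]: "e \<in> borel_measurable torus" using e by auto
  obtain v where v [measurable]: "v \<in> borel_measurable borel" and vper: "periodic v"
    and vae: "AE x in torus. v x = e x"
    by (rule borel_periodic_version_real[of e]) measurable
  have vm [measurable]: "v \<in> borel_measurable torus" by (rule borel_measurable_torusI) measurable
  have vint: "integrable torus v" using e vae by (subst integrable_cong_AE[where g = e]) auto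
  have vmean: "(\<integral>x. v x \<partial>torus) = E0" using vae by (subst integral_cong_AE[where g = e]) (auto simp: e)
  have est: "(\<integral>\<^sup>+x. ennreal ((v (x + h) - v x)\<^sup>2) \<partial>torus) \<le> ennreal ((norm h)\<^sup>2) * ennreal F" for h
  proof -
    have "(\<integral>\<^sup>+x. ennreal ((v (x + h) - v x)\<^sup>2) \<partial>torus) \<le> ennreal ((norm h)\<^sup>2) * (\<integral>\<^sup>+x. ennreal (1\<^sup>2 * (norm (g x))\<^sup>2) \<partial>torus)"
      by (rule translation_estimate[OF v vper vae grad, where \<Phi> = "\<lambda>y. y" and \<phi> = "\<lambda>y. 1"]) auto
    also have "\<dots> \<le> ennreal ((norm h)\<^sup>2) * ennreal F" using F by (intro mult_left_mono) auto
    finally show ?thesis .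
  qed
  have "(\<integral>\<^sup>+x. ennreal (E0 * (sqrt (e x) - sqrt E0)\<^sup>2) \<partial>torus) \<le> (\<integral>\<^sup>+x. ennreal ((v x - (\<integral>x. v x \<partial>torus))\<^sup>2) \<partial>torus)"
  proof (rule nn_integral_mono_AE)
    show "AE x in torus. ennreal (E0 * (sqrt (e x) - sqrt E0)\<^sup>2) \<le> ennreal ((v x - (\<integral>x. v x \<partial>torus))\<^sup>2)"
      using vae by eventually_elim
        (use sqrt_diff_square_le[OF e(2) e(4)] e(4) in \<open>auto intro!: ennreal_leI simp: vmean field_simps\<close>)
  qed
  also have "\<dots> \<le> ennreal (real CARD('d)) * ennreal F" by (rule torus_Poincare[OF v vper vint est])
  also have "\<dots> = ennreal (real CARD('d) * F)" using F by (simp add: ennreal_mult)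
  finally show ?thesis using e F by (intro nn_integral_le_divide) auto
qed

text \<open>In the proof \<open>z\<^sup>2 = M P\<close> is a common bound of all the squared \<open>L\<^sup>2\<close> deviations, and \<open>D z\<close> is the
resulting bound for \<open>\<bar>X\<^sup>2 - C\<^sub>n\<bar>\<close> and \<open>\<bar>Y\<^sup>2 - C\<^sub>p\<bar>\<close>. The bound \<open>\<Lambda>\<close> of the masses is
enlarged by \<open>C\<^sub>n + C\<^sub>p\<close> so that \<open>4 \<Lambda>\<close> is above both of them, as \<open>lambda_B_le\<close> requires.\<close>

lemma entropy_le_production:
  fixes c k_lo \<kappa> e_lo e_hi E0 Cn Cp Nn Np :: real
  assumes c: "0 < c" and k_lo: "0 < k_lo" and \<kappa>: "0 < \<kappa>" and e_lo: "0 < e_lo" and e_hi: "0 < e_hi" and E0: "0 < E0"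
    and C: "0 < Cn" "0 < Cp" "Cn * Cp = 1" and N: "0 \<le> Nn" "0 \<le> Np"
  shows "\<exists>K>0. \<forall>k n p e :: real ^ 'd \<Rightarrow> real.
      k \<in> borel_measurable torus \<and> (\<forall>x. k_lo \<le> k x) \<and>
      integrable torus n \<and> (\<forall>x. 0 \<le> n x) \<and> integrable torus p \<and> (\<forall>x. 0 \<le> p x) \<and>
      integrable torus e \<and> (\<forall>x. e_lo \<le> e x \<and> e x \<le> e_hi) \<and>
      L1_norm n = Nn \<and> L1_norm p = Np \<and>
      (\<integral>x. n x - p x \<partial>torus) = (Cn - Cp) * sqrt E0 \<and> (\<integral>x. e x \<partial>torus) = E0 \<and>
      entropy_production \<kappa> c k n p e < \<infinity> \<longrightarrow>
      rel_entropy c Cn Cp E0 n p e \<le> ennreal K * entropy_production \<kappa> c k n p e"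
proof -
  define d where "d = real CARD('d)"
  define W where "W = sqrt e_hi + sqrt E0"
  define \<Lambda> where "\<Lambda> = Nn / sqrt e_lo + Np / sqrt e_lo + Cn + Cp"
  define f where "f = 1 / (4 * \<kappa> * sqrt e_lo)"
  define fe where "fe = d / (E0 * (\<kappa> * c * sqrt e_lo / (4 * e_hi\<^sup>2)))"
  define M where "M = d * f + fe + 1 / (k_lo * e_lo)"
  define D where "D = (sqrt \<Lambda> + 1) + 2 * (3 * W * sqrt \<Lambda> + \<Lambda>) / sqrt E0"
  define Kn where "Kn = Cn * sqrt e_hi * entropy_const TYPE('d) \<Lambda> Cn f (D\<^sup>2 * M / Cn)"
  define Kp where "Kp = Cp * sqrt e_hi * entropy_const TYPE('d) \<Lambda> Cp f (D\<^sup>2 * M / Cp)"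
  define Ke where "Ke = (c + Cn + Cp) / (2 * sqrt E0) * fe"
  have d0: "0 \<le> d" by (simp add: d_def)
  have \<Lambda>0: "0 < \<Lambda>" "Cn \<le> 4 * \<Lambda>" "Cp \<le> 4 * \<Lambda>" "Nn / sqrt e_lo \<le> \<Lambda>" "Np / sqrt e_lo \<le> \<Lambda>"
  proof -
    define qn where "qn = Nn / sqrt e_lo"
    define qp where "qp = Np / sqrt e_lo"
    have "0 \<le> qn" "0 \<le> qp" "\<Lambda> = qn + qp + Cn + Cp" using N e_lo by (auto simp: qn_def qp_def \<Lambda>_def)
    then show "0 < \<Lambda>" "Cn \<le> 4 * \<Lambda>" "Cp \<le> 4 * \<Lambda>" "Nn / sqrt e_lo \<le> \<Lambda>" "Np / sqrt e_lo \<le> \<Lambda>"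
      using C unfolding qn_def[symmetric] qp_def[symmetric] by linarith+
  qed
  have f0: "0 \<le> f" "0 \<le> fe" using \<kappa> c e_lo E0 d0 by (auto simp: f_def fe_def)
  have M0: "0 \<le> M" using f0 d0 k_lo e_lo by (auto simp: M_def)
  (* The summand 1 makes K positive without strict positivity of the other summands. *)
  define K where "K = Kn + Kp + Ke + 1"
  have K0: "0 < K"
  proof -
    have "0 \<le> Kn" "0 \<le> Kp" "0 \<le> Ke"
      unfolding Kn_def Kp_def Ke_def using C c E0 e_hi f0 M0 \<Lambda>0
      by (auto intro!: mult_nonneg_nonneg entropy_const_nonneg divide_nonneg_nonneg)
    then show ?thesis by (simp add: K_def)
  qed
  show ?thesis
  proof (intro exI[of _ K] conjI K0 allI impI, elim conjE)
    fix k n p e :: "real ^ 'd \<Rightarrow> real"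
    assume k: "k \<in> borel_measurable torus" "\<forall>x. k_lo \<le> k x"
      and n: "integrable torus n" "\<forall>x. 0 \<le> n x" and p: "integrable torus p" "\<forall>x. 0 \<le> p x"
      and e: "integrable torus e" "\<forall>x. e_lo \<le> e x \<and> e x \<le> e_hi"
      and L1: "L1_norm n = Nn" "L1_norm p = Np"
      and charge: "(\<integral>x. n x - p x \<partial>torus) = (Cn - Cp) * sqrt E0" and energy: "(\<integral>x. e x \<partial>torus) = E0"
      and fin: "entropy_production \<kappa> c k n p e < \<infinity>"
    obtain P where P: "entropy_production \<kappa> c k n p e = ennreal P" "0 \<le> P"
      using fin by (cases "entropy_production \<kappa> c k n p e") auto
    have e0: "0 < e x" "e_lo \<le> e x" "0 < sqrt (e x)" "sqrt (e x) \<le> sqrt e_hi" "0 \<le> e x" for x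
      using e(2)[rule_format, of x] e_lo by auto
    have [measurable]: "n \<in> borel_measurable torus" "p \<in> borel_measurable torus" "e \<in> borel_measurable torus"
      using n p e by auto
    obtain gn gp ge where grads: "has_gradient (\<lambda>x. ln (n x / sqrt (e x))) gn" "has_gradient (\<lambda>x. ln (p x / sqrt (e x))) gp" "has_gradient e ge"
      and fn: "(\<integral>\<^sup>+x. ennreal (n x * (norm (gn x))\<^sup>2) \<partial>torus) \<le> ennreal (P / \<kappa>)"
      and fp: "(\<integral>\<^sup>+x. ennreal (p x * (norm (gp x))\<^sup>2) \<partial>torus) \<le> ennreal (P / \<kappa>)"
      and fe: "(\<integral>\<^sup>+x. ennreal ((norm (ge x))\<^sup>2) \<partial>torus) \<le> ennreal (P / (\<kappa> * c * sqrt e_lo / (4 * e_hi\<^sup>2)))"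
      and pos: "AE x in torus. 0 < n x \<and> 0 < p x"
      and react: "(\<integral>\<^sup>+x. ennreal k_lo * reaction_density (n x) (p x) (e x) \<partial>torus) \<le> ennreal P"
      by (rule production_controls[OF c k_lo \<kappa> e_lo, of k n p e e_hi P])
        (use k n p e P in auto)
    have em: "e \<in> borel_measurable torus" by measurable
    have F0: "0 \<le> P / \<kappa>" using P \<kappa> by simp
    have fP: "P / \<kappa> / (4 * sqrt e_lo) = f * P" by (simp add: f_def mult_ac)
    have posn: "AE x in torus. 0 < n x" and posp: "AE x in torus. 0 < p x"
      using pos by (auto elim: eventually_mono)
    obtain a where am [measurable]: "a \<in> borel_measurable borel" and aper: "periodic a" and apos: "\<And>x. 0 < a x"
      and aa: "AE x in torus. (a x)\<^sup>2 = n x / sqrt (e x)"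
      and aest: "\<And>h. (\<integral>\<^sup>+x. ennreal ((a (x + h) - a x)\<^sup>2) \<partial>torus) \<le> ennreal ((norm h)\<^sup>2) * ennreal (f * P)"
      and amass: "(\<integral>\<^sup>+x. ennreal ((a x)\<^sup>2) \<partial>torus) \<le> ennreal (Nn / sqrt e_lo)"
      by (rule density_root[OF n(1) posn em e_lo e0(2) grads(1) fn F0, unfolded fP L1]) (rule that)
    obtain b where bm [measurable]: "b \<in> borel_measurable borel" and bper: "periodic b" and bpos: "\<And>x. 0 < b x"
      and bb: "AE x in torus. (b x)\<^sup>2 = p x / sqrt (e x)"
      and best: "\<And>h. (\<integral>\<^sup>+x. ennreal ((b (x + h) - b x)\<^sup>2) \<partial>torus) \<le> ennreal ((norm h)\<^sup>2) * ennreal (f * P)"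
      and bmass: "(\<integral>\<^sup>+x. ennreal ((b x)\<^sup>2) \<partial>torus) \<le> ennreal (Np / sqrt e_lo)"
      by (rule density_root[OF p(1) posp em e_lo e0(2) grads(2) fp F0, unfolded fP L1]) (rule that)
    have [measurable]: "a \<in> borel_measurable torus" "b \<in> borel_measurable torus"
      by (auto intro: borel_measurable_torusI)
    have fP0: "0 \<le> f * P" using f0 P by simp
    have amass': "(\<integral>\<^sup>+x. ennreal ((a x)\<^sup>2) \<partial>torus) \<le> ennreal \<Lambda>"
      and bmass': "(\<integral>\<^sup>+x. ennreal ((b x)\<^sup>2) \<partial>torus) \<le> ennreal \<Lambda>"
      using order_trans[OF amass ennreal_leI] order_trans[OF bmass ennreal_leI] \<Lambda>0 by auto
    note A = root_density_estimates[OF am aper apos aest fP0 amass' \<Lambda>0(1)]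
    note B = root_density_estimates[OF bm bper bpos best fP0 bmass' \<Lambda>0(1)]
    define X where "X = (\<integral>x. a x \<partial>torus)"
    define Y where "Y = (\<integral>x. b x \<partial>torus)"
    have XY0: "0 \<le> X" "0 \<le> Y"
      unfolding X_def Y_def using apos bpos by (auto intro!: integral_nonneg simp: less_imp_le)
    define z where "z = sqrt (M * P)"
    have z: "0 \<le> z" "z\<^sup>2 = M * P" using M0 P by (auto simp: z_def)
    have small: "q \<le> z\<^sup>2" if "q \<le> m * P" "m \<le> M" for q m
      using that(1) mult_right_mono[OF that(2) P(2)] z(2) by linarith
    have Mparts: "d * f \<le> M" "fe \<le> M" "1 / (k_lo * e_lo) \<le> M"
    proof -
      have "0 \<le> d * f" "0 \<le> fe" "0 \<le> 1 / (k_lo * e_lo)" using f0 d0 k_lo e_lo by auto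
      then show "d * f \<le> M" "fe \<le> M" "1 / (k_lo * e_lo) \<le> M" unfolding M_def by linarith+
    qed
    have Da: "(\<integral>x. (a x - (\<integral>x. a x \<partial>torus))\<^sup>2 \<partial>torus) \<le> z\<^sup>2"
      using A(3) Mparts by (intro small[of _ "d * f"]) (auto simp: d_def mult_ac)
    have Db: "(\<integral>x. (b x - (\<integral>x. b x \<partial>torus))\<^sup>2 \<partial>torus) \<le> z\<^sup>2"
      using B(3) Mparts by (intro small[of _ "d * f"]) (auto simp: d_def mult_ac)
    have w_dev: "(\<integral>\<^sup>+x. ennreal ((sqrt (e x) - sqrt E0)\<^sup>2) \<partial>torus) \<le> ennreal (fe * P)"
    proof -
      have "(\<integral>\<^sup>+x. ennreal ((sqrt (e x) - sqrt E0)\<^sup>2) \<partial>torus)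
         \<le> ennreal (real CARD('d) * (P / (\<kappa> * c * sqrt e_lo / (4 * e_hi\<^sup>2))) / E0)"
        by (rule sqrt_energy_deviation_le[OF e(1) e0(5) energy E0 grads(3) fe]) (use P \<kappa> c e_lo in auto)
      then show ?thesis by (simp add: fe_def d_def mult_ac)
    qed
    have feP: "0 \<le> fe * P" using f0 P by simp
    have Dw: "(\<integral>x. (sqrt (e x) - sqrt E0)\<^sup>2 \<partial>torus) \<le> z\<^sup>2"
      using integral_le_of_nn_integral_le(2)[OF _ _ feP w_dev] Mparts by (intro small[of _ fe]) auto
    have reac: "(\<integral>\<^sup>+x. ennreal ((a x * b x - 1)\<^sup>2) \<partial>torus) \<le> ennreal (P / (k_lo * e_lo))"
    proof (rule nn_integral_le_divide)
      have "(\<integral>\<^sup>+x. ennreal (k_lo * e_lo * (a x * b x - 1)\<^sup>2) \<partial>torus)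
          \<le> (\<integral>\<^sup>+x. ennreal k_lo * reaction_density (n x) (p x) (e x) \<partial>torus)"
      proof (rule nn_integral_mono_AE)
        show "AE x in torus. ennreal (k_lo * e_lo * (a x * b x - 1)\<^sup>2) \<le> ennreal k_lo * reaction_density (n x) (p x) (e x)"
          using aa bb
        proof eventually_elim
          fix x assume "(a x)\<^sup>2 = n x / sqrt (e x)" "(b x)\<^sup>2 = p x / sqrt (e x)"
          then have "ennreal (e_lo * (a x * b x - 1)\<^sup>2) \<le> reaction_density (n x) (p x) (e x)"
            by (intro reaction_density_ge apos bpos e_lo e0)
          then have "ennreal k_lo * ennreal (e_lo * (a x * b x - 1)\<^sup>2) \<le> ennreal k_lo * reaction_density (n x) (p x) (e x)"
            by (rule mult_left_mono) simp
          then show "ennreal (k_lo * e_lo * (a x * b x - 1)\<^sup>2) \<le> ennreal k_lo * reaction_density (n x) (p x) (e x)"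
            using k_lo e_lo by (simp add: ennreal_mult[symmetric] mult.assoc)
        qed
      qed
      then show "(\<integral>\<^sup>+x. ennreal (k_lo * e_lo * (a x * b x - 1)\<^sup>2) \<partial>torus) \<le> ennreal P"
        using react by (rule order_trans)
    qed (use k_lo e_lo P in auto)
    have reacP: "0 \<le> P / (k_lo * e_lo)" using P k_lo e_lo by simp
    have R: "integrable torus (\<lambda>x. (a x * b x - 1)\<^sup>2)" "(\<integral>x. (a x * b x - 1)\<^sup>2 \<partial>torus) \<le> z\<^sup>2"
      using integral_le_of_nn_integral_le[OF _ _ reacP reac] Mparts
      by (auto intro!: small[of _ "1 / (k_lo * e_lo)"])
    have prod: "\<bar>X * Y - 1\<bar> \<le> (sqrt \<Lambda> + 1) * z"
      unfolding X_def Y_def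
      by (rule torus.product_mean) (use A(1,2) B(1,2) Da Db R z in auto)
    have w: "AE x in torus. 0 \<le> sqrt (e x) \<and> sqrt (e x) \<le> W"
      using e0(3,4) E0 unfolding W_def by (intro AE_I2) (smt (verit) real_sqrt_ge_zero)
    have \<omega>: "0 \<le> sqrt E0" "sqrt E0 \<le> W" using E0 e_hi by (auto simp: W_def)
    have massa: "integrable torus (\<lambda>x. sqrt (e x) * (a x)\<^sup>2)"
        "\<bar>(\<integral>x. sqrt (e x) * (a x)\<^sup>2 \<partial>torus) - sqrt E0 * X\<^sup>2\<bar> \<le> (3 * W * sqrt \<Lambda> + \<Lambda>) * z"
      using torus.weighted_mass_near_mean[OF _ _ _ A(1,2) w \<omega> _ Da Dw z(1)] XY0 by (auto simp: X_def)
    have massb: "integrable torus (\<lambda>x. sqrt (e x) * (b x)\<^sup>2)"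
        "\<bar>(\<integral>x. sqrt (e x) * (b x)\<^sup>2 \<partial>torus) - sqrt E0 * Y\<^sup>2\<bar> \<le> (3 * W * sqrt \<Lambda> + \<Lambda>) * z"
      using torus.weighted_mass_near_mean[OF _ _ _ B(1,2) w \<omega> _ Db Dw z(1)] XY0 by (auto simp: Y_def)
    have na: "(\<integral>x. sqrt (e x) * (a x)\<^sup>2 \<partial>torus) = (\<integral>x. n x \<partial>torus)"
      by (rule integral_cong_AE) (use aa e0(3) in \<open>auto elim!: eventually_mono simp: less_imp_neq[symmetric]\<close>)
    have pb: "(\<integral>x. sqrt (e x) * (b x)\<^sup>2 \<partial>torus) = (\<integral>x. p x \<partial>torus)"
      by (rule integral_cong_AE) (use bb e0(3) in \<open>auto elim!: eventually_mono simp: less_imp_neq[symmetric]\<close>)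
    have C': "(sqrt Cn)\<^sup>2 = Cn" "(sqrt Cp)\<^sup>2 = Cp" "0 < sqrt Cn" "0 < sqrt Cp" "sqrt Cn * sqrt Cp = 1"
      using C by (auto simp: real_sqrt_mult[symmetric])
    (* Conservation of charge, rewritten in terms of the means. *)
    have diff: "\<bar>(X\<^sup>2 - Y\<^sup>2) - ((sqrt Cn)\<^sup>2 - (sqrt Cp)\<^sup>2)\<bar> \<le> 2 * (3 * W * sqrt \<Lambda> + \<Lambda>) / sqrt E0 * z"
    proof -
      have "(\<integral>x. n x \<partial>torus) - (\<integral>x. p x \<partial>torus) = (Cn - Cp) * sqrt E0" using charge n p by simp
      then have "\<bar>sqrt E0 * X\<^sup>2 - sqrt E0 * Y\<^sup>2 - (Cn - Cp) * sqrt E0\<bar> \<le> 2 * ((3 * W * sqrt \<Lambda> + \<Lambda>) * z)"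
        using massa(2) massb(2) na pb by linarith
      also have "sqrt E0 * X\<^sup>2 - sqrt E0 * Y\<^sup>2 - (Cn - Cp) * sqrt E0 = sqrt E0 * ((X\<^sup>2 - Y\<^sup>2) - (Cn - Cp))"
        by (simp add: algebra_simps)
      finally have "sqrt E0 * \<bar>(X\<^sup>2 - Y\<^sup>2) - (Cn - Cp)\<bar> \<le> 2 * ((3 * W * sqrt \<Lambda> + \<Lambda>) * z)"
        using E0 by (simp add: abs_mult)
      then show ?thesis using E0 by (simp add: C' field_simps)
    qed
    note near = hyperbola_stability[OF XY0 C'(3-5) prod diff]
    have Dz: "(sqrt \<Lambda> + 1) * z + 2 * (3 * W * sqrt \<Lambda> + \<Lambda>) / sqrt E0 * z = D * z"
      by (simp add: D_def distrib_right)
    have sq_le: "(x - sqrt c)\<^sup>2 \<le> D\<^sup>2 * M / c * P" if "\<bar>x - sqrt c\<bar> \<le> D * z / sqrt c" "0 < c" for x c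
    proof -
      have "(x - sqrt c)\<^sup>2 \<le> (D * z / sqrt c)\<^sup>2"
        using that(1) by (metis abs_ge_zero power2_abs power_mono)
      then show ?thesis using that(2) z(2) by (simp add: power_divide power_mult_distrib mult_ac)
    qed
    have Xn: "(X - sqrt Cn)\<^sup>2 \<le> D\<^sup>2 * M / Cn * P" and Yp: "(Y - sqrt Cp)\<^sup>2 \<le> D\<^sup>2 * M / Cp * P"
      using sq_le[OF near(1)[unfolded Dz] C(1)] sq_le[OF near(2)[unfolded Dz] C(2)] .
    have Hn: "(\<integral>\<^sup>+x. ennreal (lambda_B ((a x)\<^sup>2 / Cn)) \<partial>torus) \<le> ennreal (entropy_const TYPE('d) \<Lambda> Cn f (D\<^sup>2 * M / Cn) * P)"
      unfolding entropy_const_scale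
      by (rule order_trans[OF A(4)[OF C(1) \<Lambda>0(2)]]) (intro ennreal_leI entropy_const_mono, use Xn C in \<open>auto simp: X_def\<close>)
    have Hp: "(\<integral>\<^sup>+x. ennreal (lambda_B ((b x)\<^sup>2 / Cp)) \<partial>torus) \<le> ennreal (entropy_const TYPE('d) \<Lambda> Cp f (D\<^sup>2 * M / Cp) * P)"
      unfolding entropy_const_scale
      by (rule order_trans[OF B(4)[OF C(2) \<Lambda>0(3)]]) (intro ennreal_leI entropy_const_mono, use Yp C in \<open>auto simp: Y_def\<close>)
    have lm [measurable]: "lambda_B \<in> borel_measurable borel" unfolding lambda_B_def by measurable
    define cE where "cE = (c + Cn + Cp) / (2 * sqrt E0)"
    have cE0: "0 \<le> cE" using c C E0 by (simp add: cE_def)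
    have "rel_entropy c Cn Cp E0 n p e \<le> (\<integral>\<^sup>+x. ennreal (Cn * sqrt e_hi) * ennreal (lambda_B ((a x)\<^sup>2 / Cn))
        + ennreal (Cp * sqrt e_hi) * ennreal (lambda_B ((b x)\<^sup>2 / Cp)) + ennreal cE * ennreal ((sqrt (e x) - sqrt E0)\<^sup>2) \<partial>torus)"
      unfolding rel_entropy_def Let_def cE_def[symmetric]
    proof (rule nn_integral_mono_AE)
      show "AE x in torus. ennreal (Cn * sqrt (e x) * lambda_B (n x / (Cn * sqrt (e x))) + Cp * sqrt (e x) * lambda_B (p x / (Cp * sqrt (e x)))
            + cE * (sqrt (e x) - sqrt E0)\<^sup>2)
          \<le> ennreal (Cn * sqrt e_hi) * ennreal (lambda_B ((a x)\<^sup>2 / Cn))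
        + ennreal (Cp * sqrt e_hi) * ennreal (lambda_B ((b x)\<^sup>2 / Cp)) + ennreal cE * ennreal ((sqrt (e x) - sqrt E0)\<^sup>2)"
        using aa bb
      proof eventually_elim
        fix x assume ax: "(a x)\<^sup>2 = n x / sqrt (e x)" and bx: "(b x)\<^sup>2 = p x / sqrt (e x)"
        have ln: "0 \<le> lambda_B ((a x)\<^sup>2 / Cn)" and lp: "0 \<le> lambda_B ((b x)\<^sup>2 / Cp)"
          using apos[of x] bpos[of x] C by (auto intro!: lambda_B_nonneg)
        have "n x / (Cn * sqrt (e x)) = (a x)\<^sup>2 / Cn" "p x / (Cp * sqrt (e x)) = (b x)\<^sup>2 / Cp"
          by (simp_all add: ax bx mult.commute)
        then have "Cn * sqrt (e x) * lambda_B (n x / (Cn * sqrt (e x))) + Cp * sqrt (e x) * lambda_B (p x / (Cp * sqrt (e x)))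
            + cE * (sqrt (e x) - sqrt E0)\<^sup>2
          \<le> Cn * sqrt e_hi * lambda_B ((a x)\<^sup>2 / Cn) + Cp * sqrt e_hi * lambda_B ((b x)\<^sup>2 / Cp)
            + cE * (sqrt (e x) - sqrt E0)\<^sup>2"
          using ln lp C e0(4)[of x] by (auto intro!: add_mono mult_right_mono mult_left_mono)
        then have "ennreal (Cn * sqrt (e x) * lambda_B (n x / (Cn * sqrt (e x))) + Cp * sqrt (e x) * lambda_B (p x / (Cp * sqrt (e x)))
            + cE * (sqrt (e x) - sqrt E0)\<^sup>2)
          \<le> ennreal (Cn * sqrt e_hi * lambda_B ((a x)\<^sup>2 / Cn) + Cp * sqrt e_hi * lambda_B ((b x)\<^sup>2 / Cp)
            + cE * (sqrt (e x) - sqrt E0)\<^sup>2)"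
          by (rule ennreal_leI)
        then show "ennreal (Cn * sqrt (e x) * lambda_B (n x / (Cn * sqrt (e x))) + Cp * sqrt (e x) * lambda_B (p x / (Cp * sqrt (e x)))
            + cE * (sqrt (e x) - sqrt E0)\<^sup>2)
          \<le> ennreal (Cn * sqrt e_hi) * ennreal (lambda_B ((a x)\<^sup>2 / Cn))
        + ennreal (Cp * sqrt e_hi) * ennreal (lambda_B ((b x)\<^sup>2 / Cp)) + ennreal cE * ennreal ((sqrt (e x) - sqrt E0)\<^sup>2)"
          using ln lp C e_hi cE0 by (simp add: ennreal_mult[symmetric] ennreal_plus[symmetric] del: ennreal_plus)
      qed
    qed
    also have "\<dots> = ennreal (Cn * sqrt e_hi) * (\<integral>\<^sup>+x. ennreal (lambda_B ((a x)\<^sup>2 / Cn)) \<partial>torus)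
        + ennreal (Cp * sqrt e_hi) * (\<integral>\<^sup>+x. ennreal (lambda_B ((b x)\<^sup>2 / Cp)) \<partial>torus)
        + ennreal cE * (\<integral>\<^sup>+x. ennreal ((sqrt (e x) - sqrt E0)\<^sup>2) \<partial>torus)"
      by (simp add: nn_integral_add nn_integral_cmult)
    also have "\<dots> \<le> ennreal (Cn * sqrt e_hi) * ennreal (entropy_const TYPE('d) \<Lambda> Cn f (D\<^sup>2 * M / Cn) * P)
        + ennreal (Cp * sqrt e_hi) * ennreal (entropy_const TYPE('d) \<Lambda> Cp f (D\<^sup>2 * M / Cp) * P)
        + ennreal cE * ennreal (fe * P)"
      using Hn Hp w_dev by (intro add_mono mult_left_mono) auto
    also have "\<dots> = ennreal ((Kn + Kp + Ke) * P)"
    proof -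
      have "0 \<le> entropy_const TYPE('d) \<Lambda> Cn f (D\<^sup>2 * M / Cn)" "0 \<le> entropy_const TYPE('d) \<Lambda> Cp f (D\<^sup>2 * M / Cp)"
        using C \<Lambda>0 f0 M0 by (auto intro!: entropy_const_nonneg)
      moreover have Ke: "Ke = cE * fe" by (simp add: Ke_def cE_def)
      ultimately show ?thesis
        using C e_hi cE0 P f0
        by (simp add: Kn_def Kp_def Ke ennreal_mult[symmetric] ennreal_plus[symmetric] algebra_simps del: ennreal_plus)
    qed
    also have "\<dots> \<le> ennreal (K * P)"
      using P e_hi by (intro ennreal_leI mult_right_mono) (auto simp: K_def)
    also have "\<dots> = ennreal K * entropy_production \<kappa> c k n p e"
      using K0 P by (simp add: ennreal_mult)
    finally show "rel_entropy c Cn Cp E0 n p e \<le> ennreal K * entropy_production \<kappa> c k n p e" .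
  qed
qed

text \<open>The bound above is uniform in \<open>n\<close>, \<open>p\<close>, \<open>e\<close> and \<open>k\<close>; it remains to recover \<open>C\<^sub>n\<close> and \<open>C\<^sub>p\<close> from the
arguments \<open>n\<^sup>* = C\<^sub>n sqrt e\<^sup>*\<close> and \<open>p\<^sup>* = C\<^sub>p sqrt e\<^sup>*\<close> of the constant.\<close>

theorem proposition6p2:
  fixes c k_lo k_hi :: real
  assumes "c > 0" and "0 < k_lo" and "k_lo \<le> k_hi"
  shows "\<exists>K :: real \<Rightarrow> real \<Rightarrow> real \<Rightarrow> real \<Rightarrow> real \<Rightarrow> real \<Rightarrow> real \<Rightarrow> real \<Rightarrow> real.
    \<forall>\<kappa> e_lo e_hi E0 C0 Cn Cp :: real. \<forall>k n p e :: real ^ 'd \<Rightarrow> real.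
      \<kappa> > 0 \<and> 0 < e_lo \<and> e_lo < e_hi \<and> E0 > 0 \<and>
      Cn > 0 \<and> Cp > 0 \<and> Cn * Cp = 1 \<and> Cn - Cp = C0 / sqrt E0 \<and>
      periodic k \<and> k \<in> borel_measurable torus \<and> (\<forall>x. k_lo \<le> k x \<and> k x \<le> k_hi) \<and>
      periodic n \<and> integrable torus n \<and> (\<forall>x. 0 \<le> n x) \<and>
      periodic p \<and> integrable torus p \<and> (\<forall>x. 0 \<le> p x) \<and>
      periodic e \<and> integrable torus e \<and> (\<forall>x. e_lo \<le> e x \<and> e x \<le> e_hi) \<and>
      (\<integral>x. n x - p x \<partial>torus) = C0 \<and> (\<integral>x. e x \<partial>torus) = E0 \<and>
      rel_entropy c Cn Cp E0 n p e < \<infinity> \<and> entropy_production \<kappa> c k n p e < \<infinity>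
      \<longrightarrow>
      0 < K \<kappa> (L1_norm n) (L1_norm p) (Cn * sqrt E0) (Cp * sqrt E0) e_lo e_hi E0 \<and>
      rel_entropy c Cn Cp E0 n p e
        \<le> ennreal (K \<kappa> (L1_norm n) (L1_norm p) (Cn * sqrt E0) (Cp * sqrt E0) e_lo e_hi E0)
            * entropy_production \<kappa> c k n p e"
proof -
  define good where "good K \<kappa> Nn Np Cn Cp e_lo e_hi E0 \<longleftrightarrow> 0 < K \<and> (\<forall>k n p e :: real ^ 'd \<Rightarrow> real.
      k \<in> borel_measurable torus \<and> (\<forall>x. k_lo \<le> k x) \<and>
      integrable torus n \<and> (\<forall>x. 0 \<le> n x) \<and> integrable torus p \<and> (\<forall>x. 0 \<le> p x) \<and>
      integrable torus e \<and> (\<forall>x. e_lo \<le> e x \<and> e x \<le> e_hi) \<and>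
      L1_norm n = Nn \<and> L1_norm p = Np \<and>
      (\<integral>x. n x - p x \<partial>torus) = (Cn - Cp) * sqrt E0 \<and> (\<integral>x. e x \<partial>torus) = E0 \<and>
      entropy_production \<kappa> c k n p e < \<infinity> \<longrightarrow>
      rel_entropy c Cn Cp E0 n p e \<le> ennreal K * entropy_production \<kappa> c k n p e)"
    for K \<kappa> Nn Np Cn Cp e_lo e_hi E0 :: real
  define K where "K \<kappa> Nn Np ns ps e_lo e_hi E0 = (SOME K. good K \<kappa> Nn Np (ns / sqrt E0) (ps / sqrt E0) e_lo e_hi E0)"
    for \<kappa> Nn Np ns ps e_lo e_hi E0
  show ?thesis
  proof (intro exI[of _ K] allI impI, elim conjE)
    fix \<kappa> e_lo e_hi E0 C0 Cn Cp :: real and k n p e :: "real ^ 'd \<Rightarrow> real"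
    assume pos: "0 < \<kappa>" "0 < e_lo" "e_lo < e_hi" "0 < E0"
      and C: "0 < Cn" "0 < Cp" "Cn * Cp = 1" "Cn - Cp = C0 / sqrt E0"
      and k: "k \<in> borel_measurable torus" "\<forall>x. k_lo \<le> k x \<and> k x \<le> k_hi"
      and n: "integrable torus n" "\<forall>x. 0 \<le> n x" and p: "integrable torus p" "\<forall>x. 0 \<le> p x"
      and e: "integrable torus e" "\<forall>x. e_lo \<le> e x \<and> e x \<le> e_hi"
      and cons: "(\<integral>x. n x - p x \<partial>torus) = C0" "(\<integral>x. e x \<partial>torus) = E0"
      and fin: "entropy_production \<kappa> c k n p e < \<infinity>"
    have e_hi: "0 < e_hi" using pos by simp
    have L1: "0 \<le> L1_norm n" "0 \<le> L1_norm p" by (simp_all add: L1_norm_def)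
    have "\<exists>K. good K \<kappa> (L1_norm n) (L1_norm p) Cn Cp e_lo e_hi E0"
      using entropy_le_production[OF assms(1,2) pos(1,2) e_hi pos(4) C(1,2,3) L1, where 'd = 'd]
      unfolding good_def by blast
    then have "good (SOME K. good K \<kappa> (L1_norm n) (L1_norm p) Cn Cp e_lo e_hi E0)
        \<kappa> (L1_norm n) (L1_norm p) Cn Cp e_lo e_hi E0"
      by (rule someI_ex)
    then have "good (K \<kappa> (L1_norm n) (L1_norm p) (Cn * sqrt E0) (Cp * sqrt E0) e_lo e_hi E0)
        \<kappa> (L1_norm n) (L1_norm p) Cn Cp e_lo e_hi E0"
      using pos(4) by (simp add: K_def)
    moreover have "(\<integral>x. n x - p x \<partial>torus) = (Cn - Cp) * sqrt E0" using cons C pos by simp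
    ultimately show "0 < K \<kappa> (L1_norm n) (L1_norm p) (Cn * sqrt E0) (Cp * sqrt E0) e_lo e_hi E0 \<and>
      rel_entropy c Cn Cp E0 n p e
        \<le> ennreal (K \<kappa> (L1_norm n) (L1_norm p) (Cn * sqrt E0) (Cp * sqrt E0) e_lo e_hi E0)
            * entropy_production \<kappa> c k n p e"
      using k n p e cons fin unfolding good_def by blast
  qed
qed

end
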